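(* Let $\omega\in\mathbb{R}^n$ and $s_0>0$. Let $\mathbf{a},\mathbf{b}$ be positive, decreasing, integrable functions on $J_0=[0,+\infty)$ and write $\bar{\mathbf a}(t)=\int_t^{+\infty}\mathbf a(\tau)\,d\tau$, $\bar{\mathbf b}(t)=\int_t^{+\infty}\mathbf b(\tau)\,d\tau$. Assume that there exist $\upsilon\ge 0$ and a constant $\Lambda$ such that, for all $t\ge\upsilon$, $$\bar{\mathbf a}(t)\le\Lambda\,\mathbf b(t),\qquad \bar{\mathbf a}(t)\,\mathbf b(t)\le\Lambda\,\mathbf a(t)\,\bar{\mathbf b}(t).$$ Let $H:\mathbb{T}^n\times B\times J_0\to\mathbb{R}$ be a time-dependent Hamiltonian of the form $H(q,p,t)=h(q,p,t)+f(q,p,t)$ such that $h\in\mathcal{K}_\omega$; $h,f\in\mathcal{A}^0_{s_0}$; $\sup_{t\in J_0}|f_0^t|_{s_0}<\infty$; $\sup_{t\in J_0}|\partial_p^2H^t|_{s_0}<\infty$; and, for all $t\in J_0$, $$|(\partial_qf)_0^t|_{s_0}\le\mathbf a(t),\qquad |(\partial_pf)_0^t|_{s_0}\le\mathbf b(t).$$ Then there exist $\tilde h\in\mathcal{K}_\omega$ and a Lagrangian analytic asymptotic KAM torus $\varphi^t$ associated to $(X_H,X_{\tilde h},\varphi_0)$, where $\varphi_0:\mathbb{T}^n\to\mathbb{T}^n\times B$, $\varphi_0(q)=(q,0)$.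
   Context: $\mathbb{T}^n=\mathbb{R}^n/\mathbb{Z}^n$; $B\subset\mathbb{R}^n$ is a (sufficiently large) ball centred at the origin; $J_\upsilon=[\upsilon,+\infty)$. $X_H=(\partial_pH,-\partial_qH)$ is the Hamiltonian vector field of $H$, and likewise for $X_{\tilde h}$. For a function $f$ of $(q,p,t)$, $f^t(q,p)=f(q,p,t)$, $f_0(q,t)=f(q,0,t)$, $f_0^t(q)=f(q,0,t)$; similarly for $(\partial_qf)_0$, $(\partial_pf)_0$. For $s>0$, $\mathbb{T}^n_s=\{q\in\mathbb{C}^n/\mathbb{Z}^n:|\operatorname{Im}q|\le s\}$ and $B_s=\{p\in\mathbb{C}^n:|p|\le s\}$. With $D_s=\mathbb{T}^n_s\times B_s$ or $\mathbb{T}^n_s$, according to the variables of the function, a real analytic function is identified with its real (i.e. real-valued at real points), bounded, holomorphic extension to $D_s$, and $|f|_s=\sup_{z\in D_s}|f(z)|$ (maximum over the components for vector- and matrix-valued functions). $\mathcal{A}^\upsilon_s$ is the space of functions $f$ continuous on $\mathbb{T}^n_s\times B_s\times J_\upsilon$ such that $f^t$ is real analytic on $\mathbb{T}^n_s\times B_s$ for all $t\in J_\upsilon$. $\mathcal{K}_\omega$ is the set of Hamiltonians $h:\mathbb{T}^n\times B\times J_0\to\mathbb{R}$ in $\omega$-Kolmogorov normal form: there is $c\in\mathbb{R}$ with $h(q,0,t)=c$ and $\partial_ph(q,0,t)=\omega$ for all $(q,t)\in\mathbb{T}^n\times J_0$. Analytic asymptotic KAM torus: let $X^t,X_0^t$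 be real analytic time-dependent vector fields on $\mathcal{P}=\mathbb{T}^n\times B$, for all $t\in J_\upsilon$ (some $\upsilon\ge 0$), and $\varphi_0:\mathbb{T}^n\to\mathcal{P}$ a real analytic embedding with, for some $s>0$, (i) $\lim_{t\to+\infty}|X^t-X_0^t|_s=0$ and (ii) $X_0(\varphi_0(q),t)=\partial_q\varphi_0(q)\omega$ for all $(q,t)\in\mathbb{T}^n\times J_\upsilon$. A family of real analytic embeddings $\varphi^t:\mathbb{T}^n\to\mathcal{P}$ is an analytic asymptotic KAM torus associated to $(X,X_0,\varphi_0)$ if there are $0<s'\le s$ and $\upsilon'\ge\upsilon$ such that $\lim_{t\to+\infty}|\varphi^t-\varphi_0|_{s'}=0$ and $X(\varphi(q,t),t)=\partial_q\varphi(q,t)\omega+\partial_t\varphi(q,t)$ for all $(q,t)\in\mathbb{T}^n\times J_{\upsilon'}$, where $\varphi(q,t)=\varphi^t(q)$. It is Lagrangian if $\varphi^t(\mathbb{T}^n)$ is Lagrangian in $\mathbb{T}^n\times B$ (with the standard symplectic form $dp\wedge dq$) for all $t\in J_{\upsilon'}$. Being associated to $(X,X_0,\varphi_0)$ includes the requirement that (i) and (ii) hold. *)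

theory Defs
  imports "HOL-Analysis.Analysis"
begin

text \<open>
  Objects on \<open>T^n = R^n / Z^n\<close> are represented by their lifts to \<open>R^n\<close>: functions become
  \<open>Z^n\<close>-periodic functions, and points of \<open>T^n \<times> B\<close> become pairs \<open>(q, p)\<close> modulo \<open>Z^n \<times> {0}\<close>.
  A time-dependent \<open>f\<close> takes the time first, so that \<open>f t\<close> is the function written \<open>f^t\<close>.
\<close>

type_synonym 'n phase = "(real ^ 'n) \<times> (real ^ 'n)"
type_synonym 'n cphase = "(complex ^ 'n) \<times> (complex ^ 'n)"

definition int_lattice :: "(real ^ 'n) set" where
  "int_lattice = {k. \<forall>i. k $ i \<in> \<int>}"

definition phase_lattice :: "'n::finite phase set" where
  "phase_lattice = int_lattice \<times> {0}"

definition cvec :: "real ^ 'n \<Rightarrow> complex ^ 'n" where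
  "cvec x = (\<chi> i. complex_of_real (x $ i))"

definition cpair :: "'n::finite phase \<Rightarrow> 'n cphase" where
  "cpair = map_prod cvec cvec"

definition scale_vec :: "complex \<Rightarrow> complex ^ 'n \<Rightarrow> complex ^ 'n" where
  "scale_vec c v = c *s v"

definition scale_pair :: "complex \<Rightarrow> 'n::finite cphase \<Rightarrow> 'n cphase" where
  "scale_pair c = map_prod (scale_vec c) (scale_vec c)"

definition strip :: "real \<Rightarrow> (complex ^ 'n) set" where
  "strip s = {q. norm (\<chi> i. Im (q $ i)) \<le> s}"

definition strip_ball :: "real \<Rightarrow> 'n::finite cphase set" where
  "strip_ball s = strip s \<times> cball 0 s"

text \<open>
  The next notions are used both on \<open>C^n\<close> and on \<open>C^n \<times> C^n\<close>; \<open>sc\<close> is the complex scalar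
  multiplication, \<open>\<iota>\<close> the inclusion of the real points and \<open>L\<close> the lattice of periods.
  Holomorphic means complex differentiable, i.e. the Frechet derivative is complex linear.
\<close>

definition cholomorphic ::
  "(complex \<Rightarrow> 'c \<Rightarrow> 'c) \<Rightarrow> 'c::real_normed_vector set \<Rightarrow> ('c \<Rightarrow> complex) \<Rightarrow> bool" where
  "cholomorphic sc U F \<longleftrightarrow>
     (\<forall>z\<in>U. \<exists>F'. (F has_derivative F') (at z) \<and> (\<forall>c v. F' (sc c v) = c * F' v))"

text \<open>
  Holomorphy on a closed domain \<open>D\<close> is understood in the weakest usual sense: continuous on \<open>D\<close>
  and holomorphic in its interior.
\<close>

definition holo_ext ::
  "(complex \<Rightarrow> 'c \<Rightarrow> 'c) \<Rightarrow> ('r \<Rightarrow> 'c::real_normed_vector) \<Rightarrow> 'r set \<Rightarrow> 'c set \<Rightarrow>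
    ('r \<Rightarrow> real) \<Rightarrow> ('c \<Rightarrow> complex) \<Rightarrow> bool" where
  "holo_ext sc \<iota> L D g G \<longleftrightarrow>
     continuous_on D G \<and> bounded (G ` D) \<and> cholomorphic sc (interior D) G \<and>
     (\<forall>z\<in>D. \<forall>k\<in>L. G (z + \<iota> k) = G z) \<and>
     (\<forall>x. \<iota> x \<in> D \<longrightarrow> G (\<iota> x) = complex_of_real (g x))"

text \<open>
  \<open>|g|_s\<close>: the maximum over the components of \<open>g\<close> of the supremum over \<open>D\<close> of the modulus of
  the holomorphic extension. On the domains used here the extension is unique, so for each
  component the infimum is over at most one value; it is \<open>\<infinity>\<close> precisely when there is no extension,
  hence finiteness of the norm includes existence of the extension.
\<close>

definition ext_norm ::
  "(complex \<Rightarrow> 'c \<Rightarrow> 'c) \<Rightarrow> ('r \<Rightarrow> 'c::real_normed_vector) \<Rightarrow> 'r set \<Rightarrow> 'c set \<Rightarrow>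
    ('r \<Rightarrow> 'b::euclidean_space) \<Rightarrow> ennreal" where
  "ext_norm sc \<iota> L D g =
     (SUP b\<in>Basis. INF G\<in>{G. holo_ext sc \<iota> L D (\<lambda>x. g x \<bullet> b) G}. SUP z\<in>D. ennreal (cmod (G z)))"

definition real_analytic ::
  "(complex \<Rightarrow> 'c \<Rightarrow> 'c) \<Rightarrow> ('r \<Rightarrow> 'c::real_normed_vector) \<Rightarrow> 'r set \<Rightarrow>
    ('r \<Rightarrow> 'b::euclidean_space) \<Rightarrow> bool" where
  "real_analytic sc \<iota> U g \<longleftrightarrow>
     (\<forall>b\<in>Basis. \<forall>x\<in>U. \<exists>W G. open W \<and> \<iota> x \<in> W \<and> cholomorphic sc W G \<and>
        (\<forall>y\<in>U. \<iota> y \<in> W \<longrightarrow> G (\<iota> y) = complex_of_real (g y \<bullet> b)))"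

definition torus_norm :: "real \<Rightarrow> (real ^ 'n \<Rightarrow> 'b::euclidean_space) \<Rightarrow> ennreal" where
  "torus_norm s = ext_norm scale_vec cvec int_lattice (strip s)"

definition phase_norm :: "real \<Rightarrow> ('n::finite phase \<Rightarrow> 'b::euclidean_space) \<Rightarrow> ennreal" where
  "phase_norm s = ext_norm scale_pair cpair phase_lattice (strip_ball s)"

text \<open>\<open>T^n \<times> B\<close>, where \<open>B\<close> is the open ball of radius \<open>R\<close>.\<close>

definition phase_space :: "real \<Rightarrow> 'n::finite phase set" where
  "phase_space R = UNIV \<times> ball 0 R"

definition periodic_on_phase :: "real \<Rightarrow> ('n::finite phase \<Rightarrow> 'b) \<Rightarrow> bool" where
  "periodic_on_phase R g \<longleftrightarrow> (\<forall>z\<in>phase_space R. \<forall>k\<in>phase_lattice. g (z + k) = g z)"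

definition analytic_on_phase :: "real \<Rightarrow> ('n::finite phase \<Rightarrow> 'b::euclidean_space) \<Rightarrow> bool" where
  "analytic_on_phase R g \<longleftrightarrow>
     periodic_on_phase R g \<and> real_analytic scale_pair cpair (phase_space R) g"

text \<open>
  The space \<open>A^\<upsilon>_s\<close> usually consists of the extensions \<open>F\<close>; here its elements are the real functions \<open>f\<close>
  identified with them. Continuity is joint in time and the complex variables.
\<close>

definition analytic_space :: "real \<Rightarrow> real \<Rightarrow> real \<Rightarrow> (real \<Rightarrow> 'n::finite phase \<Rightarrow> real) set" where
  "analytic_space R \<upsilon> s =
     {f. (\<forall>t\<ge>\<upsilon>. analytic_on_phase R (f t)) \<and>
         (\<exists>F. continuous_on ({\<upsilon>..} \<times> strip_ball s) (\<lambda>(t, z). F t z) \<and>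
              (\<forall>t\<ge>\<upsilon>. holo_ext scale_pair cpair phase_lattice (strip_ball s) (f t) (F t)))}"

definition grad :: "('a::real_inner \<Rightarrow> real) \<Rightarrow> 'a \<Rightarrow> 'a" where
  "grad g x = (THE D. GDERIV g x :> D)"

definition grad_q :: "('n::finite phase \<Rightarrow> real) \<Rightarrow> 'n phase \<Rightarrow> real ^ 'n" where
  "grad_q g z = grad (\<lambda>q. g (q, snd z)) (fst z)"

definition grad_p :: "('n::finite phase \<Rightarrow> real) \<Rightarrow> 'n phase \<Rightarrow> real ^ 'n" where
  "grad_p g z = grad (\<lambda>p. g (fst z, p)) (snd z)"

definition hess_p :: "('n::finite phase \<Rightarrow> real) \<Rightarrow> 'n phase \<Rightarrow> real ^ 'n ^ 'n" where
  "hess_p g z = jacobian (\<lambda>p. grad_p g (fst z, p)) (at (snd z))"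

definition ham_vf :: "(real \<Rightarrow> 'n::finite phase \<Rightarrow> real) \<Rightarrow> real \<Rightarrow> 'n phase \<Rightarrow> 'n phase" where
  "ham_vf H t z = (grad_p (H t) z, - grad_q (H t) z)"

definition kolmogorov_nf :: "real \<Rightarrow> real ^ 'n \<Rightarrow> (real \<Rightarrow> 'n::finite phase \<Rightarrow> real) set" where
  "kolmogorov_nf R \<omega> =
     {h. (\<forall>t\<ge>0. periodic_on_phase R (h t)) \<and>
         (\<exists>c. \<forall>q. \<forall>t\<ge>0. h t (q, 0) = c \<and> (GDERIV (\<lambda>p. h t (q, p)) 0 :> \<omega>))}"

text \<open>
  A map \<open>T^n \<rightarrow> T^n \<times> B\<close> is given by a lift \<open>\<phi>\<close>, which need not be periodic: translating the
  argument by \<open>Z^n\<close> changes the value by an element of \<open>Z^n \<times> {0}\<close>. By compactness of \<open>T^n\<close>,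
  an injective immersion is an embedding.
\<close>

definition analytic_embedding :: "real \<Rightarrow> (real ^ 'n \<Rightarrow> 'n::finite phase) \<Rightarrow> bool" where
  "analytic_embedding R \<phi> \<longleftrightarrow>
     real_analytic scale_vec cvec UNIV \<phi> \<and>
     range \<phi> \<subseteq> phase_space R \<and>
     (\<forall>q. \<forall>k\<in>int_lattice. \<phi> (q + k) - \<phi> q \<in> phase_lattice) \<and>
     (\<forall>q q'. \<phi> q - \<phi> q' \<in> phase_lattice \<longrightarrow> q - q' \<in> int_lattice) \<and>
     (\<forall>q. inj (frechet_derivative \<phi> (at q)))"

definition symp_form :: "'n::finite phase \<Rightarrow> 'n phase \<Rightarrow> real" where
  "symp_form u v = snd u \<bullet> fst v - snd v \<bullet> fst u"

definition lagrangian_subspace :: "'n::finite phase set \<Rightarrow> bool" where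
  "lagrangian_subspace V \<longleftrightarrow>
     subspace V \<and> dim V = CARD('n) \<and> (\<forall>u\<in>V. \<forall>v\<in>V. symp_form u v = 0)"

text \<open>The range of the derivative at \<open>q\<close> is the tangent space of the embedded torus at \<open>\<phi> q\<close>.\<close>

definition lagrangian_torus :: "(real ^ 'n \<Rightarrow> 'n::finite phase) \<Rightarrow> bool" where
  "lagrangian_torus \<phi> \<longleftrightarrow> (\<forall>q. lagrangian_subspace (range (frechet_derivative \<phi> (at q))))"

text \<open>
  \<open>\<phi>\<close> is an analytic asymptotic KAM torus associated to \<open>(X, X0, \<phi>0)\<close>, with \<open>\<upsilon>'\<close> as the
  initial time of the family; \<open>\<upsilon>'\<close> is a parameter because being Lagrangian refers to it.
  The norm of \<open>\<phi> t - \<phi>0\<close> is finite only if this difference of lifts is periodic.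
  At \<open>t = \<upsilon>'\<close> the time derivative is one-sided. The condition \<open>s < R\<close> says that
  \<open>B\<close> contains the real points of the complex ball of radius \<open>s\<close>.
\<close>

definition asymptotic_KAM_torus ::
  "real \<Rightarrow> real ^ 'n \<Rightarrow> (real \<Rightarrow> 'n phase \<Rightarrow> 'n phase) \<Rightarrow> (real \<Rightarrow> 'n phase \<Rightarrow> 'n phase) \<Rightarrow>
    (real ^ 'n \<Rightarrow> 'n phase) \<Rightarrow> real \<Rightarrow> (real \<Rightarrow> real ^ 'n \<Rightarrow> 'n phase) \<Rightarrow> bool" where
  "asymptotic_KAM_torus R \<omega> X X0 \<phi>0 \<upsilon>' \<phi> \<longleftrightarrow>
     (\<exists>\<upsilon>\<ge>0. \<exists>s>0. s < R \<and>
        (\<forall>t\<ge>\<upsilon>. analytic_on_phase R (X t) \<and> phase_norm s (X t) < \<infinity> \<and>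
                analytic_on_phase R (X0 t) \<and> phase_norm s (X0 t) < \<infinity>) \<and>
        analytic_embedding R \<phi>0 \<and>
        ((\<lambda>t. phase_norm s (\<lambda>z. X t z - X0 t z)) \<longlongrightarrow> 0) at_top \<and>
        (\<forall>q. \<forall>t\<ge>\<upsilon>. X0 t (\<phi>0 q) = frechet_derivative \<phi>0 (at q) \<omega>) \<and>
        \<upsilon> \<le> \<upsilon>' \<and>
        (\<forall>t\<ge>\<upsilon>'. analytic_embedding R (\<phi> t)) \<and>
        (\<exists>s'>0. s' \<le> s \<and>
           (\<forall>t\<ge>\<upsilon>'. torus_norm s' (\<lambda>q. \<phi> t q - \<phi>0 q) < \<infinity>) \<and>
           ((\<lambda>t. torus_norm s' (\<lambda>q. \<phi> t q - \<phi>0 q)) \<longlongrightarrow> 0) at_top) \<and>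
        (\<forall>q. \<forall>t\<ge>\<upsilon>'. \<exists>d. ((\<lambda>\<tau>. \<phi> \<tau> q) has_vector_derivative d) (at t within {\<upsilon>'..}) \<and>
                X t (\<phi> t q) = frechet_derivative (\<phi> t) (at q) \<omega> + d))"

end

theory Submission
  imports Defs "HOL-Complex_Analysis.Conformal_Mappings"
begin

text \<open>
  The torus is built from individual trajectories. If \<open>\<phi>\<close> is the torus, then
  \<open>t \<mapsto> \<phi> t (q + t \<omega>)\<close> is, for every \<open>q\<close>, a solution of Hamilton's equations whose distance to the
  unperturbed motion \<open>(q + t \<omega>, 0)\<close> tends to zero. Conversely, writing such a solution as
  \<open>(q + t \<omega>, 0) + W t q\<close> with \<open>W = (U, V)\<close>, the condition at infinity turns Hamilton's equations into
  \<open>W t q = - \<integral>\<^sub>t\<^sup>\<infinity> Y \<tau> ((q + \<tau> \<omega>, 0) + W \<tau> q) d\<tau>\<close>, where \<open>Y = (\<partial>\<^sub>pH - \<omega>, -\<partial>\<^sub>qH)\<close>,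
  and \<open>\<phi> t q = (q, 0) + W t (q - t \<omega>)\<close> satisfies the invariance equation by the chain rule.

  The integral equation is solved by iteration (\<open>picard_contraction\<close>, \<open>solution_exists\<close>) for all \<open>q\<close> in
  a complex strip; real translations \<open>q \<mapsto> q + t \<omega>\<close> do not change the width of the strip, so no small
  divisors appear and \<open>\<omega>\<close> is arbitrary. Write \<open>\<alpha>\<close> and \<open>\<beta>\<close> for the tails of \<open>a\<close> and \<open>b\<close>. On the zero
  section the two components of \<open>Y\<close> are bounded by \<open>b\<close> and \<open>a\<close>; the bounded Hessian in \<open>p\<close>, mean
  value estimates in \<open>p\<close> and Cauchy estimates in \<open>q\<close> then give, up to constants,
  \<open>b + |p|\<close> and \<open>a + (b + |p|) |p|\<close>, with corresponding bounds for the derivatives. In the space of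
  displacements with \<open>|U| \<le> L \<beta>\<close> and \<open>|V| \<le> 2 C \<alpha>\<close>, the hypothesis \<open>\<alpha> \<le> \<Lambda> b\<close> makes the velocity
  integrable with integral of order \<open>\<beta>\<close>, and together with \<open>\<alpha> b \<le> \<Lambda> a \<beta>\<close> it turns the nonlinear terms of the force
  into \<open>a\<close> times the factor \<open>\<beta>\<close>, which is small for large times. The only term without a small
  factor is the contribution of the momentum to the velocity; it is absorbed by weighting the two
  components differently.

  Holomorphy in \<open>q\<close> of the iterates passes to their uniform limit. The torus is Lagrangian because the
  symplectic form of two variations of the solution is constant along trajectories and tends to zero
  (\<open>solution_isotropic\<close>). The comparison Hamiltonian is \<open>h' = H - f(q,0,t) - \<partial>\<^sub>pf(q,0,t) \<cdot> p\<close>: it is in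
  Kolmogorov normal form, and \<open>X\<^sub>H - X\<^sub>h'\<close> is the vector field of a function which is affine in \<open>p\<close> with
  decaying coefficients (\<open>Elin_bound\<close>).

  Hamiltonian vector fields are defined through real gradients and all norms through holomorphic
  extensions. The two are related by the identity principle, which follows from one complex
  variable by restricting to the complex line through a real point in a real direction.
\<close>

section \<open>Holomorphic maps between complex vector spaces\<close>

text \<open>Complex vector spaces, given by a complex multiplication \<open>sc\<close> on a Euclidean space which extends the
  real one. This covers \<open>C\<close>, \<open>C^n\<close> and \<open>C^n \<times> C^n\<close> at once.\<close>

locale complex_structure =
  fixes sc :: "complex \<Rightarrow> 'c::euclidean_space \<Rightarrow> 'c"
  assumes sc_add_right: "sc c (v + w) = sc c v + sc c w"
    and sc_add_left: "sc (c + d) v = sc c v + sc d v"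
    and sc_mult: "sc (c * d) v = sc c (sc d v)"
    and sc_of_real: "sc (of_real r) v = r *\<^sub>R v"
    and norm_sc: "norm (sc c v) = cmod c * norm v"
begin

lemma sc_1 [simp]: "sc 1 v = v"
  using sc_of_real[of 1 v] by simp

lemma sc_0 [simp]: "sc 0 v = 0"
  using sc_of_real[of 0 v] by simp

lemma sc_scaleR_left: "sc (r *\<^sub>R c) v = r *\<^sub>R sc c v"
  by (metis sc_mult sc_of_real scaleR_conv_of_real)

lemma sc_scaleR_right: "sc c (r *\<^sub>R v) = r *\<^sub>R sc c v"
  by (metis mult.commute sc_mult sc_of_real)

lemma bounded_linear_sc_right: "bounded_linear (sc c)"
  by (rule bounded_linear_intro[of _ "cmod c"])
    (auto simp: sc_add_right sc_scaleR_right norm_sc mult.commute)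

lemma bounded_linear_sc_left: "bounded_linear (\<lambda>c. sc c v)"
  by (rule bounded_linear_intro[of _ "norm v"])
    (auto simp: sc_add_left sc_scaleR_left norm_sc)

lemma sc_expand: "sc c v = Re c *\<^sub>R v + Im c *\<^sub>R sc \<i> v"
proof -
  have "sc c v = sc (of_real (Re c) + of_real (Im c) * \<i>) v"
    by (metis complex_eq mult.commute)
  then show ?thesis
    by (simp add: sc_add_left sc_mult sc_of_real)
qed

text \<open>The complex linear functional whose real part is the inner product with \<open>w\<close>. Probing a vector valued
  holomorphic map with it gives scalar functions of one variable, without loss in the constants.\<close>

definition probe :: "'c \<Rightarrow> 'c \<Rightarrow> complex" where
  "probe w x = Complex (x \<bullet> w) (- (sc \<i> x \<bullet> w))"

lemma probe_sc: "probe w (sc c x) = c * probe w x"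
proof -
  have ii: "sc \<i> (sc \<i> x) = - x"
    by (metis i_squared sc_mult sc_of_real of_real_1 of_real_minus scaleR_minus1_left)
  have "sc \<i> (sc c x) = Re c *\<^sub>R sc \<i> x - Im c *\<^sub>R x"
    by (subst sc_expand) (simp add: sc_add_right sc_scaleR_right ii)
  then show ?thesis
    unfolding probe_def
    using sc_expand[of c x] by (simp add: complex_eq_iff inner_add_left inner_diff_left)
qed

lemma probe_add: "probe w (x + y) = probe w x + probe w y"
  by (simp add: probe_def complex_eq_iff sc_add_right inner_add_left)

lemma probe_scaleR: "probe w (r *\<^sub>R x) = r *\<^sub>R probe w x"
  by (simp add: probe_def complex_eq_iff sc_scaleR_right)

lemma norm_probe_le: "cmod (probe w x) \<le> norm w * norm x"
proof (cases "probe w x = 0")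
  case False
  \<comment> \<open>Rotating \<open>x\<close> by \<open>c\<close> makes the value of the functional a nonnegative real number.\<close>
  define c where "c = cnj (probe w x) / of_real (cmod (probe w x))"
  have 1: "cmod c = 1"
    using False by (simp add: c_def norm_divide)
  have "probe w (sc c x) = of_real (cmod (probe w x))"
    using False by (simp add: probe_sc c_def complex_norm_square[symmetric] power2_eq_square mult.commute)
  then have "cmod (probe w x) = Re (probe w (sc c x))"
    by simp
  also have "\<dots> = sc c x \<bullet> w"
    by (simp add: probe_def)
  also have "\<dots> \<le> norm (sc c x) * norm w"
    by (rule norm_cauchy_schwarz)
  finally show ?thesis
    by (simp add: norm_sc 1 mult.commute)
qed simp

lemma bounded_linear_probe: "bounded_linear (probe w)"
  by (rule bounded_linear_intro[of _ "norm w"])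
    (use norm_probe_le[of w] in \<open>auto simp: probe_add mult.commute probe_scaleR\<close>)

lemma norm_le_by_probe:
  assumes "cmod (probe w w) \<le> norm w * K" "0 \<le> K"
  shows "norm w \<le> K"
proof (cases "w = 0")
  case False
  have "norm w * norm w = Re (probe w w)"
    by (simp add: probe_def dot_square_norm power2_eq_square)
  also have "\<dots> \<le> norm w * K"
    using assms complex_Re_le_cmod order_trans by blast
  finally show ?thesis
    using False by simp
qed (use assms in auto)

end

lemma complex_structure_mult: "complex_structure ((*) :: complex \<Rightarrow> _)"
  by unfold_locales (auto simp: algebra_simps norm_mult scaleR_conv_of_real)

text \<open>Frechet differentiability with complex linear derivative: the notion of \<^const>\<open>cholomorphic\<close> for
  vector valued maps.\<close>

definition holo_map ::
  "(complex \<Rightarrow> 'c \<Rightarrow> 'c) \<Rightarrow> (complex \<Rightarrow> 'd \<Rightarrow> 'd) \<Rightarrow> 'c::real_normed_vector set \<Rightarrow> ('c \<Rightarrow> 'd::real_normed_vector) \<Rightarrow> bool" where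
  "holo_map sc sd U F \<longleftrightarrow>
     (\<forall>z\<in>U. \<exists>F'. (F has_derivative F') (at z) \<and> (\<forall>c v. F' (sc c v) = sd c (F' v)))"

abbreviation fd :: "('c::real_normed_vector \<Rightarrow> 'd::real_normed_vector) \<Rightarrow> 'c \<Rightarrow> 'c \<Rightarrow> 'd" where
  "fd F z \<equiv> frechet_derivative F (at z)"

lemma cholomorphic_eq_holo_map: "cholomorphic sc U F \<longleftrightarrow> holo_map sc (*) U F"
  by (simp add: cholomorphic_def holo_map_def)

lemma fd_eq: "(F has_derivative F') (at z) \<Longrightarrow> fd F z = F'"
  using frechet_derivative_at by metis

lemma holo_map_derivative:
  assumes "holo_map sc sd U F" "z \<in> U"
  shows "(F has_derivative fd F z) (at z)" "fd F z (sc c v) = sd c (fd F z v)"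
  using assms unfolding holo_map_def by (metis fd_eq)+

lemma holo_map_subset: "holo_map sc sd U F \<Longrightarrow> V \<subseteq> U \<Longrightarrow> holo_map sc sd V F"
  unfolding holo_map_def by blast

lemma holo_map_continuous: "holo_map sc sd U F \<Longrightarrow> continuous_on U F"
  unfolding holo_map_def continuous_on_eq_continuous_within
  by (meson continuous_at_imp_continuous_at_within has_derivative_continuous)

lemma holo_map_compose:
  assumes "holo_map sc sd U F" "holo_map sd se V G" "\<And>z. z \<in> U \<Longrightarrow> F z \<in> V"
  shows "holo_map sc se U (\<lambda>z. G (F z))"
  unfolding holo_map_def
proof
  fix z assume z: "z \<in> U"
  have "((\<lambda>z. G (F z)) has_derivative (\<lambda>v. fd G (F z) (fd F z v))) (at z)"
    using has_derivative_compose[OF holo_map_derivative(1)[OF assms(1) z]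
      holo_map_derivative(1)[OF assms(2) assms(3)[OF z]]] .
  then show "\<exists>F'. ((\<lambda>z. G (F z)) has_derivative F') (at z) \<and> (\<forall>c v. F' (sc c v) = se c (F' v))"
    using holo_map_derivative(2)[OF assms(1) z] holo_map_derivative(2)[OF assms(2) assms(3)[OF z]]
    by (intro exI conjI) auto
qed

lemma fd_compose:
  assumes "holo_map sc sd U F" "holo_map sd se V G" "z \<in> U" "F z \<in> V"
  shows "fd (\<lambda>z. G (F z)) z v = fd G (F z) (fd F z v)"
  using fd_eq[OF has_derivative_compose[OF holo_map_derivative(1)[OF assms(1,3)]
      holo_map_derivative(1)[OF assms(2) assms(4)]]] by simp

lemma holo_map_bounded_linear:
  assumes "bounded_linear T" "\<And>c v. T (sc c v) = sd c (T v)"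
  shows "holo_map sc sd U T"
  unfolding holo_map_def using bounded_linear_imp_has_derivative[OF assms(1)] assms(2) by blast

lemma fd_linear: 
  assumes "holo_map sc sd U F" "z \<in> U"
  shows "bounded_linear (fd F z)"
  using holo_map_derivative(1)[OF assms] has_derivative_bounded_linear by blast

locale complex_structure_pair =
  dom: complex_structure sc + cod: complex_structure sd
  for sc :: "complex \<Rightarrow> 'c::euclidean_space \<Rightarrow> 'c" and sd :: "complex \<Rightarrow> 'd::euclidean_space \<Rightarrow> 'd"
begin

lemma holo_map_const [simp]: "holo_map sc sd U (\<lambda>_. k)"
  unfolding holo_map_def
  by (intro ballI exI[of _ "\<lambda>_. 0"] conjI has_derivative_const allI)
    (use cod.bounded_linear_sc_right in \<open>simp add: bounded_linear.linear linear_0\<close>)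

lemma holo_map_add:
  assumes "holo_map sc sd U F" "holo_map sc sd U G"
  shows "holo_map sc sd U (\<lambda>z. F z + G z)"
  unfolding holo_map_def
proof
  fix z assume z: "z \<in> U"
  show "\<exists>F'. ((\<lambda>z. F z + G z) has_derivative F') (at z) \<and> (\<forall>c v. F' (sc c v) = sd c (F' v))"
    by (rule exI[of _ "\<lambda>v. fd F z v + fd G z v"])
      (use has_derivative_add[OF holo_map_derivative(1)[OF assms(1) z] holo_map_derivative(1)[OF assms(2) z]]
        holo_map_derivative(2)[OF assms(1) z] holo_map_derivative(2)[OF assms(2) z]
        in \<open>auto simp: cod.sc_add_right\<close>)
qed

lemma holo_map_sc:
  assumes "holo_map sc sd U F"
  shows "holo_map sc sd U (\<lambda>z. sd k (F z))"
  by (rule holo_map_compose[OF assms holo_map_bounded_linear[OF cod.bounded_linear_sc_right, where sc = sd and sd = sd and U = UNIV]])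
    (auto simp: mult.commute simp flip: cod.sc_mult)

lemma holo_map_scaleR: "holo_map sc sd U F \<Longrightarrow> holo_map sc sd U (\<lambda>z. r *\<^sub>R F z)"
  using holo_map_sc[of U F "of_real r"] by (simp add: cod.sc_of_real)

lemma holo_map_minus: "holo_map sc sd U F \<Longrightarrow> holo_map sc sd U (\<lambda>z. - F z)"
  using holo_map_scaleR[of U F "-1"] by simp

lemma holo_map_diff:
  "holo_map sc sd U F \<Longrightarrow> holo_map sc sd U G \<Longrightarrow> holo_map sc sd U (\<lambda>z. F z - G z)"
  using holo_map_add[OF _ holo_map_minus, of U F G] by simp

lemma holo_map_sum:
  assumes "\<And>i. i \<in> I \<Longrightarrow> holo_map sc sd U (F i)"
  shows "holo_map sc sd U (\<lambda>z. \<Sum>i\<in>I. F i z)"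
  using assms by (induction I rule: infinite_finite_induct) (auto intro: holo_map_add)

lemma line_derivative:
  assumes F: "holo_map sc sd U F" and z: "z + sc \<zeta> v \<in> U"
  shows "((\<lambda>\<zeta>. cod.probe w (F (z + sc \<zeta> v))) has_field_derivative
            cod.probe w (fd F (z + sc \<zeta> v) v)) (at \<zeta>)"
proof -
  have "((\<lambda>\<zeta>. z + sc \<zeta> v) has_derivative (\<lambda>h. sc h v)) (at \<zeta>)"
    using has_derivative_add[OF has_derivative_const bounded_linear_imp_has_derivative[OF dom.bounded_linear_sc_left]]
    by simp
  from has_derivative_compose[OF this holo_map_derivative(1)[OF F z]]
  have "((\<lambda>\<zeta>. F (z + sc \<zeta> v)) has_derivative (\<lambda>h. sd h (fd F (z + sc \<zeta> v) v))) (at \<zeta>)"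
    by (simp add: holo_map_derivative(2)[OF F z])
  from bounded_linear.has_derivative[OF cod.bounded_linear_probe[of w] this]
  show ?thesis
    unfolding has_field_derivative_def by (simp add: cod.probe_sc mult.commute[of _ "cod.probe w _"])
qed

lemma line_holomorphic:
  assumes F: "holo_map sc sd U F" and z: "\<And>\<zeta>. \<zeta> \<in> S \<Longrightarrow> z + sc \<zeta> v \<in> U"
  shows "(\<lambda>\<zeta>. cod.probe w (F (z + sc \<zeta> v))) holomorphic_on S"
  using line_derivative[OF F] z
  by (meson field_differentiable_at_within field_differentiable_def holomorphic_on_def)

text \<open>The one-variable Cauchy inequality on the complex line in direction \<open>v\<close>, probed with the derivative
  itself. Only the values on that line matter, so that bounds which depend on \<open>p\<close> can be
  differentiated in \<open>q\<close>.\<close>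

lemma directional_Cauchy:
  assumes F: "holo_map sc sd U F" and r: "0 < r"
    and U: "\<And>\<zeta>. cmod \<zeta> \<le> r \<Longrightarrow> z + sc \<zeta> v \<in> U"
    and M: "\<And>\<zeta>. cmod \<zeta> \<le> r \<Longrightarrow> norm (F (z + sc \<zeta> v)) \<le> M"
  shows "norm (fd F z v) \<le> M / r"
proof (rule cod.norm_le_by_probe)
  let ?w = "fd F z v"
  let ?g = "\<lambda>\<zeta>. cod.probe ?w (F (z + sc \<zeta> v))"
  have h: "?g holomorphic_on cball 0 r"
    by (rule line_holomorphic[OF F]) (auto intro: U)
  have "cmod ((deriv ^^ 1) ?g 0) \<le> fact 1 * (norm ?w * M) / r ^ 1"
  proof (rule Cauchy_inequality)
    show "?g holomorphic_on ball 0 r"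
      using h ball_subset_cball holomorphic_on_subset by blast
    show "continuous_on (cball 0 r) ?g"
      by (rule holomorphic_on_imp_continuous_on[OF h])
    fix x :: complex assume "cmod (0 - x) = r"
    then show "cmod (?g x) \<le> norm ?w * M"
      using cod.norm_probe_le[of ?w "F (z + sc x v)"] M[of x]
      by (smt (verit) mult_left_mono norm_ge_zero diff_0 norm_minus_cancel)
  qed (use r in auto)
  moreover have "deriv ?g 0 = cod.probe ?w ?w"
    using DERIV_imp_deriv[OF line_derivative[OF F, of z 0 v ?w]] U[of 0] r by simp
  ultimately show "cmod (cod.probe ?w ?w) \<le> norm ?w * (M / r)"
    by simp
  show "0 \<le> M / r"
    using M[of 0] r by (smt (verit) divide_nonneg_pos norm_ge_zero norm_zero)
qed

lemma Cauchy_estimate: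
  assumes F: "holo_map sc sd U F" and r: "0 < r" and U: "cball z r \<subseteq> U"
    and M: "\<And>w. w \<in> cball z r \<Longrightarrow> norm (F w) \<le> M"
  shows "norm (fd F z v) \<le> M / r * norm v"
proof (cases "v = 0")
  case True
  have "z \<in> U" using U r by auto
  from fd_linear[OF F this] show ?thesis 
    using True by (simp add: bounded_linear.linear linear_0)
next
  case False
  have *: "z + sc \<zeta> v \<in> cball z r" if "cmod \<zeta> \<le> r / norm v" for \<zeta>
    using that False by (simp add: dist_norm dom.norm_sc field_simps)
  have "norm (fd F z v) \<le> M / (r / norm v)"
    by (rule directional_Cauchy[OF F]) (use * U M r False in auto)
  then show ?thesis by simp
qed

text \<open>Taylor's formula on the complex line in direction \<open>v\<close>; the second derivative is bounded on the
  disc of radius \<open>r / 2\<close> by Cauchy's inequality. The bound depends on \<open>F\<close> only through its supremum, which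
  gives uniform convergence of difference quotients and allows differentiation under an integral.\<close>

lemma directional_second_order:
  assumes F: "holo_map sc sd U F" and r: "0 < r" "cmod h \<le> r / 2"
    and U: "\<And>\<zeta>. cmod \<zeta> \<le> r \<Longrightarrow> z + sc \<zeta> v \<in> U"
    and M: "\<And>\<zeta>. cmod \<zeta> \<le> r \<Longrightarrow> norm (F (z + sc \<zeta> v)) \<le> M"
  shows "norm (F (z + sc h v) - F z - sd h (fd F z v)) \<le> 8 * M / r\<^sup>2 * (cmod h)\<^sup>2"
proof (rule cod.norm_le_by_probe)
  let ?w = "F (z + sc h v) - F z - sd h (fd F z v)"
  let ?g = "\<lambda>\<zeta>. cod.probe ?w (F (z + sc \<zeta> v))"
  have hol: "?g holomorphic_on cball 0 r"
    by (rule line_holomorphic[OF F]) (auto intro: U)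
  have holb: "?g holomorphic_on ball 0 r"
    using hol ball_subset_cball holomorphic_on_subset by blast
  have gM: "cmod (?g x) \<le> norm ?w * M" if "cmod x \<le> r" for x
    using cod.norm_probe_le[of ?w "F (z + sc x v)"] M[OF that]
    by (smt (verit) mult_left_mono norm_ge_zero)
  have "cmod ((deriv ^^ 0) ?g h - (\<Sum>i\<le>1. (deriv ^^ i) ?g 0 * (h - 0) ^ i / (fact i)))
      \<le> (8 * (norm ?w * M) / r\<^sup>2) * cmod (h - 0) ^ (Suc 1) / fact 1"
  proof (rule complex_Taylor[where S = "cball 0 (r / 2)"])
    fix i :: nat and x :: complex assume "x \<in> cball 0 (r / 2)"
    then have x: "x \<in> ball 0 r" using r by auto
    show "((deriv ^^ i) ?g has_field_derivative (deriv ^^ Suc i) ?g x) (at x within cball 0 (r / 2))"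
      using has_field_derivative_higher_deriv[OF holb open_ball x]
      by (rule has_field_derivative_at_within)
  next
    fix x :: complex assume x: "x \<in> cball 0 (r / 2)"
    have "cball x (r / 2) \<subseteq> cball 0 r" 
      using x by (simp add: cball_subset_cball_iff dist_norm norm_minus_commute)
    then have hx: "?g holomorphic_on cball x (r / 2)"
      using hol holomorphic_on_subset by blast
    have "cmod ((deriv ^^ 2) ?g x) \<le> fact 2 * (norm ?w * M) / (r / 2) ^ 2"
    proof (rule Cauchy_inequality)
      show "?g holomorphic_on ball x (r / 2)"
        using hx ball_subset_cball holomorphic_on_subset by blast
      show "continuous_on (cball x (r / 2)) ?g"
        by (rule holomorphic_on_imp_continuous_on[OF hx])
      fix y assume "cmod (x - y) = r / 2"
      then have "cmod y \<le> r"
        using x norm_triangle_ineq3[of x y] norm_triangle_ineq2[of y x] by (simp add: norm_minus_commute)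
      then show "cmod (?g y) \<le> norm ?w * M" by (rule gM)
    qed (use r in auto)
    then show "cmod ((deriv ^^ Suc 1) ?g x) \<le> 8 * (norm ?w * M) / r\<^sup>2"
      by (simp add: power_divide numeral_2_eq_2 mult.commute)
  qed (use r in auto)
  moreover have "deriv ?g 0 = cod.probe ?w (fd F z v)"
    using DERIV_imp_deriv[OF line_derivative[OF F, of z 0 v ?w]] U[of 0] r by simp
  moreover have "cod.probe ?w ?w = ?g h - (?g 0 + cod.probe ?w (fd F z v) * h)"
    using bounded_linear.linear[OF cod.bounded_linear_probe[of ?w]] 
    by (simp add: linear_diff cod.probe_sc del: right_diff_distrib)
  ultimately have "cmod (cod.probe ?w ?w) \<le> 8 * (norm ?w * M) / r\<^sup>2 * cmod h ^ 2"
    by (simp add: numeral_2_eq_2)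
  then show "cmod (cod.probe ?w ?w) \<le> norm ?w * (8 * M / r\<^sup>2 * (cmod h)\<^sup>2)"
    by (simp add: mult_ac)
  have "0 \<le> M" using M[of 0] r by (smt (verit) norm_ge_zero norm_zero)
  then show "0 \<le> 8 * M / r\<^sup>2 * (cmod h)\<^sup>2" by simp
qed

end

context complex_structure_pair
begin

lemma fd_add:
  assumes "holo_map sc sd U F" "holo_map sc sd U G" "z \<in> U"
  shows "fd (\<lambda>z. F z + G z) z v = fd F z v + fd G z v"
  using fd_eq[OF has_derivative_add[OF holo_map_derivative(1)[OF assms(1,3)] holo_map_derivative(1)[OF assms(2,3)]]]
  by simp

lemma fd_diff:
  assumes "holo_map sc sd U F" "holo_map sc sd U G" "z \<in> U"
  shows "fd (\<lambda>z. F z - G z) z v = fd F z v - fd G z v"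
  using fd_eq[OF has_derivative_diff[OF holo_map_derivative(1)[OF assms(1,3)] holo_map_derivative(1)[OF assms(2,3)]]]
  by simp

lemma fd_scaleR:
  assumes "holo_map sc sd U F" "z \<in> U"
  shows "fd (\<lambda>z. r *\<^sub>R F z) z v = r *\<^sub>R fd F z v"
  using fd_eq[OF bounded_linear.has_derivative[OF bounded_linear_scaleR_right holo_map_derivative(1)[OF assms]]]
  by simp

text \<open>By the Cauchy estimate, uniform convergence of holomorphic maps entails uniform convergence of
  their derivatives on smaller balls, so that the limit may be differentiated.\<close>

lemma holo_map_uniform_limit:
  assumes U: "open U" and F: "\<And>n. holo_map sc sd U (F n)"
    and lim: "\<And>z. z \<in> U \<Longrightarrow> \<exists>r>0. cball z r \<subseteq> U \<and> uniform_limit (cball z r) F f sequentially"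
  shows "holo_map sc sd U f"
    and "\<And>z v. z \<in> U \<Longrightarrow> (\<lambda>n. fd (F n) z v) \<longlonglongrightarrow> fd f z v"
proof -
  have *: "\<exists>f'. (f has_derivative f') (at z) \<and> (\<forall>v. (\<lambda>n. fd (F n) z v) \<longlonglongrightarrow> f' v)" if z: "z \<in> U" for z
  proof -
    obtain r where r: "r > 0" "cball z r \<subseteq> U" "uniform_limit (cball z r) F f sequentially"
      using lim[OF z] by blast
    define S where "S = ball z (r / 2)"
    have inU: "x \<in> U" if "x \<in> S" for x
      using that r by (auto simp: S_def subset_iff)
    have close: "norm (fd (F m) x h - fd (F n) x h) \<le> e * norm h"
      if "x \<in> S" "e > 0" "\<forall>y\<in>cball z r. norm (F m y - F n y) \<le> e * (r / 2)" for m n x h e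
    proof -
      have "cball x (r / 2) \<subseteq> cball z r"
        using \<open>x \<in> S\<close> by (auto simp: S_def dist_commute cball_subset_cball_iff)
      then have "norm (fd (\<lambda>z. F m z - F n z) x h) \<le> (e * (r / 2)) / (r / 2) * norm h"
        by (intro Cauchy_estimate[OF holo_map_diff[OF F F]]) (use that r in auto)
      then show ?thesis
        using fd_diff[OF F F inU[OF \<open>x \<in> S\<close>]] r by simp
    qed
    have ev: "\<forall>\<^sub>F m in sequentially. \<forall>n\<ge>m. \<forall>y\<in>cball z r. norm (F m y - F n y) \<le> d" if "d > 0" for d
    proof -
      have "\<forall>\<^sub>F n in sequentially. \<forall>y\<in>cball z r. dist (F n y) (f y) < d / 2"
        using uniform_limitD[OF r(3), of "d / 2"] that by simp
      then obtain N where "\<forall>n\<ge>N. \<forall>y\<in>cball z r. dist (F n y) (f y) < d / 2"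
        by (auto simp: eventually_sequentially)
      then have "norm (F m y - F n y) \<le> d" if "m \<ge> N" "n \<ge> N" "y \<in> cball z r" for m n y
        using that dist_triangle_half_l[of "F m y" "f y" d "F n y"] by (auto simp: dist_norm)
      then show ?thesis
        unfolding eventually_sequentially by (meson order_trans)
    qed
    have Cau: "Cauchy (\<lambda>n. fd (F n) x h)" if x: "x \<in> S" for x h
    proof (rule metric_CauchyI)
      fix e :: real assume e: "e > 0"
      define d where "d = e / (2 * (norm h + 1))"
      have d: "d > 0" using e by (simp add: d_def add_nonneg_pos)
      have dh: "d * norm h < e / 2"
      proof -
        have "norm h + 1 > 0" by (simp add: add_nonneg_pos)
        then show ?thesis using e by (simp add: d_def field_simps)
      qed
      obtain M where M: "\<forall>n\<ge>M. \<forall>y\<in>cball z r. norm (F M y - F n y) \<le> d * (r / 2)"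
        using eventually_happens[OF ev[of "d * (r / 2)"]] d r by auto
      show "\<exists>M. \<forall>m\<ge>M. \<forall>n\<ge>M. dist (fd (F m) x h) (fd (F n) x h) < e"
      proof (intro exI allI impI)
        fix m n assume mn: "M \<le> m" "M \<le> n"
        have "dist (fd (F M) x h) (fd (F m) x h) < e / 2" "dist (fd (F M) x h) (fd (F n) x h) < e / 2"
          using close[OF x d, of M _ h] M mn dh by (force simp: dist_norm)+
        then show "dist (fd (F m) x h) (fd (F n) x h) < e"
          using dist_triangle_half_r by blast
      qed
    qed
    define g where "g x h = lim (\<lambda>n. fd (F n) x h)" for x h
    have g: "(\<lambda>n. fd (F n) x h) \<longlonglongrightarrow> g x h" if "x \<in> S" for x h
      using Cau[OF that] unfolding g_def by (simp add: Cauchy_convergent_iff convergent_LIMSEQ_iff)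
    have "\<exists>G. \<forall>x\<in>S. (\<lambda>n. F n x) \<longlonglongrightarrow> G x \<and> (G has_derivative g x) (at x within S)"
    proof (rule has_derivative_sequence)
      show "convex S" "z \<in> S" by (use r in \<open>auto simp: S_def\<close>)
      show "(F n has_derivative fd (F n) x) (at x within S)" if "x \<in> S" for n x
        using holo_map_derivative(1)[OF F inU[OF that]] has_derivative_at_withinI by blast
      show "(\<lambda>n. F n z) \<longlonglongrightarrow> f z"
        using tendsto_uniform_limitI[OF r(3)] r by simp
      fix e :: real assume e: "e > 0"
      show "\<forall>\<^sub>F n in sequentially. \<forall>x\<in>S. \<forall>h. norm (fd (F n) x h - g x h) \<le> e * norm h"
        using ev[of "e * (r / 2)"]
      proof (rule eventually_mono)
        fix n assume n: "\<forall>m\<ge>n. \<forall>y\<in>cball z r. norm (F n y - F m y) \<le> e * (r / 2)"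
        show "\<forall>x\<in>S. \<forall>h. norm (fd (F n) x h - g x h) \<le> e * norm h"
        proof (intro ballI allI)
          fix x h assume x: "x \<in> S"
          have "(\<lambda>m. norm (fd (F n) x h - fd (F m) x h)) \<longlonglongrightarrow> norm (fd (F n) x h - g x h)"
            by (intro tendsto_intros g x)
          then show "norm (fd (F n) x h - g x h) \<le> e * norm h"
            by (rule tendsto_upperbound)
              (use close[OF x e] n in \<open>auto simp: eventually_sequentially intro!: exI[of _ n]\<close>)
        qed
      qed (use e r in auto)
    qed
    then obtain G where G: "\<And>x. x \<in> S \<Longrightarrow> (\<lambda>n. F n x) \<longlonglongrightarrow> G x"
      "\<And>x. x \<in> S \<Longrightarrow> (G has_derivative g x) (at x within S)" by blast
    have Gf: "G x = f x" if "x \<in> S" for x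
    proof -
      have "x \<in> cball z r"
        using that zero_le_dist[of z x] unfolding S_def mem_ball mem_cball by linarith
      then show ?thesis
        using tendsto_uniform_limitI[OF r(3)] G(1)[OF that] LIMSEQ_unique by blast
    qed
    have zS: "z \<in> S" "open S" using r by (auto simp: S_def)
    have "(G has_derivative g z) (at z)"
      using G(2)[OF zS(1)] at_within_open[OF zS] by simp
    then have "(f has_derivative g z) (at z)"
      using has_derivative_transform_within_open[OF _ zS(2,1), of G "g z" UNIV f] Gf by simp
    then show ?thesis using g[OF zS(1)] by blast
  qed
  show "holo_map sc sd U f"
    unfolding holo_map_def
  proof
    fix z assume z: "z \<in> U"
    obtain f' where f': "(f has_derivative f') (at z)" "\<And>v. (\<lambda>n. fd (F n) z v) \<longlonglongrightarrow> f' v"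
      using *[OF z] by blast
    have "f' (sc c v) = sd c (f' v)" for c v
    proof (rule LIMSEQ_unique[OF f'(2)])
      show "(\<lambda>n. fd (F n) z (sc c v)) \<longlonglongrightarrow> sd c (f' v)"
        unfolding holo_map_derivative(2)[OF F z]
        by (rule bounded_linear.tendsto[OF cod.bounded_linear_sc_right f'(2)])
    qed
    with f' show "\<exists>F'. (f has_derivative F') (at z) \<and> (\<forall>c v. F' (sc c v) = sd c (F' v))"
      by blast
  qed
  show "\<And>z v. z \<in> U \<Longrightarrow> (\<lambda>n. fd (F n) z v) \<longlonglongrightarrow> fd f z v"
    using * fd_eq by metis
qed

lemma locally_bounded:
  assumes "holo_map sc sd U F" "cball z r \<subseteq> U"
  obtains M where "M > 0" "\<And>w. w \<in> cball z r \<Longrightarrow> norm (F w) \<le> M"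
proof -
  have "compact (F ` cball z r)"
    by (intro compact_continuous_image continuous_on_subset[OF holo_map_continuous[OF assms(1)] assms(2)]) auto
  then show ?thesis
    using that compact_imp_bounded bounded_pos by (metis imageI)
qed

text \<open>Step sizes tending to zero that keep the difference quotients in direction \<open>v\<close> within twice the radius.
  They are explicit because the exchange of two derivatives needs the same steps for two
  different maps.\<close>

definition quotient_step :: "real \<Rightarrow> 'c \<Rightarrow> nat \<Rightarrow> real" where
  "quotient_step r v n = r / (2 * (norm v + 1)) / real (Suc n)"

lemma difference_quotient_uniform_limit:
  fixes v :: 'c
  assumes F: "holo_map sc sd U F" and r: "0 < r" "cball z (2 * r) \<subseteq> U"
  shows "uniform_limit (cball z r) (\<lambda>n w. (F (w + quotient_step r v n *\<^sub>R v) - F w) /\<^sub>R quotient_step r v n) (\<lambda>w. fd F w v) sequentially"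
    and "\<And>w n. w \<in> cball z r \<Longrightarrow> w + quotient_step r v n *\<^sub>R v \<in> cball z (2 * r)"
proof -
  define \<rho> where "\<rho> = r / (norm v + 1)"
  have \<rho>: "\<rho> > 0" using r by (simp add: \<rho>_def add_nonneg_pos)
  have hr: "quotient_step r v n = \<rho> / 2 / real (Suc n)" for n
    by (simp add: quotient_step_def \<rho>_def)
  have hpos: "quotient_step r v n > 0" for n using \<rho> by (simp add: hr)
  have hle: "quotient_step r v n \<le> \<rho> / 2" for n 
  proof -
    have "\<rho> / 2 / real (Suc n) \<le> \<rho> / 2 / 1" 
      using \<rho> by (intro divide_left_mono) auto
    then show ?thesis by (simp add: hr)
  qed
  have in2: "w + sc \<zeta> v \<in> cball z (2 * r)" if "w \<in> cball z r" "cmod \<zeta> \<le> \<rho>" for w \<zeta>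
  proof -
    have "cmod \<zeta> * norm v \<le> \<rho> * (norm v + 1)"
      using that \<rho> by (intro mult_mono) auto
    also have "\<dots> = r" unfolding \<rho>_def by (simp add: add_nonneg_eq_0_iff)
    finally have "norm (sc \<zeta> v) \<le> r" by (simp add: dom.norm_sc)
    then show ?thesis
      using that norm_triangle_ineq4[of "z - w" "sc \<zeta> v"] by (simp add: dist_norm algebra_simps)
  qed
  show "w + quotient_step r v n *\<^sub>R v \<in> cball z (2 * r)" if "w \<in> cball z r" for w n
    using in2[OF that, of "of_real (quotient_step r v n)"] hpos[of n] hle[of n] \<rho> by (simp add: dom.sc_of_real)
  obtain M where M: "M > 0" "\<And>w. w \<in> cball z (2 * r) \<Longrightarrow> norm (F w) \<le> M"
    using locally_bounded[OF F r(2)] by blast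
  have est: "norm ((F (w + quotient_step r v n *\<^sub>R v) - F w) /\<^sub>R quotient_step r v n - fd F w v) \<le> 8 * M / \<rho>\<^sup>2 * quotient_step r v n"
    if w: "w \<in> cball z r" for w n
  proof -
    have "norm (F (w + sc (of_real (quotient_step r v n)) v) - F w - sd (of_real (quotient_step r v n)) (fd F w v))
        \<le> 8 * M / \<rho>\<^sup>2 * (cmod (of_real (quotient_step r v n)))\<^sup>2"
      by (rule directional_second_order[OF F \<rho>]) (use hle[of n] hpos[of n] in2[OF w] r M in \<open>auto simp: subset_iff\<close>)
    then have *: "norm (F (w + quotient_step r v n *\<^sub>R v) - F w - quotient_step r v n *\<^sub>R fd F w v) \<le> 8 * M / \<rho>\<^sup>2 * (quotient_step r v n)\<^sup>2"
      by (simp add: dom.sc_of_real cod.sc_of_real)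
    have "(F (w + quotient_step r v n *\<^sub>R v) - F w) /\<^sub>R quotient_step r v n - fd F w v = (F (w + quotient_step r v n *\<^sub>R v) - F w - quotient_step r v n *\<^sub>R fd F w v) /\<^sub>R quotient_step r v n"
      using hpos[of n] by (simp add: scaleR_diff_right)
    then have "norm ((F (w + quotient_step r v n *\<^sub>R v) - F w) /\<^sub>R quotient_step r v n - fd F w v)
        = norm (F (w + quotient_step r v n *\<^sub>R v) - F w - quotient_step r v n *\<^sub>R fd F w v) / quotient_step r v n"
      using hpos[of n] by (simp add: divide_inverse mult.commute)
    also have "\<dots> \<le> (8 * M / \<rho>\<^sup>2 * (quotient_step r v n)\<^sup>2) / quotient_step r v n"
      by (rule divide_right_mono[OF *]) (use hpos[of n] in simp)
    also have "\<dots> = 8 * M / \<rho>\<^sup>2 * quotient_step r v n"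
      using hpos[of n] by (simp add: power2_eq_square)
    finally show ?thesis .
  qed
  have h0: "quotient_step r v \<longlonglongrightarrow> 0"
    unfolding hr by (rule LIMSEQ_Suc[OF lim_const_over_n])
  have lim: "(\<lambda>n. 8 * M / \<rho>\<^sup>2 * quotient_step r v n) \<longlonglongrightarrow> 0"
    using tendsto_mult_left[OF h0, of "8 * M / \<rho>\<^sup>2"] by simp
  show "uniform_limit (cball z r) (\<lambda>n w. (F (w + quotient_step r v n *\<^sub>R v) - F w) /\<^sub>R quotient_step r v n) (\<lambda>w. fd F w v) sequentially"
  proof (rule uniform_limitI)
    fix e :: real assume "e > 0"
    have "\<forall>\<^sub>F n in sequentially. 8 * M / \<rho>\<^sup>2 * quotient_step r v n < e"
      using order_tendstoD(2)[OF lim \<open>e > 0\<close>] .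
    then show "\<forall>\<^sub>F n in sequentially. \<forall>x\<in>cball z r. dist ((F (x + quotient_step r v n *\<^sub>R v) - F x) /\<^sub>R quotient_step r v n) (fd F x v) < e"
      by (rule eventually_mono) (use est le_less_trans in \<open>unfold dist_norm, blast\<close>)
  qed
qed

lemma holo_map_shift:
  assumes "holo_map sc sd U F" "\<And>z. z \<in> V \<Longrightarrow> z + k \<in> U"
  shows "holo_map sc sd V (\<lambda>z. F (z + k))" "z \<in> V \<Longrightarrow> fd (\<lambda>z. F (z + k)) z v = fd F (z + k) v"
proof -
  have *: "((\<lambda>z. F (z + k)) has_derivative fd F (z + k)) (at z)" if "z \<in> V" for z
    using has_derivative_compose[OF has_derivative_add[OF has_derivative_ident has_derivative_const]
       holo_map_derivative(1)[OF assms(1) assms(2)[OF that]]] by simp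
  then show "holo_map sc sd V (\<lambda>z. F (z + k))"
    unfolding holo_map_def using assms(2) holo_map_derivative(2)[OF assms(1)] by blast
  show "z \<in> V \<Longrightarrow> fd (\<lambda>z. F (z + k)) z v = fd F (z + k) v"
    using fd_eq[OF *] by simp
qed

text \<open>The derivative in direction \<open>v\<close> is a uniform limit of difference quotients, which are holomorphic;
  hence it is holomorphic, and its own derivatives are the limits of those of the quotients.\<close>

lemma derivative_as_limit:
  fixes v :: 'c
  assumes F: "holo_map sc sd U F" and r: "0 < r" "cball z (2 * r) \<subseteq> U"
  shows "holo_map sc sd (ball z r) (\<lambda>w. fd F w v)"
    and "(\<lambda>n. (fd F (z + quotient_step r v n *\<^sub>R v) u - fd F z u) /\<^sub>R quotient_step r v n) \<longlonglongrightarrow> fd (\<lambda>w. fd F w v) z u"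
proof -
  define Q where "Q n w = (F (w + quotient_step r v n *\<^sub>R v) - F w) /\<^sub>R quotient_step r v n" for n w
  note dq = difference_quotient_uniform_limit[OF F r, where v = v]
  have hin: "w + quotient_step r v n *\<^sub>R v \<in> U" if "w \<in> ball z r" for w n
    using dq(2)[where w = w and n = n] that r ball_subset_cball by blast
  have sub: "ball z r \<subseteq> U" using r by auto
  have Fb: "holo_map sc sd (ball z r) F" using holo_map_subset[OF F sub] .
  have QF: "holo_map sc sd (ball z r) (Q n)" for n
    unfolding Q_def by (intro holo_map_scaleR holo_map_diff holo_map_shift[OF F hin] Fb)
  have lim: "\<exists>s>0. cball w s \<subseteq> ball z r \<and> uniform_limit (cball w s) Q (\<lambda>w. fd F w v) sequentially"
    if w: "w \<in> ball z r" for w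
  proof -
    obtain s where s: "s > 0" "cball w s \<subseteq> ball z r"
      using w by (metis open_ball open_contains_cball)
    then have "uniform_limit (cball w s) Q (\<lambda>w. fd F w v) sequentially"
      unfolding Q_def by (intro uniform_limit_on_subset[OF dq(1)]) auto
    with s show ?thesis by blast
  qed
  note ul = holo_map_uniform_limit[OF open_ball QF lim]
  show "holo_map sc sd (ball z r) (\<lambda>w. fd F w v)"
    using ul(1) r by blast
  have zr: "z \<in> ball z r" using r by simp
  have "fd (Q n) z u = (fd F (z + quotient_step r v n *\<^sub>R v) u - fd F z u) /\<^sub>R quotient_step r v n" for n
    unfolding Q_def
    using fd_scaleR[OF holo_map_diff[OF holo_map_shift(1)[OF F hin] Fb] zr]
      fd_diff[OF holo_map_shift(1)[OF F hin] Fb zr] holo_map_shift(2)[OF F hin zr] by simp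
  then show "(\<lambda>n. (fd F (z + quotient_step r v n *\<^sub>R v) u - fd F z u) /\<^sub>R quotient_step r v n) \<longlonglongrightarrow> fd (\<lambda>w. fd F w v) z u"
    using ul(2)[OF _ zr, of u] by simp
qed

lemma open_double_ball:
  assumes "open U" "z \<in> U"
  obtains r where "r > 0" "cball z (2 * r) \<subseteq> U"
proof -
  obtain e where "e > 0" "cball z e \<subseteq> U"
    using assms open_contains_cball by blast
  then show ?thesis using that[of "e / 2"] by simp
qed

lemma holo_map_fd:
  assumes F: "holo_map sc sd U F" and U: "open U"
  shows "holo_map sc sd U (\<lambda>w. fd F w v)"
  unfolding holo_map_def
proof
  fix z assume "z \<in> U"
  then obtain r where r: "r > 0" "cball z (2 * r) \<subseteq> U"
    using open_double_ball[OF U] by blast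
  from derivative_as_limit(1)[OF F r, of v] r(1)
  show "\<exists>F'. ((\<lambda>w. fd F w v) has_derivative F') (at z) \<and> (\<forall>c w. F' (sc c w) = sd c (F' w))"
    unfolding holo_map_def by simp
qed

text \<open>Both sides are the limit of the same difference quotients of the derivative in direction \<open>u\<close>.\<close>

lemma fd_fd_commute:
  assumes F: "holo_map sc sd U F" and U: "open U" and z: "z \<in> U"
  shows "fd (\<lambda>w. fd F w v) z u = fd (\<lambda>w. fd F w u) z v"
proof -
  obtain r where r: "r > 0" "cball z (2 * r) \<subseteq> U"
    using open_double_ball[OF U z] by blast
  show ?thesis
    using LIMSEQ_unique[OF derivative_as_limit(2)[OF F r, of v u] tendsto_uniform_limitI[OF
            difference_quotient_uniform_limit(1)[OF holo_map_fd[OF F U] r, of v u], of z]] r(1)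
    by simp
qed

end

context complex_structure_pair
begin

text \<open>By the Cauchy estimate for \<open>F s - F t\<close>, continuity in time, uniform on compact sets, passes to the
  derivatives.\<close>

lemma continuous_fd:
  fixes F :: "'t::metric_space \<Rightarrow> 'c \<Rightarrow> 'd"
  assumes cont: "continuous_on (T \<times> U) (\<lambda>(t, z). F t z)" and U: "open U"
    and hol: "\<And>t. t \<in> T \<Longrightarrow> holo_map sc sd U (F t)"
  shows "continuous_on (T \<times> U) (\<lambda>(t, z). fd (F t) z v)"
  unfolding continuous_on_iff
proof (clarify, rename_tac t z e)
  fix t z and e :: real assume t: "t \<in> T" and z: "z \<in> U" and e: "e > 0"
  obtain r where r: "r > 0" "cball z (2 * r) \<subseteq> U"
    using open_double_ball[OF U z] by blast
  define d where "d = e / 4 * r / (norm v + 1)"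
  have d: "d > 0" using e r by (simp add: d_def add_nonneg_pos)
  have "d / r * norm v = (e / 4) * (norm v / (norm v + 1))"
    using r by (simp add: d_def)
  also have "\<dots> \<le> e / 4 * 1"
    using e by (intro mult_left_mono) (auto simp: divide_le_eq add_nonneg_pos not_less)
  finally have dv: "d / r * norm v \<le> e / 4" by simp
  have "continuous_on (T \<times> cball z (2 * r)) (\<lambda>(t, z). F t z)"
    by (rule continuous_on_subset[OF cont]) (use r in auto)
  then obtain X where "t \<in> X" "open X"
    "\<forall>x\<in>X \<inter> T. \<forall>w\<in>cball z (2 * r). dist ((\<lambda>(t, z). F t z) (x, w)) ((\<lambda>(t, z). F t z) (t, w)) \<le> d"
    by (rule continuous_on_prod_compactE[OF _ compact_cball t d])
  then have X: "t \<in> X" "open X" "\<forall>x\<in>X \<inter> T. \<forall>w\<in>cball z (2 * r). dist (F x w) (F t w) \<le> d"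
    by simp_all
  obtain \<delta>1 where \<delta>1: "\<delta>1 > 0" "ball t \<delta>1 \<subseteq> X"
    using X open_contains_ball by blast
  have "continuous_on U (\<lambda>w. fd (F t) w v)"
    by (rule holo_map_continuous[OF holo_map_fd[OF hol[OF t] U]])
  then obtain \<delta>2 where \<delta>2: "\<delta>2 > 0" "\<And>w. w \<in> U \<Longrightarrow> dist w z < \<delta>2 \<Longrightarrow> dist (fd (F t) w v) (fd (F t) z v) < e / 2"
    using z e unfolding continuous_on_iff by (meson half_gt_zero)
  show "\<exists>\<delta>>0. \<forall>x'\<in>T \<times> U. dist x' (t, z) < \<delta> \<longrightarrow>
      dist (case x' of (t, z) \<Rightarrow> fd (F t) z v) (fd (F t) z v) < e"
  proof (intro exI[of _ "min \<delta>1 (min \<delta>2 r)"] conjI ballI impI)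
    show "0 < min \<delta>1 (min \<delta>2 r)" using \<delta>1 \<delta>2 r by simp
    fix x' assume x': "x' \<in> T \<times> U" "dist x' (t, z) < min \<delta>1 (min \<delta>2 r)"
    obtain s w where sw: "x' = (s, w)" by force
    have s: "s \<in> T" "dist s t < \<delta>1" and w: "w \<in> U" "dist w z < \<delta>2" "dist w z < r"
      using x' dist_fst_le[of x' "(t, z)"] dist_snd_le[of x' "(t, z)"] by (auto simp: sw)
    have sX: "s \<in> X \<inter> T" using s \<delta>1 by (auto simp: dist_commute)
    have sub: "cball w r \<subseteq> cball z (2 * r)"
      using w r by (simp add: cball_subset_cball_iff)
    have est: "norm (fd (\<lambda>w. F s w - F t w) w v) \<le> d / r * norm v"
      by (rule Cauchy_estimate[OF holo_map_diff[OF hol[OF s(1)] hol[OF t]] r(1)])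
        (use sub r X sX in \<open>auto simp: dist_norm subset_iff\<close>)
    then have "dist (fd (F s) w v) (fd (F t) w v) \<le> e / 4"
      using order_trans[OF est dv] fd_diff[OF hol[OF s(1)] hol[OF t] w(1), of v] by (simp add: dist_norm)
    moreover have "dist (fd (F t) w v) (fd (F t) z v) < e / 2"
      using \<delta>2 w by blast
    ultimately have "dist (fd (F s) w v) (fd (F t) z v) < e"
      using dist_triangle[of "fd (F s) w v" "fd (F t) z v" "fd (F t) w v"] e by linarith
    then show "dist (case x' of (t, z) \<Rightarrow> fd (F t) z v) (fd (F t) z v) < e"
      by (simp add: sw)
  qed
qed

end

context complex_structure_pair
begin

text \<open>A parametric integral of holomorphic maps with an integrable bound is holomorphic: the second
  order remainder of the integrand is bounded by the integrable bound times the squared increment.\<close>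

lemma holo_map_integral:
  fixes G :: "real \<Rightarrow> 'c \<Rightarrow> 'd"
  assumes U: "open U" and hol: "\<And>t. t \<in> T \<Longrightarrow> holo_map sc sd U (G t)"
    and int: "\<And>z. z \<in> U \<Longrightarrow> (\<lambda>t. G t z) integrable_on T"
    and int': "\<And>z v. z \<in> U \<Longrightarrow> (\<lambda>t. fd (G t) z v) integrable_on T"
    and bound: "\<And>t z. t \<in> T \<Longrightarrow> z \<in> U \<Longrightarrow> norm (G t z) \<le> m t" and m: "m integrable_on T"
  shows "holo_map sc sd U (\<lambda>z. integral T (\<lambda>t. G t z))"
    and "\<And>z v. z \<in> U \<Longrightarrow> fd (\<lambda>z. integral T (\<lambda>t. G t z)) z v = integral T (\<lambda>t. fd (G t) z v)"
proof -
  define I where "I z = integral T (\<lambda>t. G t z)" for z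
  define I' where "I' z v = integral T (\<lambda>t. fd (G t) z v)" for z v
  have sc: "I' z (sc c v) = sd c (I' z v)" if z: "z \<in> U" for z c v
  proof -
    have "I' z (sc c v) = integral T (\<lambda>t. sd c (fd (G t) z v))"
      unfolding I'_def by (rule integral_cong) (use holo_map_derivative(2)[OF hol z] in auto)
    also have "\<dots> = sd c (I' z v)"
      using integral_linear[OF int'[OF z, of v] cod.bounded_linear_sc_right[of c]] by (simp add: I'_def o_def)
    finally show ?thesis .
  qed
  have der: "(I has_derivative I' z) (at z)" if z: "z \<in> U" for z
  proof -
    obtain r where r: "r > 0" "cball z (2 * r) \<subseteq> U"
      using open_double_ball[OF U z] by blast
    have add: "I' z (v + w) = I' z v + I' z w" for v w
    proof -
      have "I' z (v + w) = integral T (\<lambda>t. fd (G t) z v + fd (G t) z w)"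
        unfolding I'_def
        by (rule integral_cong) (use fd_linear[OF hol z] in \<open>auto simp: bounded_linear.linear linear_add\<close>)
      then show ?thesis by (simp add: I'_def integral_add[OF int'[OF z] int'[OF z]])
    qed
    have lin: "bounded_linear (I' z)"
      by (rule linear_conv_bounded_linear[THEN iffD1], rule linearI[OF add])
        (use sc[OF z, of "of_real _"] in \<open>simp add: dom.sc_of_real cod.sc_of_real\<close>)
    define K where "K = 8 * integral T m / r\<^sup>2"
    have K: "norm (I (z + v) - I z - I' z v) \<le> K * (norm v)\<^sup>2" if v: "norm v \<le> r / 2" for v
    proof (cases "v = 0")
      case True
      then show ?thesis using lin by (simp add: bounded_linear.linear linear_0)
    next
      case False
      have zv: "z + v \<in> U" using v r by (auto simp: subset_iff dist_norm)
      have in2: "z + sc \<zeta> v \<in> U" if "cmod \<zeta> \<le> r / norm v" for \<zeta>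
      proof -
        have "norm (sc \<zeta> v) \<le> r" using that False by (simp add: dom.norm_sc field_simps)
        then have "z + sc \<zeta> v \<in> cball z (2 * r)" using r by (simp add: dist_norm)
        then show ?thesis using r by blast
      qed
      have "I (z + v) - I z - I' z v = integral T (\<lambda>t. G t (z + v) - G t z - fd (G t) z v)"
        using integral_diff[OF integrable_diff[OF int[OF zv] int[OF z]] int'[OF z, of v]]
          integral_diff[OF int[OF zv] int[OF z]] by (simp add: I_def I'_def)
      then have "norm (I (z + v) - I z - I' z v) = norm (integral T (\<lambda>t. G t (z + v) - G t z - fd (G t) z v))"
        by simp
      also have "\<dots> \<le> integral T (\<lambda>t. 8 * m t / (r / norm v)\<^sup>2 * 1)"
      proof (rule integral_norm_bound_integral)
        fix t assume t: "t \<in> T"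
        have "norm (G t (z + sc 1 v) - G t z - sd 1 (fd (G t) z v)) \<le> 8 * m t / (r / norm v)\<^sup>2 * (cmod 1)\<^sup>2"
          by (rule directional_second_order[OF hol[OF t]])
            (use r v False in2 bound[OF t] in \<open>auto simp: field_simps\<close>)
        then show "norm (G t (z + v) - G t z - fd (G t) z v) \<le> 8 * m t / (r / norm v)\<^sup>2 * 1"
          by simp
      qed (intro integrable_diff int int' z zv, use m in \<open>auto intro!: integrable_on_mult_left integrable_on_mult_right integrable_on_divide\<close>)
      also have "\<dots> = K * (norm v)\<^sup>2"
        by (simp add: K_def power_divide)
      finally show ?thesis .
    qed
    show ?thesis
      unfolding has_derivative_at_within
    proof (intro conjI lin)
      have lim: "((\<lambda>y. K * norm (y - z)) \<longlongrightarrow> 0) (at z)"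
        by (auto intro!: tendsto_eq_intros)
      show "((\<lambda>y. ((I y - I z) - I' z (y - z)) /\<^sub>R norm (y - z)) \<longlongrightarrow> 0) (at z)"
      proof (rule Lim_null_comparison[OF _ lim])
        have "\<forall>\<^sub>F y in at z. dist y z < r / 2"
          using r by (auto simp: eventually_at intro: exI[of _ "r / 2"])
        moreover have "\<forall>\<^sub>F y in at z. y \<noteq> z" by (simp add: eventually_neq_at_within)
        ultimately show "\<forall>\<^sub>F y in at z. norm ((I y - I z - I' z (y - z)) /\<^sub>R norm (y - z)) \<le> K * norm (y - z)"
        proof eventually_elim
          case (elim y)
          have "norm (I y - I z - I' z (y - z)) / norm (y - z) \<le> K * (norm (y - z))\<^sup>2 / norm (y - z)"
            using K[of "y - z"] elim by (intro divide_right_mono) (auto simp: dist_norm diff_diff_eq)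
          also have "\<dots> = K * norm (y - z)"
            using elim by (simp add: power2_eq_square)
          finally show ?case by (simp add: divide_inverse mult.commute)
        qed
      qed
    qed
  qed
  show "holo_map sc sd U (\<lambda>z. integral T (\<lambda>t. G t z))"
    unfolding holo_map_def I_def[symmetric] using der sc by blast
  show "\<And>z v. z \<in> U \<Longrightarrow> fd (\<lambda>z. integral T (\<lambda>t. G t z)) z v = integral T (\<lambda>t. fd (G t) z v)"
    using fd_eq[OF der] unfolding I_def I'_def by metis
qed

end

text \<open>The identity principle along the complex line through \<open>x\<close> in direction \<open>y\<close>, whose real axis carries
  the agreement. For real \<open>x\<close> and \<open>y\<close> every point of a complexified space has the form \<open>x + i y\<close>.\<close>

lemma (in complex_structure) holo_map_identity:
  assumes F: "holo_map sc (*) U F" and G: "holo_map sc (*) U G" and U: "open U" "convex U"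
    and x: "x \<in> U" "x + sc \<i> y \<in> U"
    and eq: "\<And>r::real. x + r *\<^sub>R y \<in> U \<Longrightarrow> F (x + r *\<^sub>R y) = G (x + r *\<^sub>R y)"
  shows "F (x + sc \<i> y) = G (x + sc \<i> y)"
proof -
  interpret C: complex_structure "(*) :: complex \<Rightarrow> _" by (rule complex_structure_mult)
  interpret complex_structure_pair sc "(*)" ..
  define S where "S = {\<zeta>. x + sc \<zeta> y \<in> U}"
  have cont: "continuous_on UNIV (\<lambda>\<zeta>. x + sc \<zeta> y)"
    by (intro continuous_intros linear_continuous_on bounded_linear_sc_left)
  have oS: "open S"
    using open_vimage[OF U(1) cont] by (simp add: S_def vimage_def)
  have "convex S"
  proof (rule convexI)
    fix a b :: complex and u v :: real assume a: "a \<in> S" "b \<in> S" "0 \<le> u" "0 \<le> v" "u + v = 1"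
    have "x + sc (u *\<^sub>R a + v *\<^sub>R b) y = (u + v) *\<^sub>R x + sc (u *\<^sub>R a + v *\<^sub>R b) y"
      using a by simp
    also have "\<dots> = u *\<^sub>R (x + sc a y) + v *\<^sub>R (x + sc b y)"
      by (simp add: sc_add_left sc_scaleR_left algebra_simps)
    finally show "u *\<^sub>R a + v *\<^sub>R b \<in> S"
      using a convexD[OF U(2), of "x + sc a y" "x + sc b y" u v] by (simp add: S_def)
  qed
  then have cS: "connected S" by (rule convex_connected)
  have hol: "(\<lambda>\<zeta>. F (x + sc \<zeta> y) - G (x + sc \<zeta> y)) holomorphic_on S"
  proof -
    have *: "((\<lambda>\<zeta>. H (x + sc \<zeta> y)) has_field_derivative fd H (x + sc \<zeta> y) y) (at \<zeta>)"
      if "\<zeta> \<in> S" "holo_map sc (*) U H" for H \<zeta>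
    proof -
      have "((\<lambda>\<zeta>. x + sc \<zeta> y) has_derivative (\<lambda>h. sc h y)) (at \<zeta>)"
        using has_derivative_add[OF has_derivative_const bounded_linear_imp_has_derivative[OF bounded_linear_sc_left]]
        by simp
      from has_derivative_compose[OF this holo_map_derivative(1)[OF that(2)]] that
      have "((\<lambda>\<zeta>. H (x + sc \<zeta> y)) has_derivative (\<lambda>h. h * fd H (x + sc \<zeta> y) y)) (at \<zeta>)"
        by (simp add: S_def holo_map_derivative(2)[OF that(2)])
      moreover have "(\<lambda>h. h * fd H (x + sc \<zeta> y) y) = (*) (fd H (x + sc \<zeta> y) y)"
        by (rule ext) (rule mult.commute)
      ultimately show ?thesis
        by (simp only: has_field_derivative_def)
    qed
    then have "(\<lambda>\<zeta>. H (x + sc \<zeta> y)) holomorphic_on S" if "holo_map sc (*) U H" for H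
      using that by (meson field_differentiable_at_within field_differentiable_def holomorphic_on_def)
    from this[OF F] this[OF G] show ?thesis
      by (rule holomorphic_on_diff)
  qed
  obtain e where e: "e > 0" "ball 0 e \<subseteq> S"
    using openE[OF oS, of 0] x(1) by (auto simp: S_def)
  have "F (x + sc \<i> y) - G (x + sc \<i> y) = 0"
  proof (rule analytic_continuation[OF hol oS cS, of "of_real ` {0<..<e}" 0])
    show "of_real ` {0<..<e} \<subseteq> S" using e by auto
    show "0 \<in> S" using x by (simp add: S_def)
    show "0 islimpt complex_of_real ` {0<..<e}"
      unfolding islimpt_approachable
    proof (intro allI impI)
      fix d :: real assume "d > 0"
      then have "min d e / 2 \<in> {0<..<e}" using e by auto
      then have m: "complex_of_real (min d e / 2) \<in> complex_of_real ` {0<..<e}"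
        by (rule imageI)
      have "complex_of_real (min d e / 2) \<noteq> 0" "dist (complex_of_real (min d e / 2)) 0 < d"
        using \<open>d > 0\<close> e by (simp_all only: of_real_eq_0_iff dist_norm diff_0_right norm_of_real)
      with m show "\<exists>x'\<in>complex_of_real ` {0<..<e}. x' \<noteq> 0 \<and> dist x' 0 < d"
        by blast
    qed
    show "F (x + sc z y) - G (x + sc z y) = 0" if z: "z \<in> complex_of_real ` {0<..<e}" for z
    proof -
      obtain r where r: "z = of_real r" "r \<in> {0<..<e}" using z by blast
      then have "z \<in> S" using e by auto
      then show ?thesis using eq[of r] by (simp add: r sc_of_real S_def)
    qed
    show "\<i> \<in> S" using x by (simp add: S_def)
  qed
  then show ?thesis by simp
qed

section \<open>The complexified phase space\<close>

text \<open>Linear algebra on \<open>C^n\<close> and \<open>C^n \<times> C^n\<close>. In the interpretations below, the letters stand for the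
  domain and codomain of the maps considered: \<open>C\<close> for the scalars, \<open>V\<close> for vectors and \<open>P\<close> for pairs.\<close>

lemma complex_structure_scale_vec: "complex_structure (scale_vec :: complex \<Rightarrow> complex ^ 'n \<Rightarrow> _)"
proof
  fix c and v :: "complex ^ 'n"
  show "norm (scale_vec c v) = cmod c * norm v"
    by (simp add: scale_vec_def norm_vec_def norm_mult L2_set_right_distrib)
qed (auto simp: scale_vec_def vec_eq_iff algebra_simps scaleR_conv_of_real[where 'a = complex])

interpretation V: complex_structure scale_vec
  by (rule complex_structure_scale_vec)

lemma complex_structure_scale_pair: "complex_structure (scale_pair :: complex \<Rightarrow> 'n::finite cphase \<Rightarrow> _)"
proof
  fix c and v :: "'n cphase"
  have "norm (scale_pair c v) = sqrt ((cmod c * norm (fst v))\<^sup>2 + (cmod c * norm (snd v))\<^sup>2)"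
    by (cases v) (simp add: scale_pair_def norm_Pair V.norm_sc)
  also have "\<dots> = sqrt ((cmod c)\<^sup>2 * ((norm (fst v))\<^sup>2 + (norm (snd v))\<^sup>2))"
    by (simp add: power_mult_distrib distrib_left)
  also have "\<dots> = cmod c * norm v"
    by (cases v) (simp add: norm_Pair real_sqrt_mult)
  finally show "norm (scale_pair c v) = cmod c * norm v" .
qed (auto simp: scale_pair_def prod_eq_iff V.sc_add_left V.sc_add_right V.sc_mult V.sc_of_real)

interpretation C: complex_structure "(*) :: complex \<Rightarrow> _" by (rule complex_structure_mult)
interpretation P: complex_structure scale_pair by (rule complex_structure_scale_pair)
interpretation VC: complex_structure_pair scale_vec "(*) :: complex \<Rightarrow> _" ..
interpretation PC: complex_structure_pair scale_pair "(*) :: complex \<Rightarrow> _" ..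
interpretation PV: complex_structure_pair scale_pair scale_vec ..
interpretation VV: complex_structure_pair scale_vec scale_vec ..
interpretation VP: complex_structure_pair scale_vec scale_pair ..
interpretation PP: complex_structure_pair scale_pair scale_pair ..

lemma scale_pair_simps [simp]:
  "fst (scale_pair c z) = scale_vec c (fst z)" "snd (scale_pair c z) = scale_vec c (snd z)"
  "scale_vec c v $ k = c * v $ k"
  by (cases z; simp add: scale_pair_def scale_vec_def)+

lemma scale_pair_Pair [simp]: "scale_pair c (u, v) = (scale_vec c u, scale_vec c v)"
  by (simp add: scale_pair_def)

lemma holo_map_Pair:
  assumes "holo_map sc scale_vec U F" "holo_map sc scale_vec U G"
  shows "holo_map sc scale_pair U (\<lambda>z. (F z, G z))"
  unfolding holo_map_def
proof
  fix z assume z: "z \<in> U"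
  show "\<exists>F'. ((\<lambda>z. (F z, G z)) has_derivative F') (at z) \<and> (\<forall>c v. F' (sc c v) = scale_pair c (F' v))"
    using has_derivative_Pair[OF holo_map_derivative(1)[OF assms(1) z] holo_map_derivative(1)[OF assms(2) z]]
      holo_map_derivative(2)[OF assms(1) z] holo_map_derivative(2)[OF assms(2) z]
    by (intro exI[of _ "\<lambda>v. (fd F z v, fd G z v)"]) (auto simp: scale_pair_def)
qed

lemma has_derivative_vec_componentwise:
  fixes F :: "'a::real_normed_vector \<Rightarrow> 'b::euclidean_space ^ 'n"
  shows "(F has_derivative F') (at z) \<longleftrightarrow> (\<forall>k. ((\<lambda>z. F z $ k) has_derivative (\<lambda>v. F' v $ k)) (at z))"
    (is "?L \<longleftrightarrow> ?R")
proof
  assume ?L then show ?R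
    using bounded_linear.has_derivative[OF bounded_linear_vec_nth] by blast
next
  assume R: ?R
  show ?L
    unfolding has_derivative_componentwise_within[of F]
  proof
    fix b :: "'b ^ 'n" assume "b \<in> Basis"
    then obtain k u where b: "b = axis k u"
      by (auto simp: Basis_vec_def)
    show "((\<lambda>x. F x \<bullet> b) has_derivative (\<lambda>x. F' x \<bullet> b)) (at z)"
      unfolding b inner_axis
      using bounded_linear.has_derivative[OF bounded_linear_inner_left R[rule_format, of k]] .
  qed
qed

lemma holo_map_vec:
  assumes "\<And>k. holo_map sc (*) U (\<lambda>z. F z $ k)"
  shows "holo_map sc scale_vec U F"
  unfolding holo_map_def
proof
  fix z assume z: "z \<in> U"
  show "\<exists>F'. (F has_derivative F') (at z) \<and> (\<forall>c v. F' (sc c v) = scale_vec c (F' v))"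
    using holo_map_derivative[OF assms z]
    by (intro exI[of _ "\<lambda>v. \<chi> k. fd (\<lambda>z. F z $ k) z v"])
      (auto simp: has_derivative_vec_componentwise vec_eq_iff)
qed

lemma holo_map_nth:
  fixes F :: "'c::real_normed_vector \<Rightarrow> complex ^ 'n"
  assumes "holo_map sc scale_vec U F"
  shows "holo_map sc (*) U (\<lambda>z. F z $ k)"
    and "z \<in> U \<Longrightarrow> fd (\<lambda>z. F z $ k) z v = fd F z v $ k"
proof -
  have *: "((\<lambda>z. F z $ k) has_derivative (\<lambda>v. fd F z v $ k)) (at z)" if "z \<in> U" for z
    using holo_map_derivative(1)[OF assms that] has_derivative_vec_componentwise[of F "fd F z" z] by blast
  show "holo_map sc (*) U (\<lambda>z. F z $ k)"
    unfolding holo_map_def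
  proof
    fix z assume z: "z \<in> U"
    show "\<exists>F'. ((\<lambda>z. F z $ k) has_derivative F') (at z) \<and> (\<forall>c v. F' (sc c v) = (*) c (F' v))"
      using *[OF z] holo_map_derivative(2)[OF assms z] by (intro exI[of _ "\<lambda>v. fd F z v $ k"]) simp
  qed
  show "z \<in> U \<Longrightarrow> fd (\<lambda>z. F z $ k) z v = fd F z v $ k"
    using fd_eq[OF *] by simp
qed

lemma holo_map_fst_snd:
  assumes "holo_map sc scale_pair U F"
  shows "holo_map sc scale_vec U (\<lambda>z. fst (F z))" "holo_map sc scale_vec U (\<lambda>z. snd (F z))"
    and "z \<in> U \<Longrightarrow> fd (\<lambda>z. fst (F z)) z v = fst (fd F z v)"
    and "z \<in> U \<Longrightarrow> fd (\<lambda>z. snd (F z)) z v = snd (fd F z v)"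
proof -
  have f: "((\<lambda>z. fst (F z)) has_derivative (\<lambda>v. fst (fd F z v))) (at z)" if "z \<in> U" for z
    using has_derivative_fst[OF holo_map_derivative(1)[OF assms that]] .
  have s: "((\<lambda>z. snd (F z)) has_derivative (\<lambda>v. snd (fd F z v))) (at z)" if "z \<in> U" for z
    using has_derivative_snd[OF holo_map_derivative(1)[OF assms that]] .
  show "holo_map sc scale_vec U (\<lambda>z. fst (F z))"
    unfolding holo_map_def
  proof
    fix z assume z: "z \<in> U"
    show "\<exists>F'. ((\<lambda>z. fst (F z)) has_derivative F') (at z) \<and> (\<forall>c v. F' (sc c v) = scale_vec c (F' v))"
      using f[OF z] holo_map_derivative(2)[OF assms z] by (intro exI[of _ "\<lambda>v. fst (fd F z v)"]) simp
  qed
  show "holo_map sc scale_vec U (\<lambda>z. snd (F z))"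
    unfolding holo_map_def
  proof
    fix z assume z: "z \<in> U"
    show "\<exists>F'. ((\<lambda>z. snd (F z)) has_derivative F') (at z) \<and> (\<forall>c v. F' (sc c v) = scale_vec c (F' v))"
      using s[OF z] holo_map_derivative(2)[OF assms z] by (intro exI[of _ "\<lambda>v. snd (fd F z v)"]) simp
  qed
  show "z \<in> U \<Longrightarrow> fd (\<lambda>z. fst (F z)) z v = fst (fd F z v)"
    "z \<in> U \<Longrightarrow> fd (\<lambda>z. snd (F z)) z v = snd (fd F z v)"
    using fd_eq[OF f] fd_eq[OF s] by simp_all
qed

definition im_vec :: "complex ^ 'n \<Rightarrow> real ^ 'n" where
  "im_vec q = (\<chi> i. Im (q $ i))"

definition re_vec :: "complex ^ 'n \<Rightarrow> real ^ 'n" where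
  "re_vec q = (\<chi> i. Re (q $ i))"

lemma vec_L2_mono: 
  fixes x :: "'a::real_normed_vector ^ 'n" and y :: "'b::real_normed_vector ^ 'n"
  assumes "\<And>i. norm (x $ i) \<le> norm (y $ i)" 
  shows "norm x \<le> norm y"
  unfolding norm_vec_def by (rule L2_set_mono) (use assms in auto)

lemma bounded_linear_im_vec: "bounded_linear im_vec"
  by (rule bounded_linear_intro[of _ 1])
    (auto simp: im_vec_def vec_eq_iff intro!: vec_L2_mono abs_Im_le_cmod)

lemma bounded_linear_re_vec: "bounded_linear re_vec"
  by (rule bounded_linear_intro[of _ 1])
    (auto simp: re_vec_def vec_eq_iff intro!: vec_L2_mono abs_Re_le_cmod)

lemma norm_im_vec_le: "norm (im_vec q) \<le> norm q" and norm_re_vec_le: "norm (re_vec q) \<le> norm q"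
  by (auto simp: im_vec_def re_vec_def intro!: vec_L2_mono abs_Im_le_cmod abs_Re_le_cmod)

lemma cvec_nth: "cvec x $ i = of_real (x $ i)"
  by (simp add: cvec_def)

lemma norm_cvec [simp]: "norm (cvec x) = norm x"
  by (simp add: cvec_def norm_vec_def)

lemma bounded_linear_cvec: "bounded_linear cvec"
  by (rule bounded_linear_intro[of _ 1])
    (simp_all add: vec_eq_iff scaleR_conv_of_real[where 'a = complex] cvec_nth)

lemma cvec_simps [simp]: "cvec x $ i = of_real (x $ i)" "im_vec (cvec x) = 0" "re_vec (cvec x) = x"
  "im_vec q $ i = Im (q $ i)" "re_vec q $ i = Re (q $ i)" "cvec 0 = 0" "im_vec 0 = 0" "re_vec 0 = 0"
  by (auto simp: cvec_def im_vec_def re_vec_def vec_eq_iff)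

lemma cvec_add: "cvec (x + y) = cvec x + cvec y" and cvec_diff: "cvec (x - y) = cvec x - cvec y"
  and cvec_scaleR: "cvec (r *\<^sub>R x) = r *\<^sub>R cvec x" and cvec_minus: "cvec (- x) = - cvec x"
  and im_vec_add: "im_vec (p + q) = im_vec p + im_vec q" and im_vec_diff: "im_vec (p - q) = im_vec p - im_vec q"
  and im_vec_scaleR: "im_vec (r *\<^sub>R q) = r *\<^sub>R im_vec q"
  by (auto simp: vec_eq_iff scaleR_conv_of_real[where 'a = complex])

lemma cvec_decompose: "q = cvec (re_vec q) + scale_vec \<i> (cvec (im_vec q))"
  by (simp add: vec_eq_iff) (metis complex_eq)

lemma im_vec_eq_0: "im_vec q = 0 \<longleftrightarrow> q = cvec (re_vec q)"
  by (auto simp: vec_eq_iff complex_eq_iff)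

lemma cpair_simps [simp]: "cpair (q, p) = (cvec q, cvec p)" "fst (cpair z) = cvec (fst z)" "snd (cpair z) = cvec (snd z)"
  by (auto simp: cpair_def)

lemma bounded_linear_cpair: "bounded_linear cpair"
  by (rule bounded_linear_intro[of _ 1])
    (auto simp: cpair_def prod_eq_iff cvec_add cvec_scaleR map_prod_def split_beta norm_prod_def)

lemma cpair_add: "cpair (x + y) = cpair x + cpair y" and cpair_scaleR: "cpair (r *\<^sub>R x) = r *\<^sub>R cpair x"
  by (simp_all add: prod_eq_iff cvec_add cvec_scaleR)

text \<open>Open versions of the domains on which the norms are defined; only there are derivatives available.\<close>

definition open_strip :: "real \<Rightarrow> (complex ^ 'n) set" where
  "open_strip r = {q. norm (im_vec q) < r}"

definition domain :: "real \<Rightarrow> 'n::finite cphase set" where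
  "domain r = open_strip r \<times> ball 0 r"

lemma open_open_strip: "open (open_strip r)"
  unfolding open_strip_def
  by (intro open_Collect_less continuous_intros linear_continuous_on bounded_linear_im_vec)

lemma convex_open_strip: "convex (open_strip r)"
proof -
  have "open_strip r = im_vec -` ball 0 r"
    by (auto simp: open_strip_def)
  then show ?thesis
    using convex_linear_vimage[OF bounded_linear.linear[OF bounded_linear_im_vec]] convex_ball by metis
qed

lemma open_domain: "open (domain r)" and convex_domain: "convex (domain r)"
  unfolding domain_def by (auto intro!: open_Times convex_Times open_open_strip convex_open_strip)

lemma domain_mono: "r \<le> s \<Longrightarrow> domain r \<subseteq> domain s" and open_strip_mono: "r \<le> s \<Longrightarrow> open_strip r \<subseteq> open_strip s"
  by (auto simp: domain_def open_strip_def)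

lemma strip_eq: "strip r = {q. norm (im_vec q) \<le> r}"
  by (simp add: strip_def im_vec_def)

lemma strip_subset_open_strip: "r < s \<Longrightarrow> strip r \<subseteq> open_strip s"
  and strip_ball_subset_domain: "r < s \<Longrightarrow> strip_ball r \<subseteq> domain s"
  and open_strip_subset_strip: "open_strip r \<subseteq> strip r"
  and domain_subset_strip_ball: "domain r \<subseteq> strip_ball r"
  by (auto simp: domain_def open_strip_def strip_ball_def strip_eq)

lemma domain_subset_interior: "domain r \<subseteq> interior (strip_ball r)"
  using interior_maximal[OF domain_subset_strip_ball open_domain] .

lemma open_strip_subset_interior: "open_strip r \<subseteq> interior (strip r)"
  using interior_maximal[OF open_strip_subset_strip open_open_strip] .

lemma cvec_in_open_strip [simp]: "0 < r \<Longrightarrow> cvec q \<in> open_strip r" "q' + cvec x \<in> open_strip r \<longleftrightarrow> q' \<in> open_strip r"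
  by (simp_all add: open_strip_def im_vec_add)

text \<open>Every point of the complexified domains lies on the complex line through its real part in the
  direction of its imaginary part, and by convexity the part of this line inside the domain is connected.\<close>

lemma open_strip_identity:
  assumes "holo_map scale_vec (*) (open_strip r) F" "holo_map scale_vec (*) (open_strip r) G" "0 < r"
    and eq: "\<And>x. F (cvec x) = G (cvec x)" and q: "q \<in> open_strip r"
  shows "F q = G q"
proof -
  have "F (cvec (re_vec q) + scale_vec \<i> (cvec (im_vec q))) = G (cvec (re_vec q) + scale_vec \<i> (cvec (im_vec q)))"
    by (rule V.holo_map_identity[OF assms(1,2) open_open_strip convex_open_strip])
      (use assms(3) q cvec_decompose[of q, symmetric] eq in \<open>auto simp flip: cvec_scaleR cvec_add\<close>)
  then show ?thesis using cvec_decompose[of q, symmetric] by simp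
qed

lemma domain_identity:
  assumes "holo_map scale_pair (*) (domain r) F" "holo_map scale_pair (*) (domain r) G" "0 < r"
    and eq: "\<And>x. norm (snd x) < r \<Longrightarrow> F (cpair x) = G (cpair x)" and z: "z \<in> domain r"
  shows "F z = G z"
proof -
  let ?x = "cpair (re_vec (fst z), re_vec (snd z))" and ?y = "cpair (im_vec (fst z), im_vec (snd z))"
  have dec: "?x + scale_pair \<i> ?y = z"
    using cvec_decompose[of "fst z", symmetric] cvec_decompose[of "snd z", symmetric] by (simp add: prod_eq_iff)
  have "F (?x + scale_pair \<i> ?y) = G (?x + scale_pair \<i> ?y)"
  proof (rule P.holo_map_identity[OF assms(1,2) open_domain convex_domain])
    show "?x \<in> domain r" 
      using z assms(3) norm_re_vec_le[of "snd z"] by (auto simp: domain_def mem_Times_iff)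
    show "?x + scale_pair \<i> ?y \<in> domain r" using z dec by simp
    fix t :: real assume "?x + t *\<^sub>R ?y \<in> domain r"
    moreover have *: "?x + t *\<^sub>R ?y = cpair ((re_vec (fst z), re_vec (snd z)) + t *\<^sub>R (im_vec (fst z), im_vec (snd z)))"
      by (simp only: cpair_add cpair_scaleR)
    ultimately show "F (?x + t *\<^sub>R ?y) = G (?x + t *\<^sub>R ?y)"
      unfolding * by (intro eq) (auto simp: domain_def mem_Times_iff simp del: cpair_simps(1))
  qed
  then show ?thesis using dec by simp
qed

text \<open>The derivative of \<open>G \<circ> \<iota>\<close> is real because \<open>G \<circ> \<iota>\<close> is; thus complex derivatives of extensions
  compute real ones.\<close>

lemma real_derivative_of_extension:
  fixes \<iota> :: "'r::real_normed_vector \<Rightarrow> 'c::real_normed_vector"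
  assumes \<iota>: "bounded_linear \<iota>" and G: "(G has_derivative G') (at (\<iota> x))"
    and U: "open U" "x \<in> U" and eq: "\<And>y. y \<in> U \<Longrightarrow> G (\<iota> y) = complex_of_real (g y)"
  shows "(g has_derivative (\<lambda>v. Re (G' (\<iota> v)))) (at x)" "G' (\<iota> v) = complex_of_real (Re (G' (\<iota> v)))"
proof -
  have D: "((\<lambda>y. G (\<iota> y)) has_derivative (\<lambda>v. G' (\<iota> v))) (at x)"
    using has_derivative_compose[OF bounded_linear_imp_has_derivative[OF \<iota>] G] .
  have "((\<lambda>y. Re (G (\<iota> y))) has_derivative (\<lambda>v. Re (G' (\<iota> v)))) (at x)"
    by (rule has_derivative_Re[OF D])
  then show "(g has_derivative (\<lambda>v. Re (G' (\<iota> v)))) (at x)"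
    by (rule has_derivative_transform_within_open[OF _ U]) (simp add: eq)
  have "((\<lambda>y. Im (G (\<iota> y))) has_derivative (\<lambda>v. Im (G' (\<iota> v)))) (at x)"
    by (rule has_derivative_Im[OF D])
  then have "((\<lambda>y. 0) has_derivative (\<lambda>v. Im (G' (\<iota> v)))) (at x)"
    by (rule has_derivative_transform_within_open[OF _ U]) (simp add: eq)
  then have "(\<lambda>v. Im (G' (\<iota> v))) = (\<lambda>v. 0)"
    using has_derivative_unique has_derivative_const by blast
  then show "G' (\<iota> v) = complex_of_real (Re (G' (\<iota> v)))"
    by (simp add: complex_eq_iff fun_eq_iff)
qed

section \<open>Tails of decaying functions\<close>

definition tail :: "(real \<Rightarrow> real) \<Rightarrow> real \<Rightarrow> real" where
  "tail a t = integral {t..} a"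

lemma integrable_on_half_line:
  fixes g :: "real \<Rightarrow> 'd::euclidean_space"
  assumes "continuous_on {t..} g" "m integrable_on {t..}" "\<And>x. t \<le> x \<Longrightarrow> norm (g x) \<le> m x"
  shows "g integrable_on {t..}" "norm (integral {t..} g) \<le> integral {t..} m"
proof -
  show g: "g integrable_on {t..}"
    by (rule measurable_bounded_by_integrable_imp_integrable[OF _ assms(2)])
      (use assms in \<open>auto intro!: continuous_imp_measurable_on_sets_lebesgue\<close>)
  show "norm (integral {t..} g) \<le> integral {t..} m"
    by (rule integral_norm_bound_integral[OF g assms(2)]) (use assms in auto)
qed

lemma half_line_split:
  fixes g :: "real \<Rightarrow> 'd::euclidean_space"
  assumes "t \<le> s" "g integrable_on {t..s}" "g integrable_on {s..}"
  shows "g integrable_on {t..}" "integral {t..} g = integral {t..s} g + integral {s..} g"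
proof -
  have "{t..} = {t..s} \<union> {s..}" using assms by auto
  moreover have "(g has_integral (integral {t..s} g + integral {s..} g)) ({t..s} \<union> {s..})"
    by (rule has_integral_Un)
      (use assms in \<open>auto simp: integrable_integral Int_atLeastAtMostL1 atLeastAtMost_singleton_iff intro: negligible_subset[of "{s}"]\<close>)
  ultimately have "(g has_integral (integral {t..s} g + integral {s..} g)) {t..}" by simp
  then show "g integrable_on {t..}" "integral {t..} g = integral {t..s} g + integral {s..} g"
    by (auto simp: has_integral_integrable integral_unique)
qed

lemma tail_integral_has_vector_derivative:
  fixes g :: "real \<Rightarrow> 'd::euclidean_space"
  assumes cont: "continuous_on {T..} g" and int: "\<And>t. T \<le> t \<Longrightarrow> g integrable_on {t..}" and t: "T \<le> t"
  shows "((\<lambda>t. integral {t..} g) has_vector_derivative - g t) (at t within {T..})"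
proof -
  have "((\<lambda>u. integral {T..u} g) has_vector_derivative g t) (at t within {T..t + 1})"
    by (rule integral_has_vector_derivative) (use t in \<open>auto intro: continuous_on_subset[OF cont]\<close>)
  then have "((\<lambda>u. integral {T..} g - integral {T..u} g) has_vector_derivative - g t) (at t within {T..t + 1})"
    by (auto intro!: derivative_eq_intros)
  then have "((\<lambda>u. integral {u..} g) has_vector_derivative - g t) (at t within {T..t + 1})"
  proof (rule has_vector_derivative_transform[rotated 2])
    fix u assume u: "u \<in> {T..t + 1}"
    have "g integrable_on {T..u}"
      by (rule integrable_continuous_real) (auto intro: continuous_on_subset[OF cont])
    then show "integral {u..} g = integral {T..} g - integral {T..u} g"
      using half_line_split(2)[of T u g] int u by auto
  qed (use t in auto)
  moreover have "at t within {T..t + 1} = at t within {T..}"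
    by (rule at_within_nhd[of _ "{t - 1<..<t + 1}"]) auto
  ultimately show ?thesis by simp
qed

locale decaying =
  fixes a :: "real \<Rightarrow> real"
  assumes pos: "0 \<le> t \<Longrightarrow> 0 < a t"
    and antimono: "antimono_on {0..} a"
    and integrable: "a integrable_on {0..}"
begin

lemma mono: "0 \<le> s \<Longrightarrow> s \<le> t \<Longrightarrow> a t \<le> a s"
  using antimono by (auto simp: monotone_on_def)

lemma abs_int: "a absolutely_integrable_on {0..}"
  by (rule nonnegative_absolutely_integrable_1[OF integrable]) (use pos in \<open>auto intro: less_imp_le\<close>)

lemma integrable_subset: "S \<subseteq> {0..} \<Longrightarrow> S \<in> sets lebesgue \<Longrightarrow> a integrable_on S"
  using set_integrable_subset[OF abs_int] set_lebesgue_integral_eq_integral(1) by blast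

lemma integrable_tail: "0 \<le> t \<Longrightarrow> a integrable_on {t..}"
  and integrable_segment: "0 \<le> t \<Longrightarrow> a integrable_on {t..s}"
  by (rule integrable_subset; auto)+

lemma tail_split: "0 \<le> t \<Longrightarrow> t \<le> s \<Longrightarrow> tail a t = integral {t..s} a + tail a s"
  unfolding tail_def by (rule half_line_split(2)) (auto intro: integrable_tail integrable_segment)

lemma tail_nonneg: "0 \<le> t \<Longrightarrow> 0 \<le> tail a t"
  unfolding tail_def
  by (rule integral_nonneg[OF integrable_tail]) (use pos in \<open>auto intro: less_imp_le order_trans\<close>)

lemma segment_nonneg: "0 \<le> t \<Longrightarrow> 0 \<le> integral {t..s} a"
  by (rule integral_nonneg[OF integrable_segment]) (use pos in \<open>auto intro: less_imp_le order_trans\<close>)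

lemma tail_antimono: "0 \<le> t \<Longrightarrow> t \<le> s \<Longrightarrow> tail a s \<le> tail a t"
  using tail_split segment_nonneg by (metis add_increasing order_refl)

text \<open>Dominated convergence along the integers, and monotonicity of the tail in between.\<close>

lemma tail_tendsto_0: "(tail a \<longlongrightarrow> 0) at_top"
proof -
  have "(\<lambda>k. integral {0..} (\<lambda>x. if x \<in> {real k..} then a x else 0)) \<longlonglongrightarrow> integral {0::real..} (\<lambda>x. 0::real)"
  proof (rule Equivalence_Lebesgue_Henstock_Integration.dominated_convergence(2)[where h = a])
    show "(\<lambda>x. if x \<in> {real k..} then a x else 0) integrable_on {0..}" for k
      using integrable_restrict_Int[of "{real k..}" a "{0::real..}"] integrable_tail[of "real k"]
      by (simp add: Int_absorb2)
    show "norm (if x \<in> {real k..} then a x else 0) \<le> a x" if "x \<in> {0..}" for k x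
      using pos[of x] that by auto
    show "(\<lambda>k. if x \<in> {real k..} then a x else 0) \<longlonglongrightarrow> 0" if "x \<in> {0..}" for x
    proof (rule tendsto_eventually)
      show "\<forall>\<^sub>F k in sequentially. (if x \<in> {real k..} then a x else 0) = 0"
        using eventually_gt_at_top[of "nat \<lceil>x\<rceil>"] by eventually_elim (use that in \<open>auto simp: nat_less_iff ceiling_less_iff\<close>)
    qed
  qed (rule integrable)
  moreover have "integral {0..} (\<lambda>x. if x \<in> {real k..} then a x else 0) = tail a (real k)" for k
    using Henstock_Kurzweil_Integration.integral_restrict_Int[of "{0::real..}" "{real k..}" a] by (simp add: tail_def Int_absorb2)
  ultimately have lim: "(\<lambda>k. tail a (real k)) \<longlonglongrightarrow> 0" by simp
  show ?thesis
  proof (rule tendstoI)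
    fix e :: real assume "e > 0"
    then obtain k where k: "tail a (real k) < e"
      using order_tendstoD(2)[OF lim] by (metis eventually_happens trivial_limit_sequentially)
    show "\<forall>\<^sub>F t in at_top. dist (tail a t) 0 < e"
      using eventually_ge_at_top[of "real k"]
    proof eventually_elim
      case (elim t)
      then show ?case
        using k tail_antimono[of "real k" t] tail_nonneg[of t] by (simp add: dist_norm)
    qed
  qed
qed

text \<open>A decreasing function is bounded by its integral over the preceding unit interval.\<close>

lemma tendsto_0: "(a \<longlongrightarrow> 0) at_top"
proof (rule tendsto_sandwich[OF _ _ tendsto_const])
  show "\<forall>\<^sub>F t in at_top. 0 \<le> a t"
    using eventually_ge_at_top[of 0] by eventually_elim (use pos in \<open>auto intro: less_imp_le\<close>)
  have "filterlim (\<lambda>t::real. t - 1) at_top at_top"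
    using filterlim_tendsto_add_at_top[OF tendsto_const filterlim_ident, of "-1 :: real"] by simp
  from filterlim_compose[OF tail_tendsto_0 this]
  show "((\<lambda>t. tail a (t - 1)) \<longlongrightarrow> 0) at_top" by simp
  show "\<forall>\<^sub>F t in at_top. a t \<le> tail a (t - 1)"
    using eventually_ge_at_top[of 1]
  proof eventually_elim
    case (elim t)
    have "a t = integral {t - 1..t} (\<lambda>_. a t)" by simp
    also have "\<dots> \<le> integral {t - 1..t} a"
      by (rule integral_le) (use elim mono integrable_segment in auto)
    also have "\<dots> \<le> tail a (t - 1)"
      using tail_split[of "t - 1" t] tail_nonneg[of t] elim by simp
    finally show ?case .
  qed
qed

lemma integral_bound:
  fixes g :: "real \<Rightarrow> 'd::euclidean_space"
  assumes "0 \<le> t" "continuous_on {t..} g" "\<And>x. t \<le> x \<Longrightarrow> norm (g x) \<le> c * a x"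
  shows "norm (integral {t..} g) \<le> c * tail a t"
  using integrable_on_half_line(2)[OF assms(2) integrable_on_mult_right[OF integrable_tail[OF assms(1)]] assms(3)]
  by (simp add: tail_def)

end

section \<open>Solving the equation of motion from infinity\<close>

lemma derivative_bound_along_segment:
  fixes F :: "'c::euclidean_space \<Rightarrow> 'd::euclidean_space" and P :: "'d \<Rightarrow> 'e::euclidean_space"
  assumes F: "holo_map sc sd U F" and U: "convex U" "z1 \<in> U" "z2 \<in> U" and P: "bounded_linear P"
    and B: "\<And>s. 0 \<le> s \<Longrightarrow> s \<le> 1 \<Longrightarrow> norm (P (fd F (z1 + s *\<^sub>R (z2 - z1)) (z2 - z1))) \<le> B"
  shows "norm (P (F z2) - P (F z1)) \<le> B"
proof -
  have inU: "z1 + s *\<^sub>R (z2 - z1) \<in> U" if "s \<in> {0..1}" for s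
    using convexD_alt[OF U, of s] that by (simp add: algebra_simps)
  have "norm ((\<lambda>s. P (F (z1 + s *\<^sub>R (z2 - z1)))) 1 - (\<lambda>s. P (F (z1 + s *\<^sub>R (z2 - z1)))) 0) \<le> B * norm (1 - 0 :: real)"
  proof (rule differentiable_bound[of "{0..1}" _ "\<lambda>s h. h *\<^sub>R P (fd F (z1 + s *\<^sub>R (z2 - z1)) (z2 - z1))"])
    fix s :: real assume s: "s \<in> {0..1}"
    have "((\<lambda>s. z1 + s *\<^sub>R (z2 - z1)) has_derivative (\<lambda>h. h *\<^sub>R (z2 - z1))) (at s within {0..1})"
      by (auto intro!: derivative_eq_intros)
    from bounded_linear.has_derivative[OF P has_derivative_compose[OF this holo_map_derivative(1)[OF F inU[OF s]]]]
    show "((\<lambda>s. P (F (z1 + s *\<^sub>R (z2 - z1)))) has_derivative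
        (\<lambda>h. h *\<^sub>R P (fd F (z1 + s *\<^sub>R (z2 - z1)) (z2 - z1)))) (at s within {0..1})"
      using bounded_linear.linear[OF P] bounded_linear.linear[OF fd_linear[OF F inU[OF s]]]
      by (simp add: linear_scale)
    show "onorm (\<lambda>h. h *\<^sub>R P (fd F (z1 + s *\<^sub>R (z2 - z1)) (z2 - z1))) \<le> B"
      by (rule onorm_le) (use B[of s] s in \<open>auto simp: mult.commute[of _ "norm (P _)"] intro: mult_right_mono\<close>)
  qed auto
  then show ?thesis by simp
qed

text \<open>The field \<open>Y\<close> is the deviation from the constant field \<open>(\<omega>, 0)\<close>, complexified; \<open>b\<close> and \<open>a\<close> measure the velocity and
  the force which it exerts on the zero section. The bounds on derivatives are those which the bounds on
  the values suggest. The initial time \<open>T\<close> is so late that the tails of \<open>a\<close> and \<open>b\<close> are small compared with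
  the constants: the first two conditions keep the trajectories in the domain, the last three make
  the nonlinear terms negligible.\<close>

locale asymptotic_system = A: decaying a + B: decaying b
  for a b :: "real \<Rightarrow> real" +
  fixes \<upsilon> \<Lambda> C \<rho> T :: real and \<omega> :: "real ^ 'n" and Y :: "real \<Rightarrow> 'n::finite cphase \<Rightarrow> 'n cphase"
  assumes \<upsilon>: "0 \<le> \<upsilon>" and \<Lambda>: "1 \<le> \<Lambda>" and C: "1 \<le> C" and \<rho>: "0 < \<rho>"
    and tail_a_le: "\<upsilon> \<le> t \<Longrightarrow> tail a t \<le> \<Lambda> * b t"
    and tail_a_b_le: "\<upsilon> \<le> t \<Longrightarrow> tail a t * b t \<le> \<Lambda> * a t * tail b t"
    and cont: "continuous_on ({0..} \<times> domain \<rho>) (\<lambda>(t, z). Y t z)"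
    and hol: "0 \<le> t \<Longrightarrow> holo_map scale_pair scale_pair (domain \<rho>) (Y t)"
    and fst_bound: "0 \<le> t \<Longrightarrow> z \<in> domain \<rho> \<Longrightarrow> norm (fst (Y t z)) \<le> C * (b t + norm (snd z))"
    and snd_bound: "0 \<le> t \<Longrightarrow> z \<in> domain \<rho> \<Longrightarrow>
      norm (snd (Y t z)) \<le> C * (a t + (b t + norm (snd z)) * norm (snd z))"
    and fd_fst_bound: "0 \<le> t \<Longrightarrow> z \<in> domain \<rho> \<Longrightarrow>
      norm (fst (fd (Y t) z w)) \<le> C * ((b t + norm (snd z)) * norm (fst w) + norm (snd w))"
    and fd_snd_bound: "0 \<le> t \<Longrightarrow> z \<in> domain \<rho> \<Longrightarrow>
      norm (snd (fd (Y t) z w)) \<le> C * ((a t + (b t + norm (snd z)) * norm (snd z)) * norm (fst w)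
        + (b t + norm (snd z)) * norm (snd w))"
    and periodic: "0 \<le> t \<Longrightarrow> z \<in> domain \<rho> \<Longrightarrow> k \<in> int_lattice \<Longrightarrow> Y t (z + (cvec k, 0)) = Y t z"
    and real: "0 \<le> t \<Longrightarrow> norm (snd x) < \<rho> \<Longrightarrow> Y t (cpair x) \<in> range cpair"
    and T: "\<upsilon> \<le> T"
    and small_a: "2 * C * tail a T \<le> \<rho> / 2"
    and small_b: "C * (1 + 2 * C * \<Lambda>) * tail b T \<le> \<rho> / 8"
      "2 * C * (1 + 2 * C * \<Lambda>) * \<Lambda> * tail b T \<le> 1"
      "C * (1 + 2 * C * \<Lambda>) * tail b T \<le> 1 / 4"
      "(8 * C\<^sup>2 * \<Lambda> + C * (1 + 2 * C * \<Lambda>) * \<Lambda>) * tail b T \<le> 1 / 2"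
begin

text \<open>Displacements will be bounded by \<open>L\<close> and \<open>2 C\<close> times the tails of \<open>b\<close> and \<open>a\<close>; \<open>J\<close> is the relative weight of the
  two components. The strip \<open>S\<close> of phases has half the available width, which leaves the other half for the
  imaginary part of the displacement.\<close>

abbreviation "L \<equiv> C * (1 + 2 * C * \<Lambda>)"
abbreviation "J \<equiv> 4 * C * \<Lambda>"
abbreviation "S \<equiv> open_strip (\<rho> / 2) :: (complex ^ 'n) set"

lemma T_nonneg: "0 \<le> T" using \<upsilon> T by simp
lemma constants: "0 < C" "0 < \<Lambda>" "0 < L" "1 \<le> J"
proof -
  show "0 < C" "0 < \<Lambda>" using C \<Lambda> by auto
  then show "0 < L" by (simp add: add_pos_pos)
  have "1 * 1 \<le> C * \<Lambda>" using C \<Lambda> by (intro mult_mono) auto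
  then show "1 \<le> J" by simp
qed

definition base :: "real \<Rightarrow> complex ^ 'n \<Rightarrow> 'n cphase" where
  "base t q = (q + t *\<^sub>R cvec \<omega>, 0)"

text \<open>The displacements \<open>w\<close> from the unperturbed motion among which the solution is sought.\<close>

definition tube :: "real \<Rightarrow> 'n cphase set" where
  "tube t = {w. norm (fst w) \<le> L * tail b t \<and> norm (snd w) \<le> 2 * C * tail a t}"

lemma time_bounds:
  assumes t: "T \<le> t"
  shows "0 \<le> t" "0 < a t" "0 < b t" "0 \<le> tail a t" "0 \<le> tail b t" "tail a t \<le> tail a T" "tail b t \<le> tail b T"
    and "tail a t \<le> \<Lambda> * b t" "tail a t * b t \<le> \<Lambda> * a t * tail b t"
proof -
  show "0 \<le> t" using T_nonneg t by simp
  then show "0 < a t" "0 < b t" "0 \<le> tail a t" "0 \<le> tail b t" 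
    using A.pos B.pos A.tail_nonneg B.tail_nonneg by auto
  show "tail a t \<le> tail a T" "tail b t \<le> tail b T"
    using A.tail_antimono[OF T_nonneg t] B.tail_antimono[OF T_nonneg t] by auto
  show "tail a t \<le> \<Lambda> * b t" "tail a t * b t \<le> \<Lambda> * a t * tail b t"
    using tail_a_le tail_a_b_le T t by auto
qed

text \<open>This is where the two relations between \<open>a\<close> and \<open>b\<close> enter: the first one bounds the momentum by a
  multiple of \<open>b\<close>, and then the second one bounds by \<open>a\<close> the part of the force that depends on the momentum.\<close>

lemma tube_bounds:
  assumes t: "T \<le> t" and w: "w \<in> tube t"
  shows "b t + norm (snd w) \<le> (1 + 2 * C * \<Lambda>) * b t"
    and "(b t + norm (snd w)) * norm (snd w) \<le> a t"
proof -
  note tb = time_bounds[OF t]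
  have w2: "norm (snd w) \<le> 2 * C * tail a t" using w by (simp add: tube_def)
  also have "\<dots> \<le> 2 * C * (\<Lambda> * b t)" using tb(8) constants(1) by (intro mult_left_mono) auto
  finally show 1: "b t + norm (snd w) \<le> (1 + 2 * C * \<Lambda>) * b t" by (simp add: algebra_simps)
  have "(b t + norm (snd w)) * norm (snd w) \<le> ((1 + 2 * C * \<Lambda>) * b t) * (2 * C * tail a t)"
    by (rule mult_mono[OF 1 w2]) (use tb constants in auto)
  also have "\<dots> = 2 * C * (1 + 2 * C * \<Lambda>) * (tail a t * b t)" by simp
  also have "\<dots> \<le> 2 * C * (1 + 2 * C * \<Lambda>) * (\<Lambda> * a t * tail b t)"
    using tb(9) constants by (intro mult_left_mono) auto
  also have "\<dots> \<le> 2 * C * (1 + 2 * C * \<Lambda>) * (\<Lambda> * a t * tail b T)"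
    using tb constants by (intro mult_left_mono) auto
  also have "\<dots> = (2 * C * (1 + 2 * C * \<Lambda>) * \<Lambda> * tail b T) * a t" by simp
  also have "\<dots> \<le> 1 * a t"
    using small_b(2) tb by (intro mult_right_mono) auto
  finally show "(b t + norm (snd w)) * norm (snd w) \<le> a t" by simp
qed

lemma tube_in_domain:
  assumes t: "T \<le> t" and q: "q \<in> S" and w: "w \<in> tube t"
  shows "base t q + w \<in> domain \<rho>"
proof -
  note tb = time_bounds[OF t]
  have "norm (fst w) \<le> L * tail b T"
    using w tb constants unfolding tube_def by (smt (verit) mem_Collect_eq mult_left_mono)
  then have 1: "norm (im_vec (fst w)) \<le> \<rho> / 8" using small_b(1) norm_im_vec_le[of "fst w"] by linarith
  have "2 * C * tail a t \<le> 2 * C * tail a T"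
    using tb(6) constants by (intro mult_left_mono) auto
  then have "norm (snd w) \<le> 2 * C * tail a T"
    using w by (auto simp: tube_def)
  then have 2: "norm (snd w) \<le> \<rho> / 2" using small_a by linarith
  have "norm (im_vec (q + t *\<^sub>R cvec \<omega> + fst w)) = norm (im_vec q + im_vec (fst w))"
    by (simp add: im_vec_add im_vec_scaleR)
  also have "\<dots> < \<rho>"
    using q 1 \<rho> norm_triangle_ineq[of "im_vec q" "im_vec (fst w)"] by (simp add: open_strip_def)
  finally show ?thesis using 2 \<rho> by (simp add: domain_def base_def mem_Times_iff open_strip_def)
qed

lemma snd_base [simp]: "snd (base t q) = 0" by (simp add: base_def)

lemma snd_base_add: "snd (base t q + w) = snd w" by simp

lemma field_bound:
  assumes t: "T \<le> t" and q: "q \<in> S" and w: "w \<in> tube t"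
  shows "norm (fst (Y t (base t q + w))) \<le> L * b t" "norm (snd (Y t (base t q + w))) \<le> 2 * C * a t"
proof -
  note tb = time_bounds[OF t] and tu = tube_bounds[OF t w]
  have "norm (fst (Y t (base t q + w))) \<le> C * (b t + norm (snd w))"
    using fst_bound[OF tb(1) tube_in_domain[OF assms]] by simp
  also have "\<dots> \<le> C * ((1 + 2 * C * \<Lambda>) * b t)"
    using tu constants by (intro mult_left_mono) auto
  finally show "norm (fst (Y t (base t q + w))) \<le> L * b t" by (simp add: mult.assoc)
  have "norm (snd (Y t (base t q + w))) \<le> C * (a t + (b t + norm (snd w)) * norm (snd w))"
    using snd_bound[OF tb(1) tube_in_domain[OF assms]] by simp
  also have "\<dots> \<le> C * (a t + a t)"
    using tu constants by (intro mult_left_mono) auto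
  finally show "norm (snd (Y t (base t q + w))) \<le> 2 * C * a t" by simp
qed

text \<open>The contraction estimate. The weight \<open>J\<close> between the two components absorbs the coefficient
  \<open>C \<Lambda>\<close> of the momentum in the equation for the position, which is not small.\<close>

lemma field_contraction:
  assumes t: "T \<le> t" and q: "q \<in> S" and w: "w1 \<in> tube t" "w2 \<in> tube t" and n: "0 \<le> n"
    and d: "norm (fst (w2 - w1)) \<le> J * n * tail b t" "norm (snd (w2 - w1)) \<le> n * tail a t"
  shows "norm (fst (Y t (base t q + w2)) - fst (Y t (base t q + w1))) \<le> (J * (n / 2)) * b t"
    and "norm (snd (Y t (base t q + w2)) - snd (Y t (base t q + w1))) \<le> (n / 2) * a t"
proof -
  note tb = time_bounds[OF t]
  let ?z = "\<lambda>s. (base t q + w1) + s *\<^sub>R ((base t q + w2) - (base t q + w1))"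
  have tube_s: "w1 + s *\<^sub>R (w2 - w1) \<in> tube t" if s: "0 \<le> s" "s \<le> 1" for s
  proof -
    have "convex (tube t)"
    proof -
      have "tube t = cball 0 (L * tail b t) \<times> cball 0 (2 * C * tail a t)"
        by (auto simp: tube_def)
      then show ?thesis by (simp add: convex_Times)
    qed
    then show ?thesis using convexD_alt[of "tube t" w1 w2 s] w s by (simp add: algebra_simps)
  qed
  have zs: "?z s = base t q + (w1 + s *\<^sub>R (w2 - w1))" for s by simp
  have dom: "?z s \<in> domain \<rho>" if "0 \<le> s" "s \<le> 1" for s
    unfolding zs by (rule tube_in_domain[OF t q tube_s[OF that]])
  note seg = derivative_bound_along_segment[OF hol[OF tb(1)] convex_domain tube_in_domain[OF t q w(1)] tube_in_domain[OF t q w(2)]]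
  show "norm (fst (Y t (base t q + w2)) - fst (Y t (base t q + w1))) \<le> (J * (n / 2)) * b t"
  proof (rule seg[OF bounded_linear_fst])
    fix s :: real assume s: "0 \<le> s" "s \<le> 1"
    note tu = tube_bounds[OF t tube_s[OF s]]
    have "norm (fst (fd (Y t) (?z s) (w2 - w1)))
      \<le> C * ((b t + norm (snd (?z s))) * norm (fst (w2 - w1)) + norm (snd (w2 - w1)))"
      by (rule fd_fst_bound[OF tb(1) dom[OF s]])
    also have "\<dots> \<le> C * (((1 + 2 * C * \<Lambda>) * b t) * (J * n * tail b T) + n * (\<Lambda> * b t))"
    proof (intro mult_left_mono add_mono mult_mono)
      show "b t + norm (snd (?z s)) \<le> (1 + 2 * C * \<Lambda>) * b t"
        unfolding zs using tu(1) by simp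
      have "J * n * tail b t \<le> J * n * tail b T" 
        using tb(7) n constants by (intro mult_left_mono) auto
      then show "norm (fst (w2 - w1)) \<le> J * n * tail b T" using d(1) by linarith
      have "n * tail a t \<le> n * (\<Lambda> * b t)" using tb(8) n by (intro mult_left_mono) auto
      then show "norm (snd (w2 - w1)) \<le> n * (\<Lambda> * b t)" using d(2) by linarith
    qed (use tb constants in auto)
    also have "\<dots> = (L * tail b T) * (J * n * b t) + (J / 4) * (n * b t)"
      by (simp add: algebra_simps)
    also have "\<dots> \<le> (1 / 4) * (J * n * b t) + (J / 4) * (n * b t)"
      using small_b(3) tb n constants by (intro add_mono mult_right_mono) auto
    also have "\<dots> = (J * (n / 2)) * b t" by simp
    finally show "norm (fst (fd (Y t) (?z s) ((base t q + w2) - (base t q + w1)))) \<le> (J * (n / 2)) * b t"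
      by simp
  qed
  show "norm (snd (Y t (base t q + w2)) - snd (Y t (base t q + w1))) \<le> (n / 2) * a t"
  proof (rule seg[OF bounded_linear_snd])
    fix s :: real assume s: "0 \<le> s" "s \<le> 1"
    note tu = tube_bounds[OF t tube_s[OF s]]
    have "norm (snd (fd (Y t) (?z s) (w2 - w1)))
      \<le> C * ((a t + (b t + norm (snd (?z s))) * norm (snd (?z s))) * norm (fst (w2 - w1))
          + (b t + norm (snd (?z s))) * norm (snd (w2 - w1)))"
      by (rule fd_snd_bound[OF tb(1) dom[OF s]])
    also have "\<dots> \<le> C * ((a t + a t) * (J * n * tail b t) + ((1 + 2 * C * \<Lambda>) * b t) * (n * tail a t))"
      unfolding zs snd_base_add using tu d tb n constants
      by (intro mult_left_mono add_mono mult_mono) (auto intro!: add_nonneg_nonneg mult_nonneg_nonneg)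
    also have "\<dots> = 8 * C\<^sup>2 * \<Lambda> * (a t * n * tail b t) + L * n * (tail a t * b t)"
      by (simp add: algebra_simps power2_eq_square)
    also have "\<dots> \<le> 8 * C\<^sup>2 * \<Lambda> * (a t * n * tail b t) + L * n * (\<Lambda> * a t * tail b t)"
      using tb n constants by (intro add_mono[OF order_refl] mult_left_mono) auto
    also have "\<dots> = (8 * C\<^sup>2 * \<Lambda> + L * \<Lambda>) * tail b t * (n * a t)"
      by (simp add: algebra_simps)
    also have "\<dots> \<le> (8 * C\<^sup>2 * \<Lambda> + L * \<Lambda>) * tail b T * (n * a t)"
      using tb n constants by (intro mult_right_mono mult_left_mono) auto
    also have "\<dots> \<le> (1 / 2) * (n * a t)"
      using small_b(4) tb n by (intro mult_right_mono) auto
    finally show "norm (snd (fd (Y t) (?z s) ((base t q + w2) - (base t q + w1)))) \<le> (n / 2) * a t"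
      by simp
  qed
qed

end

context asymptotic_system
begin

definition admissible :: "(real \<Rightarrow> complex ^ 'n \<Rightarrow> 'n cphase) \<Rightarrow> bool" where
  "admissible W \<longleftrightarrow>
     continuous_on ({T..} \<times> S) (\<lambda>(t, q). W t q) \<and>
     (\<forall>t\<ge>T. holo_map scale_vec scale_pair S (W t) \<and>
        (\<forall>q\<in>S. W t q \<in> tube t \<and> (\<forall>k\<in>int_lattice. W t (q + cvec k) = W t q)) \<and>
        (\<forall>x. W t (cvec x) \<in> range cpair))"

definition field :: "(real \<Rightarrow> complex ^ 'n \<Rightarrow> 'n cphase) \<Rightarrow> real \<Rightarrow> complex ^ 'n \<Rightarrow> 'n cphase" where
  "field W t q = Y t (base t q + W t q)"

text \<open>Fixed points are the displacements \<open>W\<close> for which \<open>base t q + W t q\<close> is a trajectory asymptotic to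
  \<open>base t q\<close>, since the integral is over all later times.\<close>

definition picard :: "(real \<Rightarrow> complex ^ 'n \<Rightarrow> 'n cphase) \<Rightarrow> real \<Rightarrow> complex ^ 'n \<Rightarrow> 'n cphase" where
  "picard W t q = - integral {t..} (\<lambda>\<tau>. field W \<tau> q)"

definition majorant :: "real \<Rightarrow> real" where
  "majorant t = L * b t + 2 * C * a t"

lemma admissibleD:
  assumes "admissible W"
  shows "continuous_on ({T..} \<times> S) (\<lambda>(t, q). W t q)"
    and "T \<le> t \<Longrightarrow> holo_map scale_vec scale_pair S (W t)"
    and "T \<le> t \<Longrightarrow> q \<in> S \<Longrightarrow> W t q \<in> tube t"
    and "T \<le> t \<Longrightarrow> q \<in> S \<Longrightarrow> k \<in> int_lattice \<Longrightarrow> W t (q + cvec k) = W t q"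
    and "T \<le> t \<Longrightarrow> W t (cvec x) \<in> range cpair"
  using assms unfolding admissible_def by auto

lemma norm_pair_le: "norm z \<le> norm (fst z) + norm (snd z)"
  using norm_Pair_le[of "fst z" "snd z"] by simp

lemma holo_map_base: "holo_map scale_vec scale_pair U (base t)"
  unfolding base_def
  by (intro holo_map_Pair VV.holo_map_add VV.holo_map_const holo_map_bounded_linear bounded_linear_ident) simp_all

lemma fd_base: "fd (base t) q v = (v, 0)"
proof -
  have "(base t has_derivative (\<lambda>v. (v, 0))) (at q)"
    unfolding base_def by (auto intro!: derivative_eq_intros)
  then show ?thesis using fd_eq by metis
qed

lemma continuous_field:
  assumes W: "admissible W"
  shows "continuous_on ({T..} \<times> S) (\<lambda>(t, q). field W t q)"
proof -
  have "continuous_on ({T..} \<times> S) (\<lambda>x. case (\<lambda>(t, q). (t, base t q + W t q)) x of (t, z) \<Rightarrow> Y t z)"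
  proof (rule continuous_on_compose2[OF cont])
    show "continuous_on ({T..} \<times> S) (\<lambda>(t, q). (t, base t q + W t q))"
      using admissibleD(1)[OF W] unfolding split_beta base_def by (intro continuous_intros)
    show "(\<lambda>(t, q). (t, base t q + W t q)) ` ({T..} \<times> S) \<subseteq> {0..} \<times> domain \<rho>"
      unfolding image_subset_iff using T_nonneg by (auto intro!: tube_in_domain admissibleD(3)[OF W])
  qed
  then show ?thesis by (simp add: field_def split_beta)
qed

lemma holo_map_orbit:
  assumes W: "admissible W" and t: "T \<le> t"
  shows "holo_map scale_vec scale_pair S (\<lambda>q. base t q + W t q)"
  by (rule VP.holo_map_add[OF holo_map_base admissibleD(2)[OF W t]])

lemma holo_map_field:
  assumes W: "admissible W" and t: "T \<le> t"
  shows "holo_map scale_vec scale_pair S (field W t)"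
  unfolding field_def[abs_def]
  by (rule holo_map_compose[OF holo_map_orbit[OF W t] hol])
    (use tube_in_domain[OF t] admissibleD(3)[OF W t] T_nonneg t in auto)

lemma fd_field:
  assumes W: "admissible W" and t: "T \<le> t" and q: "q \<in> S"
  shows "fd (field W t) q v = fd (Y t) (base t q + W t q) ((v, 0) + fd (W t) q v)"
proof -
  have "fd (field W t) q v = fd (Y t) (base t q + W t q) (fd (\<lambda>q. base t q + W t q) q v)"
    unfolding field_def[abs_def]
    by (rule fd_compose[OF holo_map_orbit[OF W t] hol q tube_in_domain[OF t q admissibleD(3)[OF W t q]]])
      (use T_nonneg t in auto)
  then show ?thesis
    by (simp add: VP.fd_add[OF holo_map_base admissibleD(2)[OF W t] q] fd_base)
qed

lemma norm_field:
  assumes W: "admissible W" and t: "T \<le> t" and q: "q \<in> S"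
  shows "norm (fst (field W t q)) \<le> L * b t" "norm (snd (field W t q)) \<le> 2 * C * a t"
    and "norm (field W t q) \<le> majorant t"
proof -
  show *: "norm (fst (field W t q)) \<le> L * b t" "norm (snd (field W t q)) \<le> 2 * C * a t"
    using field_bound[OF t q admissibleD(3)[OF W t q]] by (auto simp: field_def)
  show "norm (field W t q) \<le> majorant t"
    using norm_pair_le[of "field W t q"] * by (simp add: majorant_def)
qed

lemma majorant:
  assumes "T \<le> t"
  shows "majorant integrable_on {t..}" "0 \<le> majorant t" "majorant t \<le> majorant T"
proof -
  have t: "0 \<le> t" using assms T_nonneg by simp
  show "majorant integrable_on {t..}"
    unfolding majorant_def[abs_def]
    by (intro integrable_add integrable_on_mult_right A.integrable_tail B.integrable_tail t)
  show "0 \<le> majorant t"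
    using A.pos[OF t] B.pos[OF t] constants by (simp add: majorant_def)
  show "majorant t \<le> majorant T"
    unfolding majorant_def using A.mono[OF T_nonneg assms] B.mono[OF T_nonneg assms] constants
    by (intro add_mono mult_left_mono) auto
qed

lemma continuous_time_slice:
  assumes "continuous_on ({T..} \<times> S) (\<lambda>(t, q). F t q)" "q \<in> S" "T \<le> t"
  shows "continuous_on {t..} (\<lambda>\<tau>. F \<tau> q)"
proof -
  have "continuous_on {t..} (\<lambda>\<tau>. case (\<tau>, q) of (t, q) \<Rightarrow> F t q)"
    by (rule continuous_on_compose2[OF assms(1)]) (use assms in \<open>auto intro!: continuous_intros\<close>)
  then show ?thesis by simp
qed

lemma field_integrable:
  assumes W: "admissible W" and t: "T \<le> t" and q: "q \<in> S"
  shows "(\<lambda>\<tau>. field W \<tau> q) integrable_on {t..}"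
  by (rule integrable_on_half_line(1)[OF continuous_time_slice[OF continuous_field[OF W] q t] majorant(1)[OF t]])
    (use norm_field(3)[OF W _ q] t in auto)

lemma continuous_fd_field:
  assumes W: "admissible W"
  shows "continuous_on ({T..} \<times> S) (\<lambda>(t, q). fd (field W t) q v)"
  by (rule VP.continuous_fd[OF continuous_field[OF W] open_open_strip]) (use holo_map_field[OF W] in auto)

lemma fd_field_integrable:
  assumes W: "admissible W" and t: "T \<le> t" and q: "q \<in> S"
  shows "(\<lambda>\<tau>. fd (field W \<tau>) q v) integrable_on {t..}"
proof -
  obtain r where r: "0 < r" "cball q (2 * r) \<subseteq> S"
    using VP.open_double_ball[OF open_open_strip q] by blast
  have sub: "cball q r \<subseteq> S" using r by auto
  show ?thesis
  proof (rule integrable_on_half_line(1)[OF continuous_time_slice[OF continuous_fd_field[OF W] q t]])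
    show "(\<lambda>\<tau>. norm v / r * majorant \<tau>) integrable_on {t..}"
      by (rule integrable_on_mult_right[OF majorant(1)[OF t]])
    show "norm (fd (field W \<tau>) q v) \<le> norm v / r * majorant \<tau>" if "t \<le> \<tau>" for \<tau>
    proof -
      have \<tau>: "T \<le> \<tau>" using that t by simp
      have "norm (fd (field W \<tau>) q v) \<le> majorant \<tau> / r * norm v"
        by (rule VP.Cauchy_estimate[OF holo_map_field[OF W \<tau>] r(1) sub])
          (use norm_field(3)[OF W \<tau>] sub in blast)
      then show ?thesis by (simp add: mult.commute)
    qed
  qed
qed

lemma holo_map_picard:
  assumes W: "admissible W" and t: "T \<le> t"
  shows "holo_map scale_vec scale_pair S (picard W t)"
    and "q \<in> S \<Longrightarrow> fd (picard W t) q v = - integral {t..} (\<lambda>\<tau>. fd (field W \<tau>) q v)"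
proof -
  have h: "\<tau> \<in> {t..} \<Longrightarrow> holo_map scale_vec scale_pair S (field W \<tau>)" for \<tau>
    using holo_map_field[OF W] t by auto
  have n: "\<tau> \<in> {t..} \<Longrightarrow> z \<in> S \<Longrightarrow> norm (field W \<tau> z) \<le> majorant \<tau>" for \<tau> z
    using norm_field(3)[OF W] t by auto
  have I: "holo_map scale_vec scale_pair S (\<lambda>z. integral {t..} (\<lambda>\<tau>. field W \<tau> z))"
    "\<And>q v. q \<in> S \<Longrightarrow>
      fd (\<lambda>z. integral {t..} (\<lambda>\<tau>. field W \<tau> z)) q v = integral {t..} (\<lambda>\<tau>. fd (field W \<tau>) q v)"
    using VP.holo_map_integral[of S "{t..}" "field W" majorant, OF open_open_strip]
      h n field_integrable[OF W t] fd_field_integrable[OF W t] majorant(1)[OF t] by blast+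
  show "holo_map scale_vec scale_pair S (picard W t)"
    unfolding picard_def[abs_def] by (rule VP.holo_map_minus, rule I(1))
  show "q \<in> S \<Longrightarrow> fd (picard W t) q v = - integral {t..} (\<lambda>\<tau>. fd (field W \<tau>) q v)"
    unfolding picard_def[abs_def]
    using VP.fd_scaleR[OF I(1), where z = q and r = "-1" and v = v] I(2)[where q = q and v = v] by simp
qed

text \<open>The Lipschitz constant in time is uniform in \<open>q\<close>; with continuity in \<open>q\<close> this gives joint continuity.\<close>

lemma picard_Lipschitz:
  assumes W: "admissible W" and q: "q \<in> S" and t: "T \<le> t" "T \<le> s"
  shows "norm (picard W t q - picard W s q) \<le> majorant T * \<bar>t - s\<bar>"
proof -
  have *: "norm (picard W t q - picard W s q) \<le> majorant T * (s - t)" if t: "T \<le> t" "t \<le> s" for t s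
  proof -
    have c: "continuous_on {t..s} (\<lambda>\<tau>. field W \<tau> q)"
      using continuous_on_subset[OF continuous_time_slice[OF continuous_field[OF W] q t(1)]] by auto
    have "norm (integral {t..s} (\<lambda>\<tau>. field W \<tau> q)) \<le> majorant T * (s - t)"
    proof (rule integral_bound[OF t(2) c])
      fix \<tau> assume "\<tau> \<in> {t..s}"
      then have "T \<le> \<tau>" using t by simp
      then show "norm (field W \<tau> q) \<le> majorant T"
        using norm_field(3)[OF W _ q, of \<tau>] majorant(3)[of \<tau>] by linarith
    qed
    moreover have "integral {t..} (\<lambda>\<tau>. field W \<tau> q) = integral {t..s} (\<lambda>\<tau>. field W \<tau> q) + integral {s..} (\<lambda>\<tau>. field W \<tau> q)"
      by (rule half_line_split(2)[OF t(2) integrable_continuous_real[OF c] field_integrable[OF W _ q]]) (use t in auto)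
    ultimately show ?thesis by (simp add: picard_def)
  qed
  show ?thesis
  proof (cases "t \<le> s")
    case True
    then show ?thesis using *[of t s] t by simp
  next
    case False
    then show ?thesis using *[of s t] t by (simp add: norm_minus_commute)
  qed
qed

lemma continuous_picard:
  assumes W: "admissible W"
  shows "continuous_on ({T..} \<times> S) (\<lambda>(t, q). picard W t q)"
  unfolding continuous_on_def
proof
  fix x assume "x \<in> {T..} \<times> S"
  then obtain t q where x: "x = (t, q)" and t: "t \<in> {T..}" and q: "q \<in> S" by auto
  have 1: "((\<lambda>x. picard W t (snd x)) \<longlongrightarrow> picard W t q) (at (t, q) within {T..} \<times> S)"
  proof -
    have "continuous_on ({T..} \<times> S) (\<lambda>x. picard W t (snd x))"
      by (rule continuous_on_compose2[OF holo_map_continuous[OF holo_map_picard(1)[OF W]] continuous_on_snd[OF continuous_on_id]])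
        (use t in auto)
    then show ?thesis using t q unfolding continuous_on_def by force
  qed
  have "((\<lambda>x. fst x) \<longlongrightarrow> t) (at (t, q) within {T..} \<times> S)"
    using tendsto_fst[OF tendsto_ident_at, of "(t, q)"] by simp
  then have 2: "((\<lambda>x. majorant T * \<bar>fst x - t\<bar>) \<longlongrightarrow> 0) (at (t, q) within {T..} \<times> S)"
    by (auto intro!: tendsto_eq_intros)
  have "((\<lambda>x. picard W (fst x) (snd x) - picard W t (snd x)) \<longlongrightarrow> 0) (at (t, q) within {T..} \<times> S)"
    by (rule Lim_null_comparison[OF _ 2])
      (use picard_Lipschitz[OF W] t in \<open>auto simp: eventually_at_filter intro!: always_eventually\<close>)
  from tendsto_add[OF this 1]
  show "((\<lambda>(t, q). picard W t q) \<longlongrightarrow> (case x of (t, q) \<Rightarrow> picard W t q)) (at x within {T..} \<times> S)"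
    by (simp add: case_prod_unfold x)
qed

lemma fst_snd_picard:
  assumes W: "admissible W" and t: "T \<le> t" and q: "q \<in> S"
  shows "fst (picard W t q) = - integral {t..} (\<lambda>\<tau>. fst (field W \<tau> q))"
    and "snd (picard W t q) = - integral {t..} (\<lambda>\<tau>. snd (field W \<tau> q))"
  using integral_linear[OF field_integrable[OF assms] bounded_linear_fst]
    integral_linear[OF field_integrable[OF assms] bounded_linear_snd]
  by (simp_all add: picard_def o_def)

lemma range_cpair_iff: "z \<in> range cpair \<longleftrightarrow> im_vec (fst z) = 0 \<and> im_vec (snd z) = 0"
proof
  assume "im_vec (fst z) = 0 \<and> im_vec (snd z) = 0"
  then have "fst z = cvec (re_vec (fst z))" "snd z = cvec (re_vec (snd z))"
    using im_vec_eq_0 by blast+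
  then have "z = cpair (re_vec (fst z), re_vec (snd z))"
    by (metis cpair_simps(1) prod.collapse)
  then show "z \<in> range cpair" by blast
qed auto

lemma base_cvec: "base t (cvec x) = cpair (x + t *\<^sub>R \<omega>, 0)"
  by (simp add: base_def cvec_add cvec_scaleR)

lemma field_periodic:
  assumes W: "admissible W" and t: "T \<le> t" and q: "q \<in> S" and k: "k \<in> int_lattice"
  shows "field W t (q + cvec k) = field W t q"
proof -
  have "base t (q + cvec k) + W t (q + cvec k) = (base t q + W t q) + (cvec k, 0)"
    using admissibleD(4)[OF W t q k] by (simp add: base_def prod_eq_iff)
  then show ?thesis
    using periodic[OF _ tube_in_domain[OF t q admissibleD(3)[OF W t q]] k] T_nonneg t by (simp add: field_def)
qed

lemma field_real:
  assumes W: "admissible W" and t: "T \<le> t"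
  shows "field W t (cvec x) \<in> range cpair"
proof -
  have xS: "cvec x \<in> S" using \<rho> by simp
  obtain y where y: "W t (cvec x) = cpair y" using admissibleD(5)[OF W t] by blast
  have "base t (cvec x) + W t (cvec x) = cpair ((x + t *\<^sub>R \<omega>, 0) + y)"
    by (simp only: cpair_add y base_cvec)
  moreover have "norm (snd ((x + t *\<^sub>R \<omega>, 0) + y)) < \<rho>"
    using tube_in_domain[OF t xS admissibleD(3)[OF W t xS]]
    unfolding calculation by (auto simp: domain_def mem_Times_iff simp del: cpair_simps(1))
  ultimately show ?thesis
    using real[of t "(x + t *\<^sub>R \<omega>, 0) + y"] T_nonneg t by (simp add: field_def)
qed

lemma admissible_picard:
  assumes W: "admissible W"
  shows "admissible (picard W)"
  unfolding admissible_def
proof (intro conjI allI impI ballI)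
  show "continuous_on ({T..} \<times> S) (\<lambda>(t, q). picard W t q)" by (rule continuous_picard[OF W])
  fix t assume t: "T \<le> t"
  show "holo_map scale_vec scale_pair S (picard W t)" by (rule holo_map_picard(1)[OF W t])
  have t0: "0 \<le> t" using t T_nonneg by simp
  { fix q assume q: "q \<in> S"
    have f: "continuous_on {t..} (\<lambda>\<tau>. field W \<tau> q)"
      by (rule continuous_time_slice[OF continuous_field[OF W] q t])
    have "norm (fst (picard W t q)) \<le> L * tail b t"
      unfolding fst_snd_picard[OF W t q] norm_minus_cancel
      by (rule B.integral_bound[OF t0]) (use norm_field[OF W _ q] t in \<open>auto intro!: continuous_intros f\<close>)
    moreover have "norm (snd (picard W t q)) \<le> 2 * C * tail a t"
      unfolding fst_snd_picard[OF W t q] norm_minus_cancel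
      by (rule A.integral_bound[OF t0]) (use norm_field[OF W _ q] t in \<open>auto intro!: continuous_intros f\<close>)
    ultimately show "picard W t q \<in> tube t" by (simp add: tube_def)
    fix k :: "real ^ 'n" assume k: "k \<in> int_lattice"
    have "integral {t..} (\<lambda>\<tau>. field W \<tau> (q + cvec k)) = integral {t..} (\<lambda>\<tau>. field W \<tau> q)"
      by (rule integral_cong) (use field_periodic[OF W _ q k] t in auto)
    then show "picard W t (q + cvec k) = picard W t q" by (simp add: picard_def)
  }
  fix x :: "real ^ 'n"
  have xS: "cvec x \<in> S" using \<rho> by simp
  note fi = field_integrable[OF W t xS]
  have "L (picard W t (cvec x)) = 0"
    if L: "bounded_linear L" "\<And>z. z \<in> range cpair \<Longrightarrow> L z = 0" for L :: "'n cphase \<Rightarrow> real ^ 'n"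
  proof -
    have "L (integral {t..} (\<lambda>\<tau>. field W \<tau> (cvec x))) = integral {t..} (\<lambda>\<tau>. L (field W \<tau> (cvec x)))"
      using integral_linear[OF fi L(1)] by (simp add: o_def)
    also have "\<dots> = integral {t..} (\<lambda>_. 0)"
      by (rule integral_cong) (use field_real[OF W] t L(2) in auto)
    finally show ?thesis
      using bounded_linear.linear[OF L(1)] by (simp add: picard_def linear_neg)
  qed
  from this[OF bounded_linear_compose[OF bounded_linear_im_vec bounded_linear_fst]]
    this[OF bounded_linear_compose[OF bounded_linear_im_vec bounded_linear_snd]]
  show "picard W t (cvec x) \<in> range cpair"
    by (simp add: range_cpair_iff)
qed

end

context asymptotic_system
begin

text \<open>The weighted distance in which the iteration contracts.\<close>

definition close :: "real \<Rightarrow> real \<Rightarrow> 'n cphase \<Rightarrow> bool" where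
  "close n t w \<longleftrightarrow> norm (fst w) \<le> J * n * tail b t \<and> norm (snd w) \<le> n * tail a t"

lemma picard_contraction:
  assumes W: "admissible W1" "admissible W2" and n: "0 \<le> n"
    and cl: "\<And>t q. T \<le> t \<Longrightarrow> q \<in> S \<Longrightarrow> close n t (W2 t q - W1 t q)"
    and t: "T \<le> t" and q: "q \<in> S"
  shows "close (n / 2) t (picard W2 t q - picard W1 t q)"
proof -
  note tb = time_bounds[OF t]
  have c: "norm (fst (field W2 \<tau> q) - fst (field W1 \<tau> q)) \<le> (J * (n / 2)) * b \<tau>"
    "norm (snd (field W2 \<tau> q) - snd (field W1 \<tau> q)) \<le> (n / 2) * a \<tau>" if "t \<le> \<tau>" for \<tau>
  proof -
    have \<tau>: "T \<le> \<tau>" using t that by simp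
    have "norm (fst (W2 \<tau> q - W1 \<tau> q)) \<le> J * n * tail b \<tau>" "norm (snd (W2 \<tau> q - W1 \<tau> q)) \<le> n * tail a \<tau>"
      using cl[OF \<tau> q] by (auto simp: close_def)
    from field_contraction[OF \<tau> q admissibleD(3)[OF W(1) \<tau> q] admissibleD(3)[OF W(2) \<tau> q] n this]
    show "norm (fst (field W2 \<tau> q) - fst (field W1 \<tau> q)) \<le> (J * (n / 2)) * b \<tau>"
      "norm (snd (field W2 \<tau> q) - snd (field W1 \<tau> q)) \<le> (n / 2) * a \<tau>"
      by (simp_all add: field_def)
  qed
  note f = continuous_time_slice[OF continuous_field[OF W(1)] q t] continuous_time_slice[OF continuous_field[OF W(2)] q t]
  note fi = field_integrable[OF W(1) t q] field_integrable[OF W(2) t q]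
  have "fst (picard W2 t q - picard W1 t q) = - integral {t..} (\<lambda>\<tau>. fst (field W2 \<tau> q) - fst (field W1 \<tau> q))"
    using fst_snd_picard[OF W(1) t q] fst_snd_picard[OF W(2) t q]
      integral_diff[OF integrable_linear[OF fi(2) bounded_linear_fst] integrable_linear[OF fi(1) bounded_linear_fst]]
    by (simp add: o_def)
  moreover have "norm (integral {t..} (\<lambda>\<tau>. fst (field W2 \<tau> q) - fst (field W1 \<tau> q))) \<le> (J * (n / 2)) * tail b t"
    by (rule B.integral_bound[OF tb(1)]) (use c in \<open>auto intro!: continuous_intros f\<close>)
  ultimately have 1: "norm (fst (picard W2 t q - picard W1 t q)) \<le> (J * (n / 2)) * tail b t"
    by (simp only: norm_minus_cancel)
  have "snd (picard W2 t q - picard W1 t q) = - integral {t..} (\<lambda>\<tau>. snd (field W2 \<tau> q) - snd (field W1 \<tau> q))"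
    using fst_snd_picard[OF W(1) t q] fst_snd_picard[OF W(2) t q]
      integral_diff[OF integrable_linear[OF fi(2) bounded_linear_snd] integrable_linear[OF fi(1) bounded_linear_snd]]
    by (simp add: o_def)
  moreover have "norm (integral {t..} (\<lambda>\<tau>. snd (field W2 \<tau> q) - snd (field W1 \<tau> q))) \<le> (n / 2) * tail a t"
    by (rule A.integral_bound[OF tb(1)]) (use c in \<open>auto intro!: continuous_intros f\<close>)
  ultimately have "norm (snd (picard W2 t q - picard W1 t q)) \<le> (n / 2) * tail a t"
    by (simp only: norm_minus_cancel)
  with 1 show ?thesis unfolding close_def by blast
qed

lemma admissible_0: "admissible (\<lambda>_ _. 0)"
proof -
  have "(0 :: 'n cphase) \<in> range cpair"
    by (simp add: range_cpair_iff)
  then show ?thesis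
    unfolding admissible_def tube_def using time_bounds constants
    by (auto simp: case_prod_unfold)
qed

definition iterate :: "nat \<Rightarrow> real \<Rightarrow> complex ^ 'n \<Rightarrow> 'n cphase" where
  "iterate n = (picard ^^ n) (\<lambda>_ _. 0)"

lemma iterate_simps [simp]: "iterate 0 = (\<lambda>_ _. 0)" "iterate (Suc n) = picard (iterate n)"
  by (simp_all add: iterate_def)

lemma admissible_iterate: "admissible (iterate n)"
  by (induction n) (auto intro: admissible_0 admissible_picard)

text \<open>An upper bound for the weighted distance between zero and its image under \<open>picard\<close>, as \<open>1 \<le> J\<close>.\<close>

abbreviation "\<nu> \<equiv> 2 * C + L"

lemma iterate_close:
  assumes "T \<le> t" "q \<in> S"
  shows "close (\<nu> / 2 ^ n) t (iterate (Suc n) t q - iterate n t q)"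
  using assms
proof (induction n arbitrary: t q)
  case 0
  note tb = time_bounds[OF 0(1)]
  have "picard (\<lambda>_ _. 0) t q \<in> tube t"
    using admissibleD(3)[OF admissible_picard[OF admissible_0] 0] .
  moreover have "1 * L \<le> J * \<nu>"
    using constants by (intro mult_mono) auto
  then have "L * tail b t \<le> J * \<nu> * tail b t"
    using tb by (intro mult_right_mono) auto
  moreover have "2 * C * tail a t \<le> \<nu> * tail a t"
    using tb constants by (intro mult_right_mono) auto
  ultimately show ?case
    by (auto simp: close_def tube_def simp del: mult_cancel_right mult_le_cancel_right)
next
  case (Suc n)
  have "close (\<nu> / 2 ^ n / 2) t (picard (iterate (Suc n)) t q - picard (iterate n) t q)"
    by (rule picard_contraction[OF admissible_iterate admissible_iterate]) (use Suc constants in auto)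
  then show ?case by (simp add: mult.commute)
qed

lemma iterate_converges:
  obtains W where "uniform_limit ({T..} \<times> S) (\<lambda>n (t, q). iterate n t q) (\<lambda>(t, q). W t q) sequentially"
proof -
  define M where "M n = (J * tail b T + tail a T) * \<nu> * (1 / 2) ^ n" for n :: nat
  have M: "norm (iterate (Suc n) t q - iterate n t q) \<le> M n" if t: "T \<le> t" and q: "q \<in> S" for n t q
  proof -
    note tb = time_bounds[OF t]
    have n0: "0 \<le> \<nu> / 2 ^ n" using constants by simp
    have "norm (iterate (Suc n) t q - iterate n t q) \<le> J * (\<nu> / 2 ^ n) * tail b t + \<nu> / 2 ^ n * tail a t"
      using norm_pair_le[of "iterate (Suc n) t q - iterate n t q"] iterate_close[OF t q, of n] unfolding close_def by linarith
    also have "\<dots> \<le> J * (\<nu> / 2 ^ n) * tail b T + \<nu> / 2 ^ n * tail a T"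
      using tb constants n0 by (intro add_mono mult_left_mono) auto
    also have "\<dots> = M n" by (simp add: M_def power_divide field_simps)
    finally show ?thesis .
  qed
  have "summable M"
    unfolding M_def by (intro summable_mult summable_geometric) simp
  then have "uniform_limit ({T..} \<times> S) (\<lambda>n x. \<Sum>i<n. iterate (Suc i) (fst x) (snd x) - iterate i (fst x) (snd x))
      (\<lambda>x. suminf (\<lambda>i. iterate (Suc i) (fst x) (snd x) - iterate i (fst x) (snd x))) sequentially"
    by (intro Weierstrass_m_test[where M = M]) (use M in auto)
  moreover have "(\<Sum>i<n. iterate (Suc i) t q - iterate i t q) = iterate n t q" for n t q
    by (subst sum_lessThan_telescope) simp
  ultimately show ?thesis
    by (intro that[of "\<lambda>t q. suminf (\<lambda>i. iterate (Suc i) t q - iterate i t q)"]) (simp add: case_prod_unfold)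
qed

definition solution :: "(real \<Rightarrow> complex ^ 'n \<Rightarrow> 'n cphase) \<Rightarrow> bool" where
  "solution W \<longleftrightarrow> admissible W \<and> (\<forall>t\<ge>T. \<forall>q\<in>S. W t q = picard W t q)"

text \<open>The uniform limit of the iterates inherits continuity, holomorphy, bounds, periodicity and reality;
  it is a fixed point by dominated convergence.\<close>

theorem solution_exists: "\<exists>W. solution W"
proof -
  obtain W where ul: "uniform_limit ({T..} \<times> S) (\<lambda>n (t, q). iterate n t q) (\<lambda>(t, q). W t q) sequentially"
    by (rule iterate_converges)
  note it = admissibleD[OF admissible_iterate]
  have lim: "(\<lambda>n. iterate n t q) \<longlonglongrightarrow> W t q" if "T \<le> t" "q \<in> S" for t q
    using tendsto_uniform_limitI[OF ul, of "(t, q)"] that by simp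
  have ult: "uniform_limit S (\<lambda>n. iterate n t) (W t) sequentially" if "T \<le> t" for t
    using ul that unfolding uniform_limit_iff by (auto elim!: eventually_mono)
  have W: "admissible W"
    unfolding admissible_def
  proof (intro conjI allI impI ballI)
    show "continuous_on ({T..} \<times> S) (\<lambda>(t, q). W t q)"
      by (rule uniform_limit_theorem[OF _ ul]) (use it(1) in auto)
    fix t assume t: "T \<le> t"
    show "holo_map scale_vec scale_pair S (W t)"
    proof (rule VP.holo_map_uniform_limit(1)[OF open_open_strip it(2)[OF t]])
      fix q assume q: "q \<in> S"
      obtain r where r: "0 < r" "cball q (2 * r) \<subseteq> S"
        using VP.open_double_ball[OF open_open_strip q] by blast
      then have "cball q r \<subseteq> S" by auto
      with r(1) uniform_limit_on_subset[OF ult[OF t] this]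
      show "\<exists>r>0. cball q r \<subseteq> S \<and> uniform_limit (cball q r) (\<lambda>n. iterate n t) (W t) sequentially"
        by blast
    qed
    { fix q assume q: "q \<in> S"
      have "closed (tube t)"
      proof -
        have "tube t = cball 0 (L * tail b t) \<times> cball 0 (2 * C * tail a t)"
          by (auto simp: tube_def)
        then show ?thesis by (simp add: closed_Times)
      qed
      then show "W t q \<in> tube t"
        using closed_sequentially[OF _ _ lim[OF t q]] it(3)[OF t q] by blast
      fix k :: "real ^ 'n" assume k: "k \<in> int_lattice"
      have "(\<lambda>n. iterate n t q) \<longlonglongrightarrow> W t (q + cvec k)"
        using lim[OF t, of "q + cvec k"] q it(4)[OF t q k] by simp
      then show "W t (q + cvec k) = W t q"
        using LIMSEQ_unique lim[OF t q] by blast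
    }
    fix x :: "real ^ 'n"
    have "closed (range (cpair :: 'n phase \<Rightarrow> _))"
    proof -
      have "range (cpair :: 'n phase \<Rightarrow> _) = {z. im_vec (fst z) = 0} \<inter> {z. im_vec (snd z) = 0}"
        using range_cpair_iff by auto
      moreover have "closed {z :: 'n cphase. im_vec (fst z) = 0}" "closed {z :: 'n cphase. im_vec (snd z) = 0}"
        by (intro closed_Collect_eq continuous_intros
            linear_continuous_on[OF bounded_linear_compose[OF bounded_linear_im_vec bounded_linear_fst]]
            linear_continuous_on[OF bounded_linear_compose[OF bounded_linear_im_vec bounded_linear_snd]])+
      ultimately show ?thesis by (simp add: closed_Int)
    qed
    then show "W t (cvec x) \<in> range cpair"
      using closed_sequentially[OF _ _ lim[OF t, of "cvec x"]] it(5)[OF t] \<rho> by simp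
  qed
  moreover have "W t q = picard W t q" if t: "T \<le> t" and q: "q \<in> S" for t q
  proof -
    have "(\<lambda>n. integral {t..} (\<lambda>\<tau>. field (iterate n) \<tau> q)) \<longlonglongrightarrow> integral {t..} (\<lambda>\<tau>. field W \<tau> q)"
    proof (rule Equivalence_Lebesgue_Henstock_Integration.dominated_convergence(2)[where h = majorant])
      show "(\<lambda>\<tau>. field (iterate n) \<tau> q) integrable_on {t..}" for n
        by (rule field_integrable[OF admissible_iterate t q])
      show "majorant integrable_on {t..}" by (rule majorant(1)[OF t])
      fix \<tau> assume "\<tau> \<in> {t..}"
      then have \<tau>: "T \<le> \<tau>" using t by simp
      show "norm (field (iterate n) \<tau> q) \<le> majorant \<tau>" for n
        by (rule norm_field(3)[OF admissible_iterate \<tau> q])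
      have in_dom: "base \<tau> q + W \<tau> q \<in> domain \<rho>"
        by (rule tube_in_domain[OF \<tau> q admissibleD(3)[OF W \<tau> q]])
      have "isCont (Y \<tau>) (base \<tau> q + W \<tau> q)"
        using holo_map_continuous[OF hol] continuous_on_eq_continuous_at[OF open_domain] in_dom \<tau> T_nonneg by force
      then show "(\<lambda>n. field (iterate n) \<tau> q) \<longlonglongrightarrow> field W \<tau> q"
        unfolding field_def by (rule isCont_tendsto_compose) (intro tendsto_intros lim[OF \<tau> q])
    qed
    then have "(\<lambda>n. picard (iterate n) t q) \<longlonglongrightarrow> picard W t q"
      unfolding picard_def by (rule tendsto_minus)
    moreover have "(\<lambda>n. iterate (Suc n) t q) \<longlonglongrightarrow> W t q"
      using LIMSEQ_Suc[OF lim[OF t q]] .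
    ultimately show ?thesis using LIMSEQ_unique by simp
  qed
  ultimately show ?thesis by (auto simp: solution_def)
qed

end

lemma fd_cong_open:
  assumes "holo_map sc sd U F" "open U" "z \<in> U" "\<And>w. w \<in> U \<Longrightarrow> G w = F w"
  shows "fd G z = fd F z"
  using fd_eq[OF has_derivative_transform_within_open[OF holo_map_derivative(1)[OF assms(1,3)] assms(2,3)]] assms(4)
  by metis

definition csymp :: "'n::finite cphase \<Rightarrow> 'n cphase \<Rightarrow> complex" where
  "csymp u v = (\<Sum>k\<in>UNIV. snd u $ k * fst v $ k - snd v $ k * fst u $ k)"

context asymptotic_system
begin

lemma solution_time_derivative:
  assumes W: "solution W" and t: "T \<le> t" and q: "q \<in> S"
  shows "((\<lambda>t. W t q) has_vector_derivative field W t q) (at t within {T..})"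
proof -
  have adm: "admissible W" using W by (simp add: solution_def)
  have "((\<lambda>t. integral {t..} (\<lambda>\<tau>. field W \<tau> q)) has_vector_derivative - field W t q) (at t within {T..})"
    by (rule tail_integral_has_vector_derivative[OF continuous_time_slice[OF continuous_field[OF adm] q order_refl]
          field_integrable[OF adm _ q] t])
  then have "((\<lambda>t. picard W t q) has_vector_derivative field W t q) (at t within {T..})"
    unfolding picard_def using has_vector_derivative_minus by fastforce
  then show ?thesis
    by (rule has_vector_derivative_transform[rotated 2]) (use W t q in \<open>auto simp: solution_def\<close>)
qed

text \<open>The linearised equation of motion along the solution.\<close>

lemma solution_fd_time_derivative:
  assumes W: "solution W" and t: "T \<le> t" and q: "q \<in> S"
  shows "((\<lambda>t. fd (W t) q v) has_vector_derivative fd (field W t) q v) (at t within {T..})"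
proof -
  have adm: "admissible W" using W by (simp add: solution_def)
  have "((\<lambda>t. integral {t..} (\<lambda>\<tau>. fd (field W \<tau>) q v)) has_vector_derivative - fd (field W t) q v) (at t within {T..})"
    by (rule tail_integral_has_vector_derivative[OF continuous_time_slice[OF continuous_fd_field[OF adm] q order_refl]
          fd_field_integrable[OF adm _ q] t])
  then have "((\<lambda>t. - integral {t..} (\<lambda>\<tau>. fd (field W \<tau>) q v)) has_vector_derivative fd (field W t) q v) (at t within {T..})"
    using has_vector_derivative_minus by fastforce
  then show ?thesis
  proof (rule has_vector_derivative_transform[rotated 2])
    fix s assume s: "s \<in> {T..}"
    have "fd (W s) q = fd (picard W s) q"
      by (rule fd_cong_open[OF holo_map_picard(1)[OF adm] open_open_strip q]) (use W s in \<open>auto simp: solution_def\<close>)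
    then show "fd (W s) q v = - integral {s..} (\<lambda>\<tau>. fd (field W \<tau>) q v)"
      using holo_map_picard(2)[OF adm _ q] s by simp
  qed (use t in auto)
qed

text \<open>The total derivative of \<open>W\<close> along the curve \<open>(q - \<tau> \<omega>, \<tau>)\<close>; it yields the invariance equation of the
  torus.\<close>

lemma solution_comoving_derivative:
  assumes W: "solution W" and t: "T \<le> t" and q: "q \<in> S"
  shows "((\<lambda>\<tau>. W \<tau> (q - \<tau> *\<^sub>R cvec \<omega>)) has_vector_derivative
      field W t (q - t *\<^sub>R cvec \<omega>) - fd (W t) (q - t *\<^sub>R cvec \<omega>) (cvec \<omega>)) (at t within {T..})"
proof -
  have adm: "admissible W" using W by (simp add: solution_def)
  have inS: "q - \<tau> *\<^sub>R cvec \<omega> \<in> S" for \<tau>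
    using q by (simp add: open_strip_def im_vec_diff im_vec_scaleR)
  let ?q = "q - t *\<^sub>R cvec \<omega>"
  have lin: "linear (fd (W t) ?q)"
    using bounded_linear.linear[OF fd_linear[OF admissibleD(2)[OF adm t] inS]] .
  have "((\<lambda>(x, y). W y x) has_derivative
      (\<lambda>(tx, ty). fd (W t) ?q tx + blinfun_scaleR_left (field W t ?q) ty)) (at (?q, t) within S \<times> {T..})"
  proof (rule has_derivative_partialsI)
    show "(W t has_derivative fd (W t) ?q) (at ?q within S)"
      using holo_map_derivative(1)[OF admissibleD(2)[OF adm t] inS] has_derivative_at_withinI by blast
    show "((\<lambda>y. W y x) has_derivative blinfun_apply (blinfun_scaleR_left (field W y x))) (at y within {T..})"
      if "x \<in> S" "y \<in> {T..}" for x y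
      using solution_time_derivative[OF W _ that(1), of y] that(2)
      by (simp add: has_vector_derivative_def)
    have "continuous_on (S \<times> {T..}) (\<lambda>x. (\<lambda>(t, q). field W t q) (snd x, fst x))"
      by (rule continuous_on_compose2[OF continuous_field[OF adm]]) (auto intro!: continuous_intros)
    then have "continuous_on (S \<times> {T..}) (\<lambda>x. blinfun_scaleR_left (field W (snd x) (fst x)))"
      by (intro bounded_linear.continuous_on[OF bounded_linear_blinfun_scaleR_left]) simp
    then show "continuous (at (?q, t) within S \<times> {T..}) (\<lambda>(x, y). blinfun_scaleR_left (field W y x))"
      unfolding continuous_on_eq_continuous_within case_prod_unfold using inS t by blast
  qed (use t in auto)
  then have "((\<lambda>(x, y). W y x) has_derivative (\<lambda>(tx, ty). fd (W t) ?q tx + ty *\<^sub>R field W t ?q))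
      (at (?q, t) within S \<times> {T..})"
    by simp
  then have 1: "((\<lambda>(x, y). W y x) has_derivative
      (\<lambda>(tx, ty). fd (W t) ?q tx + ty *\<^sub>R field W t ?q))
      (at ((\<lambda>\<tau>. (q - \<tau> *\<^sub>R cvec \<omega>, \<tau>)) t) within (\<lambda>\<tau>. (q - \<tau> *\<^sub>R cvec \<omega>, \<tau>)) ` {T..})"
    by (rule has_derivative_subset) (use inS in auto)
  have 2: "((\<lambda>\<tau>. (q - \<tau> *\<^sub>R cvec \<omega>, \<tau>)) has_derivative (\<lambda>h. (- h *\<^sub>R cvec \<omega>, h))) (at t within {T..})"
    by (auto intro!: derivative_eq_intros)
  from has_derivative_in_compose[OF 2 1] show ?thesis
    by (simp add: has_vector_derivative_def linear_scale[OF lin] linear_neg[OF lin] algebra_simps)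
qed

lemma solution_fd_bound:
  assumes W: "admissible W" and t: "T \<le> t"
  shows "norm (fst (fd (W t) (cvec x) v)) \<le> L * tail b t / (\<rho> / 4) * norm v"
    and "norm (fd (W t) (cvec x) v) \<le> (L * tail b t + 2 * C * tail a t) / (\<rho> / 4) * norm v"
proof -
  have sub: "cball (cvec x) (\<rho> / 4) \<subseteq> S"
  proof
    fix q :: "complex ^ 'n" assume "q \<in> cball (cvec x) (\<rho> / 4)"
    then have "norm (im_vec (q - cvec x)) \<le> \<rho> / 4"
      using norm_im_vec_le[of "q - cvec x"] by (simp add: dist_norm norm_minus_commute)
    then show "q \<in> S" using \<rho> by (simp add: open_strip_def im_vec_diff)
  qed
  have xS: "cvec x \<in> S" using \<rho> by simp
  have r: "0 < \<rho> / 4" using \<rho> by simp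
  note h = admissibleD(2)[OF W t]
  have w: "norm (fst (W t q)) \<le> L * tail b t" "norm (snd (W t q)) \<le> 2 * C * tail a t" if "q \<in> S" for q
    using admissibleD(3)[OF W t that] by (auto simp: tube_def)
  have "norm (fd (\<lambda>q. fst (W t q)) (cvec x) v) \<le> L * tail b t / (\<rho> / 4) * norm v"
    by (rule VV.Cauchy_estimate[OF holo_map_fst_snd(1)[OF h] r sub]) (use w(1) sub in blast)
  then show "norm (fst (fd (W t) (cvec x) v)) \<le> L * tail b t / (\<rho> / 4) * norm v"
    using holo_map_fst_snd(3)[OF h xS] by simp
  show "norm (fd (W t) (cvec x) v) \<le> (L * tail b t + 2 * C * tail a t) / (\<rho> / 4) * norm v"
  proof (rule VP.Cauchy_estimate[OF h r sub])
    fix q assume "q \<in> cball (cvec x) (\<rho> / 4)"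
    then have "q \<in> S" using sub by blast
    then show "norm (W t q) \<le> L * tail b t + 2 * C * tail a t"
      using w[of q] norm_pair_le[of "W t q"] by linarith
  qed
qed

text \<open>The symplectic form evaluated on two variations of the solution is a constant of motion, and
  it tends to zero because the variations tend to horizontal vectors.\<close>

lemma solution_isotropic:
  assumes W: "solution W" and t: "T \<le> t"
    and skew: "\<And>t z u w. 0 \<le> t \<Longrightarrow> z \<in> domain \<rho> \<Longrightarrow> csymp (fd (Y t) z u) w + csymp u (fd (Y t) z w) = 0"
  shows "csymp ((v, 0) + fd (W t) (cvec x) v) ((w, 0) + fd (W t) (cvec x) w) = 0"
proof -
  have adm: "admissible W" using W by (simp add: solution_def)
  let ?q = "cvec x :: complex ^ 'n"
  have q: "?q \<in> S" using \<rho> by simp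
  define \<xi> where "\<xi> v t = (v, 0) + fd (W t) ?q v" for v t
  define g where "g t = csymp (\<xi> v t) (\<xi> w t)" for t
  have d\<xi>: "(\<xi> v has_vector_derivative fd (Y s) (base s ?q + W s ?q) (\<xi> v s)) (at s within {T..})"
    if s: "T \<le> s" for v s
    unfolding \<xi>_def fd_field[OF adm s q, symmetric]
    using has_vector_derivative_add[OF has_vector_derivative_const solution_fd_time_derivative[OF W s q, of v]]
    by simp
  have gd: "(g has_derivative (\<lambda>h. 0)) (at s within {T..})" if "s \<in> {T..}" for s
  proof -
    have s: "T \<le> s" using that by simp
    let ?z = "base s ?q + W s ?q"
    have bl: "bounded_linear (\<lambda>z :: 'n cphase. fst z $ k)" "bounded_linear (\<lambda>z :: 'n cphase. snd z $ k)" for k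
      by (auto intro: bounded_linear_compose[OF bounded_linear_vec_nth bounded_linear_fst]
          bounded_linear_compose[OF bounded_linear_vec_nth bounded_linear_snd])
    note c = bounded_linear.has_vector_derivative[OF bl(1) d\<xi>[OF s]] bounded_linear.has_vector_derivative[OF bl(2) d\<xi>[OF s]]
    have "(g has_vector_derivative
        (\<Sum>k\<in>UNIV. (snd (\<xi> v s) $ k * fst (fd (Y s) ?z (\<xi> w s)) $ k + snd (fd (Y s) ?z (\<xi> v s)) $ k * fst (\<xi> w s) $ k)
         - (snd (\<xi> w s) $ k * fst (fd (Y s) ?z (\<xi> v s)) $ k + snd (fd (Y s) ?z (\<xi> w s)) $ k * fst (\<xi> v s) $ k)))
       (at s within {T..})"
      unfolding g_def csymp_def
      by (intro has_vector_derivative_sum has_vector_derivative_diff has_vector_derivative_mult c)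
    moreover have "(\<Sum>k\<in>UNIV. (snd (\<xi> v s) $ k * fst (fd (Y s) ?z (\<xi> w s)) $ k + snd (fd (Y s) ?z (\<xi> v s)) $ k * fst (\<xi> w s) $ k)
         - (snd (\<xi> w s) $ k * fst (fd (Y s) ?z (\<xi> v s)) $ k + snd (fd (Y s) ?z (\<xi> w s)) $ k * fst (\<xi> v s) $ k))
      = csymp (fd (Y s) ?z (\<xi> v s)) (\<xi> w s) + csymp (\<xi> v s) (fd (Y s) ?z (\<xi> w s))"
      by (simp add: csymp_def sum.distrib[symmetric] algebra_simps)
    moreover have "\<dots> = 0"
      using skew tube_in_domain[OF s q admissibleD(3)[OF adm s q]] s T_nonneg by simp
    ultimately show ?thesis by (simp add: has_vector_derivative_def)
  qed
  have const: "g s = g t" if "T \<le> s" for s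
    by (rule has_derivative_zero_unique[OF convex_real_interval(1) gd]) (use that t in simp_all)
  have \<xi>lim: "(\<xi> v \<longlongrightarrow> (v, 0)) at_top" for v
  proof -
    have "((\<lambda>s. (L * tail b s + 2 * C * tail a s) / (\<rho> / 4) * norm v) \<longlongrightarrow> (L * 0 + 2 * C * 0) / (\<rho> / 4) * norm v) at_top"
      by (intro tendsto_intros A.tail_tendsto_0 B.tail_tendsto_0) (use \<rho> in auto)
    then have "((\<lambda>s. (L * tail b s + 2 * C * tail a s) / (\<rho> / 4) * norm v) \<longlongrightarrow> 0) at_top" by simp
    then have "((\<lambda>s. fd (W s) ?q v) \<longlongrightarrow> 0) at_top"
      by (rule Lim_null_comparison[rotated])
        (use solution_fd_bound(2)[OF adm] in \<open>auto simp: eventually_at_top_linorder intro!: exI[of _ T]\<close>)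
    from tendsto_add[OF tendsto_const this, of "(v, 0)"] show ?thesis by (simp add: \<xi>_def[abs_def])
  qed
  have "(g \<longlongrightarrow> csymp (v, 0) (w, 0)) at_top"
    unfolding g_def csymp_def by (intro tendsto_intros \<xi>lim)
  moreover have "csymp (v, 0) (w, 0) = 0" by (simp add: csymp_def)
  moreover have "(g \<longlongrightarrow> g t) at_top"
    by (rule tendsto_eventually) (use const in \<open>auto simp: eventually_at_top_linorder\<close>)
  ultimately have "g t = 0" using tendsto_unique by (metis trivial_limit_at_top_linorder)
  then show ?thesis by (simp add: g_def \<xi>_def)
qed

end

section \<open>Estimates for the Hamiltonian vector field\<close>

lemma norm_vec_le_card:
  fixes x :: "'b::real_normed_vector ^ 'n"
  assumes "\<And>k. norm (x $ k) \<le> B"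
  shows "norm x \<le> real CARD('n) * B"
proof -
  have "norm x \<le> (\<Sum>k\<in>UNIV. norm (x $ k))"
    unfolding norm_vec_def by (rule L2_set_le_sum) auto
  also have "\<dots> \<le> real CARD('n) * B"
    using sum_bounded_above[of UNIV "\<lambda>k. norm (x $ k)" B] assms by simp
  finally show ?thesis .
qed

definition dq :: "'n \<Rightarrow> 'n::finite cphase" where "dq k = (axis k 1, 0)"
definition dp :: "'n \<Rightarrow> 'n::finite cphase" where "dp k = (0, axis k 1)"

lemma axis_cpair: "dp k = cpair (0, axis k 1)" "dq k = cpair (axis k 1, 0)"
  by (auto simp: dp_def dq_def axis_def vec_eq_iff prod_eq_iff)

lemma cphase_expansion: "w = (\<Sum>k\<in>UNIV. scale_pair (fst w $ k) (dq k) + scale_pair (snd w $ k) (dp k))"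
proof -
  have "x = (\<Sum>k\<in>UNIV. scale_vec (x $ k) (axis k 1))" for x :: "complex ^ 'n"
    using basis_expansion[of x] by (simp add: scale_vec_def)
  from this[of "fst w"] this[of "snd w"] show ?thesis
    by (simp add: prod_eq_iff fst_sum snd_sum dq_def dp_def V.bounded_linear_sc_right bounded_linear.linear linear_0)
qed

lemma complex_linear_expansion:
  assumes "bounded_linear L" "\<And>c v. L (scale_pair c v) = c * L v"
  shows "L w = (\<Sum>k\<in>UNIV. fst w $ k * L (dq k) + snd w $ k * L (dp k))"
proof -
  have "L w = L (\<Sum>k\<in>UNIV. scale_pair (fst w $ k) (dq k) + scale_pair (snd w $ k) (dp k))"
    using cphase_expansion[of w] by simp
  then show ?thesis
    using bounded_linear.linear[OF assms(1)] by (simp add: linear_sum linear_add assms(2))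
qed

lemma norm_axis_complex: "norm (axis k (1 :: complex)) = 1"
proof -
  have "axis k (1 :: complex) = cvec (axis k 1)"
    by (simp add: vec_eq_iff axis_def)
  then show ?thesis by (simp add: norm_axis_1)
qed

text \<open>A complexified Hamiltonian \<open>H\<close> with real values \<open>Hr\<close>, subject to the scalar bounds that the hypotheses
  on the norms provide. The number \<open>N\<close> of degrees of freedom is a parameter because constants defined
  in terms of \<open>CARD('n)\<close> alone would carry the type as an extra argument.\<close>

locale complex_hamiltonian = A: decaying a + B: decaying b
  for a b :: "real \<Rightarrow> real" +
  fixes \<upsilon> \<Lambda> s M N :: real and \<omega> :: "real ^ 'n" and H :: "real \<Rightarrow> 'n::finite cphase \<Rightarrow> complex"
    and Hr :: "real \<Rightarrow> 'n phase \<Rightarrow> real"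
  assumes \<upsilon>: "0 \<le> \<upsilon>" and \<Lambda>: "1 \<le> \<Lambda>" and s: "0 < s" and M: "0 \<le> M" and N: "N = real CARD('n)"
    and tail_a_le: "\<upsilon> \<le> t \<Longrightarrow> tail a t \<le> \<Lambda> * b t"
    and tail_a_b_le: "\<upsilon> \<le> t \<Longrightarrow> tail a t * b t \<le> \<Lambda> * a t * tail b t"
    and cont: "continuous_on ({0..} \<times> domain s) (\<lambda>(t, z). H t z)"
    and hol: "0 \<le> t \<Longrightarrow> holo_map scale_pair (*) (domain s) (H t)"
    and periodic: "0 \<le> t \<Longrightarrow> z \<in> domain s \<Longrightarrow> k \<in> int_lattice \<Longrightarrow> H t (z + (cvec k, 0)) = H t z"
    and real: "0 \<le> t \<Longrightarrow> norm (snd x) < s \<Longrightarrow> H t (cpair x) = complex_of_real (Hr t x)"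
    and dp_bound: "0 \<le> t \<Longrightarrow> q \<in> open_strip s \<Longrightarrow> cmod (fd (H t) (q, 0) (dp i) - of_real (\<omega> $ i)) \<le> b t"
    and dq_bound: "0 \<le> t \<Longrightarrow> q \<in> open_strip s \<Longrightarrow> cmod (fd (H t) (q, 0) (dq i)) \<le> a t"
    and hess_bound: "0 \<le> t \<Longrightarrow> z \<in> domain s \<Longrightarrow> cmod (fd (\<lambda>z. fd (H t) z (dp j)) z (dp i)) \<le> M"
begin

definition Y :: "real \<Rightarrow> 'n cphase \<Rightarrow> 'n cphase" where
  "Y t z = ((\<chi> k. fd (H t) z (dp k) - of_real (\<omega> $ k)), (\<chi> k. - fd (H t) z (dq k)))"

definition D2 :: "real \<Rightarrow> 'n cphase \<Rightarrow> 'n cphase \<Rightarrow> 'n cphase \<Rightarrow> complex" where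
  "D2 t z u w = fd (\<lambda>z. fd (H t) z u) z w"

lemma holo_map_fd_H: "0 \<le> t \<Longrightarrow> holo_map scale_pair (*) (domain s) (\<lambda>z. fd (H t) z u)"
  by (rule PC.holo_map_fd[OF hol open_domain])

lemma D2_commute: "0 \<le> t \<Longrightarrow> z \<in> domain s \<Longrightarrow> D2 t z u w = D2 t z w u"
  unfolding D2_def by (rule PC.fd_fd_commute[OF hol open_domain])

lemma D2_expansion:
  assumes "0 \<le> t" "z \<in> domain s"
  shows "D2 t z u w = (\<Sum>k\<in>UNIV. fst w $ k * D2 t z u (dq k) + snd w $ k * D2 t z u (dp k))"
  unfolding D2_def
  by (rule complex_linear_expansion[OF fd_linear[OF holo_map_fd_H[OF assms(1)] assms(2)]])
    (rule holo_map_derivative(2)[OF holo_map_fd_H[OF assms(1)] assms(2)])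

lemma holo_map_Y: "0 \<le> t \<Longrightarrow> holo_map scale_pair scale_pair (domain s) (Y t)"
  unfolding Y_def[abs_def]
  by (intro holo_map_Pair holo_map_vec) (auto intro!: PC.holo_map_diff PC.holo_map_minus holo_map_fd_H)

lemma fd_Y:
  assumes "0 \<le> t" "z \<in> domain s"
  shows "fst (fd (Y t) z w) $ k = D2 t z (dp k) w" "snd (fd (Y t) z w) $ k = - D2 t z (dq k) w"
proof -
  note h = holo_map_Y[OF assms(1)]
  have "fst (fd (Y t) z w) $ k = fd (\<lambda>z. fst (Y t z) $ k) z w"
    using holo_map_fst_snd(3)[OF h assms(2)] holo_map_nth(2)[OF holo_map_fst_snd(1)[OF h] assms(2)] by simp
  also have "\<dots> = D2 t z (dp k) w"
    unfolding Y_def D2_def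
    using PC.fd_diff[OF holo_map_fd_H[OF assms(1)] PC.holo_map_const assms(2), of "dp k" "of_real (\<omega> $ k)" w]
    by (simp add: frechet_derivative_const)
  finally show "fst (fd (Y t) z w) $ k = D2 t z (dp k) w" .
  have "snd (fd (Y t) z w) $ k = fd (\<lambda>z. snd (Y t z) $ k) z w"
    using holo_map_fst_snd(4)[OF h assms(2)] holo_map_nth(2)[OF holo_map_fst_snd(2)[OF h] assms(2)] by simp
  also have "\<dots> = - D2 t z (dq k) w"
    unfolding Y_def D2_def
    using PC.fd_scaleR[OF holo_map_fd_H[OF assms(1)] assms(2), of "- 1" "dq k" w] by simp
  finally show "snd (fd (Y t) z w) $ k = - D2 t z (dq k) w" .
qed

text \<open>Hamiltonian vector fields are infinitesimally symplectic, by the symmetry of the Hessian.\<close>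

lemma fd_Y_skew:
  assumes "0 \<le> t" "z \<in> domain s"
  shows "csymp (fd (Y t) z u) w + csymp u (fd (Y t) z w) = 0"
proof -
  have 1: "csymp (fd (Y t) z u) w = - D2 t z u w" for u w
    unfolding csymp_def fd_Y[OF assms] D2_expansion[OF assms, of u w] sum_negf[symmetric]
    by (rule sum.cong) (simp_all add: D2_commute[OF assms, of u] algebra_simps)
  have "csymp u (fd (Y t) z w) = - csymp (fd (Y t) z w) u"
    by (simp add: csymp_def sum_negf[symmetric])
  then show ?thesis using 1[of u w] 1[of w u] D2_commute[OF assms, of u w] by simp
qed

text \<open>The constants in the chain of estimates, up to the weights in \<open>a\<close>, \<open>b\<close> and \<open>|p|\<close>: \<open>C1\<close> bounds the \<open>p\<close>-derivative of the velocity, \<open>C2\<close> its \<open>q\<close>-derivative, \<open>C3\<close> the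
  \<open>p\<close>-derivative of the force and \<open>C4\<close> its \<open>q\<close>-derivative. The two Cauchy estimates reduce the domain from
  \<open>s\<close> to \<open>s / 2\<close> and then to \<open>s / 4\<close>.\<close>

definition "C1 = N * (N * M)"
definition "C2 = 2 / s * (N + C1)"
definition "C3 = N * (N * C2)"
definition "C4 = 4 / s * (N + C3)"

lemma constants: "1 \<le> N" "0 \<le> C1" "0 \<le> C2" "0 \<le> C3" "0 \<le> C4"
proof -
  have "CARD('n) \<ge> 1" using zero_less_card_finite[where 'a = 'n] by linarith
  then show N1: "1 \<le> N" using N by linarith
  show c1: "0 \<le> C1" using M N1 by (simp add: C1_def)
  show c2: "0 \<le> C2" using c1 s N1 by (simp add: C2_def)
  show c3: "0 \<le> C3" using c2 N1 by (simp add: C3_def)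
  show "0 \<le> C4" using c3 s N1 by (simp add: C4_def)
qed

lemma norm_vec_le:
  fixes x :: "complex ^ 'n"
  shows "(\<And>k. norm (x $ k) \<le> B) \<Longrightarrow> norm x \<le> N * B"
  using norm_vec_le_card[of x B] by (simp add: N)

lemma D2_dp_bound:
  assumes "0 \<le> t" "z \<in> domain s" "\<And>j. cmod (D2 t z u (dp j)) \<le> K"
  shows "cmod (D2 t z u (0, w)) \<le> N * K * norm w"
proof -
  have "cmod (D2 t z u (0, w)) \<le> (\<Sum>j\<in>UNIV. cmod (w $ j * D2 t z u (dp j)))"
    unfolding D2_expansion[OF assms(1,2), of u "(0, w)"] by (rule order_trans[OF norm_sum]) simp
  also have "\<dots> \<le> (\<Sum>j\<in>(UNIV :: 'n set). norm w * K)"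
    unfolding norm_mult by (intro sum_mono mult_mono assms(3) Finite_Cartesian_Product.norm_nth_le) auto
  finally show ?thesis by (simp add: N mult_ac)
qed

lemma fst_fd_Y_dp:
  assumes "0 \<le> t" "z \<in> domain s"
  shows "norm (fst (fd (Y t) z (0, w))) \<le> C1 * norm w"
proof -
  have "norm (fst (fd (Y t) z (0, w))) \<le> N * (N * M * norm w)"
    by (rule norm_vec_le, unfold fd_Y[OF assms], rule D2_dp_bound[OF assms])
      (use hess_bound[OF assms] in \<open>simp add: D2_def\<close>)
  then show ?thesis by (simp add: C1_def mult.assoc)
qed

lemma domain_vertical_segment:
  assumes "z \<in> domain r" "0 \<le> \<theta>" "\<theta> \<le> 1"
  shows "(fst z, 0) + \<theta> *\<^sub>R (z - (fst z, 0)) \<in> domain r"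
    and "(fst z, 0) \<in> domain r"
    and "norm (snd ((fst z, 0) + \<theta> *\<^sub>R (z - (fst z, 0)))) \<le> norm (snd z)"
proof -
  have "norm (\<theta> *\<^sub>R snd z) \<le> norm (snd z)"
    using assms(2,3) by (simp add: mult_left_le_one_le)
  moreover have "norm (snd z) < r" using assms by (auto simp: domain_def mem_Times_iff)
  moreover have "0 < r" using calculation(2) norm_ge_zero le_less_trans by blast
  ultimately show "(fst z, 0) + \<theta> *\<^sub>R (z - (fst z, 0)) \<in> domain r" "(fst z, 0) \<in> domain r"
    "norm (snd ((fst z, 0) + \<theta> *\<^sub>R (z - (fst z, 0)))) \<le> norm (snd z)"
    using assms by (auto simp: domain_def mem_Times_iff)
qed

lemma Y_zero_section:
  assumes "0 \<le> t" "q \<in> open_strip s"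
  shows "norm (fst (Y t (q, 0))) \<le> N * b t" "norm (snd (Y t (q, 0))) \<le> N * a t"
  unfolding Y_def using dp_bound[OF assms] dq_bound[OF assms] by (auto intro!: norm_vec_le)

lemma fst_Y_bound:
  assumes "0 \<le> t" "z \<in> domain s"
  shows "norm (fst (Y t z)) \<le> N * b t + C1 * norm (snd z)"
proof -
  have "norm (fst (Y t z) - fst (Y t (fst z, 0))) \<le> C1 * norm (snd z)"
  proof (rule derivative_bound_along_segment[OF holo_map_Y[OF assms(1)] convex_domain _ assms(2) bounded_linear_fst])
    show "(fst z, 0) \<in> domain s" using domain_vertical_segment(2)[OF assms(2), of 0] by simp
    fix \<theta> :: real assume \<theta>: "0 \<le> \<theta>" "\<theta> \<le> 1"
    have "z - (fst z, 0) = (0, snd z)" by (simp add: prod_eq_iff)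
    then show "norm (fst (fd (Y t) ((fst z, 0) + \<theta> *\<^sub>R (z - (fst z, 0))) (z - (fst z, 0)))) \<le> C1 * norm (snd z)"
      using fst_fd_Y_dp[OF assms(1) domain_vertical_segment(1)[OF assms(2) \<theta>], of "snd z"] by simp
  qed
  moreover have "norm (fst (Y t (fst z, 0))) \<le> N * b t"
    using assms by (intro Y_zero_section) (auto simp: domain_def mem_Times_iff)
  ultimately show ?thesis
    using norm_triangle_ineq2[of "fst (Y t z)" "fst (Y t (fst z, 0))"] by linarith
qed

text \<open>Cauchy's estimate in \<open>q\<close> at fixed momentum, so that the bound \<open>K\<close> may depend on the momentum.\<close>

lemma horizontal_Cauchy:
  fixes F :: "'n cphase \<Rightarrow> complex ^ 'n"
  assumes F: "holo_map scale_pair scale_vec (domain (2 * r)) F" and z: "z \<in> domain r" and r: "0 < r"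
    and K: "\<And>q. q \<in> open_strip (2 * r) \<Longrightarrow> norm (F (q, snd z)) \<le> K"
  shows "norm (fd F z (v, 0)) \<le> K / r * norm v"
proof (cases "v = 0")
  case True
  have "z \<in> domain (2 * r)" using z domain_mono[of r "2 * r"] r by auto
  from fd_linear[OF F this] show ?thesis
    using True by (simp add: bounded_linear.linear linear_0 flip: zero_prod_def)
next
  case False
  have in_strip: "fst z + scale_vec \<zeta> v \<in> open_strip (2 * r)" if "cmod \<zeta> \<le> r / norm v" for \<zeta>
  proof -
    have "norm (im_vec (scale_vec \<zeta> v)) \<le> r"
      using that False norm_im_vec_le[of "scale_vec \<zeta> v"] by (simp add: V.norm_sc field_simps)
    moreover have "norm (im_vec (fst z)) < r" using z by (auto simp: domain_def open_strip_def)
    ultimately show ?thesis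
      using norm_triangle_ineq[of "im_vec (fst z)" "im_vec (scale_vec \<zeta> v)"]
      by (simp add: open_strip_def im_vec_add)
  qed
  have "norm (snd z) < 2 * r" using z r by (auto simp: domain_def mem_Times_iff)
  then have "norm (fd F z (v, 0)) \<le> K / (r / norm v)"
    using in_strip K r False
    by (intro PV.directional_Cauchy[OF F])
      (auto simp: domain_def plus_prod_def mem_Times_iff V.bounded_linear_sc_right bounded_linear.linear linear_0)
  then show ?thesis by simp
qed

lemma fst_fd_Y_dq:
  assumes t: "0 \<le> t" and z: "z \<in> domain (s / 2)"
  shows "norm (fst (fd (Y t) z (v, 0))) \<le> C2 * (b t + norm (snd z)) * norm v"
proof -
  have zs: "z \<in> domain s" using z domain_mono[of "s / 2" s] s by auto
  have "norm (fd (\<lambda>z. fst (Y t z)) z (v, 0)) \<le> (N * b t + C1 * norm (snd z)) / (s / 2) * norm v"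
  proof (rule horizontal_Cauchy[OF _ z])
    show "holo_map scale_pair scale_vec (domain (2 * (s / 2))) (\<lambda>z. fst (Y t z))"
      using holo_map_fst_snd(1)[OF holo_map_Y[OF t]] by simp
    fix q :: "complex ^ 'n" assume "q \<in> open_strip (2 * (s / 2))"
    then show "norm (fst (Y t (q, snd z))) \<le> N * b t + C1 * norm (snd z)"
      using fst_Y_bound[OF t, of "(q, snd z)"] zs by (auto simp: domain_def mem_Times_iff)
  qed (use s in auto)
  also have "\<dots> \<le> C2 * (b t + norm (snd z)) * norm v"
  proof (rule mult_right_mono)
    have "(N * b t + C1 * norm (snd z)) / (s / 2) = 2 / s * (N * b t + C1 * norm (snd z))" by simp
    also have "\<dots> \<le> 2 / s * ((N + C1) * (b t + norm (snd z)))"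
      using constants B.pos[OF t] s by (intro mult_left_mono) (auto simp: algebra_simps)
    also have "\<dots> = C2 * (b t + norm (snd z))" by (simp only: C2_def mult.assoc)
    finally show "(N * b t + C1 * norm (snd z)) / (s / 2) \<le> C2 * (b t + norm (snd z))" .
  qed simp
  finally show ?thesis
    using holo_map_fst_snd(3)[OF holo_map_Y[OF t] zs] by simp
qed

text \<open>By symmetry of the second derivative, the \<open>p\<close>-derivative of the force is minus the transposed
  \<open>q\<close>-derivative of the velocity, which has already been bounded.\<close>

lemma snd_fd_Y_dp:
  assumes t: "0 \<le> t" and z: "z \<in> domain (s / 2)"
  shows "norm (snd (fd (Y t) z (0, w))) \<le> C3 * (b t + norm (snd z)) * norm w"
proof -
  have zs: "z \<in> domain s" using z domain_mono[of "s / 2" s] s by auto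
  have "norm (snd (fd (Y t) z (0, w))) \<le> N * (N * (C2 * (b t + norm (snd z))) * norm w)"
  proof (rule norm_vec_le)
    fix k
    have "cmod (D2 t z (dq k) (dp j)) \<le> C2 * (b t + norm (snd z))" for j
    proof -
      have "cmod (D2 t z (dq k) (dp j)) = cmod (fst (fd (Y t) z (axis k 1, 0)) $ j)"
        using D2_commute[OF t zs, of "dq k" "dp j"] fd_Y(1)[OF t zs] by (simp add: dq_def)
      also have "\<dots> \<le> norm (fst (fd (Y t) z (axis k 1, 0)))" by (rule Finite_Cartesian_Product.norm_nth_le)
      also have "\<dots> \<le> C2 * (b t + norm (snd z)) * norm (axis k (1 :: complex))"
        by (rule fst_fd_Y_dq[OF t z])
      finally show ?thesis by (simp add: norm_axis_complex)
    qed
    then show "cmod (snd (fd (Y t) z (0, w)) $ k) \<le> N * (C2 * (b t + norm (snd z))) * norm w"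
      unfolding fd_Y[OF t zs] norm_minus_cancel by (rule D2_dp_bound[OF t zs])
  qed
  then show ?thesis by (simp add: C3_def mult.assoc)
qed

lemma snd_Y_bound:
  assumes t: "0 \<le> t" and z: "z \<in> domain (s / 2)"
  shows "norm (snd (Y t z)) \<le> N * a t + C3 * (b t + norm (snd z)) * norm (snd z)"
proof -
  have zs: "z \<in> domain s" using z domain_mono[of "s / 2" s] s by auto
  have "norm (snd (Y t z) - snd (Y t (fst z, 0))) \<le> C3 * (b t + norm (snd z)) * norm (snd z)"
  proof (rule derivative_bound_along_segment[OF holo_map_Y[OF t] convex_domain _ zs bounded_linear_snd])
    show "(fst z, 0) \<in> domain s" using domain_vertical_segment(2)[OF zs, of 0] by simp
    fix \<theta> :: real assume \<theta>: "0 \<le> \<theta>" "\<theta> \<le> 1"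
    let ?z = "(fst z, 0) + \<theta> *\<^sub>R (z - (fst z, 0))"
    have "norm (snd (fd (Y t) ?z (0, snd z))) \<le> C3 * (b t + norm (snd ?z)) * norm (snd z)"
      by (rule snd_fd_Y_dp[OF t domain_vertical_segment(1)[OF z \<theta>]])
    also have "\<dots> \<le> C3 * (b t + norm (snd z)) * norm (snd z)"
      using domain_vertical_segment(3)[OF z \<theta>] constants by (intro mult_right_mono mult_left_mono) auto
    finally show "norm (snd (fd (Y t) ?z (z - (fst z, 0)))) \<le> C3 * (b t + norm (snd z)) * norm (snd z)"
      by (simp add: minus_prod_def)
  qed
  moreover have "norm (snd (Y t (fst z, 0))) \<le> N * a t"
    using t zs by (intro Y_zero_section) (auto simp: domain_def mem_Times_iff)
  ultimately show ?thesis
    using norm_triangle_ineq2[of "snd (Y t z)" "snd (Y t (fst z, 0))"] by linarith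
qed

lemma snd_fd_Y_dq:
  assumes t: "0 \<le> t" and z: "z \<in> domain (s / 4)"
  shows "norm (snd (fd (Y t) z (v, 0))) \<le> C4 * (a t + (b t + norm (snd z)) * norm (snd z)) * norm v"
proof -
  have zs: "z \<in> domain s" using z domain_mono[of "s / 4" s] s by auto
  have zs2: "z \<in> domain (s / 2)" using z domain_mono[of "s / 4" "s / 2"] s by auto
  let ?m = "N * a t + C3 * (b t + norm (snd z)) * norm (snd z)"
  have "norm (fd (\<lambda>z. snd (Y t z)) z (v, 0)) \<le> ?m / (s / 4) * norm v"
  proof (rule horizontal_Cauchy[OF _ z])
    show "holo_map scale_pair scale_vec (domain (2 * (s / 4))) (\<lambda>z. snd (Y t z))"
      using holo_map_subset[OF holo_map_fst_snd(2)[OF holo_map_Y[OF t]] domain_mono] s by simp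
    fix q :: "complex ^ 'n" assume "q \<in> open_strip (2 * (s / 4))"
    then show "norm (snd (Y t (q, snd z))) \<le> ?m"
      using snd_Y_bound[OF t, of "(q, snd z)"] zs2 by (auto simp: domain_def mem_Times_iff)
  qed (use s in auto)
  also have "\<dots> \<le> C4 * (a t + (b t + norm (snd z)) * norm (snd z)) * norm v"
  proof (rule mult_right_mono)
    have p: "0 \<le> (b t + norm (snd z)) * norm (snd z)" using B.pos[OF t] by simp
    have "N * a t \<le> (N + C3) * a t"
      "C3 * ((b t + norm (snd z)) * norm (snd z)) \<le> (N + C3) * ((b t + norm (snd z)) * norm (snd z))"
      using constants A.pos[OF t] p by (intro mult_right_mono; simp)+
    moreover have "?m = N * a t + C3 * ((b t + norm (snd z)) * norm (snd z))"
      by (simp only: mult.assoc)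
    moreover have "(N + C3) * (a t + (b t + norm (snd z)) * norm (snd z))
        = (N + C3) * a t + (N + C3) * ((b t + norm (snd z)) * norm (snd z))"
      by (rule distrib_left)
    ultimately have "?m \<le> (N + C3) * (a t + (b t + norm (snd z)) * norm (snd z))"
      by linarith
    then have "4 / s * ?m \<le> 4 / s * ((N + C3) * (a t + (b t + norm (snd z)) * norm (snd z)))"
      using s by (intro mult_left_mono) auto
    moreover have "?m / (s / 4) = 4 / s * ?m" by simp
    moreover have "C4 * (a t + (b t + norm (snd z)) * norm (snd z))
        = 4 / s * ((N + C3) * (a t + (b t + norm (snd z)) * norm (snd z)))"
      by (simp only: C4_def mult.assoc)
    ultimately show "?m / (s / 4) \<le> C4 * (a t + (b t + norm (snd z)) * norm (snd z))"
      by (simp only:)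
  qed simp
  finally show ?thesis
    using holo_map_fst_snd(4)[OF holo_map_Y[OF t] zs] by simp
qed

lemma fd_Y_split:
  assumes "0 \<le> t" "z \<in> domain s"
  shows "fd (Y t) z w = fd (Y t) z (fst w, 0) + fd (Y t) z (0, snd w)"
  using linear_add[OF bounded_linear.linear[OF fd_linear[OF holo_map_Y[OF assms(1)] assms(2)]], of "(fst w, 0)" "(0, snd w)"]
  by simp

lemma continuous_Y: "continuous_on ({0..} \<times> domain s) (\<lambda>(t, z). Y t z)"
proof -
  have "continuous_on ({0..} \<times> domain s) (\<lambda>(t, z). fd (H t) z u)" for u
    by (rule PC.continuous_fd[OF cont open_domain]) (use hol in auto)
  then show ?thesis
    unfolding Y_def case_prod_unfold by (intro continuous_intros continuous_on_vec_lambda) auto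
qed

lemma fd_H_periodic:
  assumes "0 \<le> t" "z \<in> domain s" "k \<in> int_lattice"
  shows "fd (H t) (z + (cvec k, 0)) u = fd (H t) z u"
proof -
  have sh: "z \<in> domain s \<Longrightarrow> z + (cvec k, 0) \<in> domain s" for z
    by (auto simp: domain_def mem_Times_iff)
  have "fd (\<lambda>z. H t (z + (cvec k, 0))) z = fd (H t) z"
    by (rule fd_cong_open[OF hol[OF assms(1)] open_domain assms(2)]) (use periodic[OF assms(1) _ assms(3)] in auto)
  then show ?thesis
    using PC.holo_map_shift(2)[OF hol[OF assms(1)] sh assms(2)] by metis
qed

lemma fd_H_real:
  assumes "0 \<le> t" "norm (snd x) < s"
  shows "(Hr t has_derivative (\<lambda>v. Re (fd (H t) (cpair x) (cpair v)))) (at x)"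
    and "fd (H t) (cpair x) (cpair v) = of_real (Re (fd (H t) (cpair x) (cpair v)))"
proof -
  have U: "open {x :: 'n phase. norm (snd x) < s}"
    by (intro open_Collect_less continuous_intros)
  have x: "cpair x \<in> domain s"
    using assms s by (auto simp: domain_def mem_Times_iff)
  note d = real_derivative_of_extension[OF bounded_linear_cpair holo_map_derivative(1)[OF hol[OF assms(1)] x] U]
  show "(Hr t has_derivative (\<lambda>v. Re (fd (H t) (cpair x) (cpair v)))) (at x)"
    "fd (H t) (cpair x) (cpair v) = of_real (Re (fd (H t) (cpair x) (cpair v)))"
    using d[of "Hr t"] assms real by auto
qed

lemma Y_real:
  assumes "0 \<le> t" "norm (snd x) < s"
  shows "Y t (cpair x) = cpair ((\<chi> k. Re (fd (H t) (cpair x) (dp k)) - \<omega> $ k), (\<chi> k. - Re (fd (H t) (cpair x) (dq k))))"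
  using fd_H_real(2)[OF assms]
  by (simp add: Y_def prod_eq_iff vec_eq_iff axis_cpair del: cpair_simps(1))

definition "C = 1 + N + C1 + C2 + C3 + C4"

text \<open>The initial time exists because the finitely many smallness conditions hold for all large times.\<close>

lemma asymptotic_system:
  obtains T where "asymptotic_system a b \<upsilon> \<Lambda> C (s / 4) T Y"
proof -
  have Cge: "1 \<le> C" "N \<le> C" "C1 \<le> C" "C2 \<le> C" "C3 \<le> C" "C4 \<le> C"
    using constants by (auto simp: C_def)
  have ev: "\<forall>\<^sub>F T in at_top. c * tail f T \<le> d" if "decaying f" "0 < d" for c d f
  proof -
    have "((\<lambda>T. c * tail f T) \<longlongrightarrow> c * 0) at_top"
      by (intro tendsto_intros decaying.tail_tendsto_0 that)
    then show ?thesis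
      using order_tendstoD(2)[of "\<lambda>T. c * tail f T" "c * 0" at_top d] that(2)
      by (auto elim!: eventually_mono)
  qed
  have dec: "decaying a" "decaying b" by unfold_locales
  have s4: "0 < s / 4 / 2" "0 < s / 4 / 8" "(0 :: real) < 1 / 4" "(0 :: real) < 1 / 2" using s by auto
  obtain T where T: "\<upsilon> \<le> T" "2 * C * tail a T \<le> s / 4 / 2" "C * (1 + 2 * C * \<Lambda>) * tail b T \<le> s / 4 / 8"
      "2 * C * (1 + 2 * C * \<Lambda>) * \<Lambda> * tail b T \<le> 1"
      "C * (1 + 2 * C * \<Lambda>) * tail b T \<le> 1 / 4"
      "(8 * C\<^sup>2 * \<Lambda> + C * (1 + 2 * C * \<Lambda>) * \<Lambda>) * tail b T \<le> 1 / 2"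
    using eventually_happens[OF eventually_conj[OF eventually_ge_at_top[of \<upsilon>]
        eventually_conj[OF ev[OF dec(1) s4(1), of "2 * C"]
        eventually_conj[OF ev[OF dec(2) s4(2), of "C * (1 + 2 * C * \<Lambda>)"]
        eventually_conj[OF ev[OF dec(2) zero_less_one, of "2 * C * (1 + 2 * C * \<Lambda>) * \<Lambda>"]
        eventually_conj[OF ev[OF dec(2) s4(3), of "C * (1 + 2 * C * \<Lambda>)"]
          ev[OF dec(2) s4(4), of "8 * C\<^sup>2 * \<Lambda> + C * (1 + 2 * C * \<Lambda>) * \<Lambda>"]]]]]]]
    by auto
  have sub: "domain (s / 4) \<subseteq> domain s" "domain (s / 4) \<subseteq> domain (s / 2)"
    using s by (auto intro!: domain_mono)
  have "asymptotic_system a b \<upsilon> \<Lambda> C (s / 4) T Y"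
  proof (unfold_locales; (fact \<upsilon> \<Lambda> Cge(1) T tail_a_le tail_a_b_le)?)
    show "0 < s / 4" using s by simp
    show "continuous_on ({0..} \<times> domain (s / 4)) (\<lambda>(t, z). Y t z)"
      by (rule continuous_on_subset[OF continuous_Y]) (use sub in auto)
    fix t :: real assume t: "0 \<le> t"
    show "holo_map scale_pair scale_pair (domain (s / 4)) (Y t)"
      by (rule holo_map_subset[OF holo_map_Y[OF t] sub(1)])
    show "Y t (cpair x) \<in> range cpair" if "norm (snd x) < s / 4" for x
    proof -
      have x: "norm (snd x) < s" using that s by simp
      show ?thesis unfolding Y_real[OF t x] by (rule rangeI)
    qed
    fix z :: "'n cphase" assume z: "z \<in> domain (s / 4)"
    have zs: "z \<in> domain s" "z \<in> domain (s / 2)" using z sub by auto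
    have ab: "0 < a t" "0 < b t" using A.pos[OF t] B.pos[OF t] by auto
    have bp: "0 \<le> b t + norm (snd z)" "0 \<le> (b t + norm (snd z)) * norm (snd z)" using ab by auto
    show "Y t (z + (cvec k, 0)) = Y t z" if "k \<in> int_lattice" for k
      using fd_H_periodic[OF t zs(1) that] by (simp add: Y_def)
    have "N * b t \<le> C * b t" "C1 * norm (snd z) \<le> C * norm (snd z)"
      using Cge ab by (intro mult_right_mono; simp)+
    then show "norm (fst (Y t z)) \<le> C * (b t + norm (snd z))"
      using fst_Y_bound[OF t zs(1)] by (simp add: distrib_left)
    have "N * a t \<le> C * a t" "C3 * ((b t + norm (snd z)) * norm (snd z)) \<le> C * ((b t + norm (snd z)) * norm (snd z))"
      using Cge ab bp by (intro mult_right_mono; simp)+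
    then show "norm (snd (Y t z)) \<le> C * (a t + (b t + norm (snd z)) * norm (snd z))"
      using snd_Y_bound[OF t zs(2)] mult.assoc[of C3 "b t + norm (snd z)" "norm (snd z)"]
        distrib_left[of C "a t" "(b t + norm (snd z)) * norm (snd z)"]
      by linarith
    fix w :: "'n cphase"
    have "norm (fst (fd (Y t) z w)) \<le> norm (fst (fd (Y t) z (fst w, 0))) + norm (fst (fd (Y t) z (0, snd w)))"
      unfolding fd_Y_split[OF t zs(1), of w] by (simp add: norm_triangle_ineq)
    also have "\<dots> \<le> C2 * (b t + norm (snd z)) * norm (fst w) + C1 * norm (snd w)"
      by (intro add_mono fst_fd_Y_dq fst_fd_Y_dp t zs)
    also have "\<dots> \<le> C * (b t + norm (snd z)) * norm (fst w) + C * norm (snd w)"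
      using Cge bp by (intro add_mono mult_right_mono) auto
    finally show "norm (fst (fd (Y t) z w)) \<le> C * ((b t + norm (snd z)) * norm (fst w) + norm (snd w))"
      by (simp only: mult.assoc distrib_left[of C "(b t + norm (snd z)) * norm (fst w)" "norm (snd w)"])
    have "norm (snd (fd (Y t) z w)) \<le> norm (snd (fd (Y t) z (fst w, 0))) + norm (snd (fd (Y t) z (0, snd w)))"
      unfolding fd_Y_split[OF t zs(1), of w] by (simp add: norm_triangle_ineq)
    also have "\<dots> \<le> C4 * (a t + (b t + norm (snd z)) * norm (snd z)) * norm (fst w) + C3 * (b t + norm (snd z)) * norm (snd w)"
      by (intro add_mono snd_fd_Y_dq snd_fd_Y_dp t zs z)
    also have "\<dots> \<le> C * (a t + (b t + norm (snd z)) * norm (snd z)) * norm (fst w) + C * (b t + norm (snd z)) * norm (snd w)"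
      using Cge bp ab by (intro add_mono mult_right_mono) auto
    finally show "norm (snd (fd (Y t) z w)) \<le> C * ((a t + (b t + norm (snd z)) * norm (snd z)) * norm (fst w)
        + (b t + norm (snd z)) * norm (snd w))"
      by (simp only: mult.assoc distrib_left[of C "(a t + (b t + norm (snd z)) * norm (snd z)) * norm (fst w)"
          "(b t + norm (snd z)) * norm (snd w)"])
  qed
  then show ?thesis using that by blast
qed

end

section \<open>Norms, gradients and embeddings through holomorphic extensions\<close>

lemma holo_ext_domain:
  assumes "holo_ext scale_pair cpair phase_lattice (strip_ball s) g G"
  shows "holo_map scale_pair (*) (domain s) G"
    and "z \<in> domain s \<Longrightarrow> k \<in> int_lattice \<Longrightarrow> G (z + (cvec k, 0)) = G z"
    and "norm (snd x) < s \<Longrightarrow> G (cpair x) = complex_of_real (g x)"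
proof -
  show "holo_map scale_pair (*) (domain s) G"
    using assms holo_map_subset[OF _ domain_subset_interior]
    by (auto simp: holo_ext_def cholomorphic_eq_holo_map)
  show "z \<in> domain s \<Longrightarrow> k \<in> int_lattice \<Longrightarrow> G (z + (cvec k, 0)) = G z"
    using assms domain_subset_strip_ball[of s] cpair_simps(1)[of k 0]
    by (force simp: holo_ext_def phase_lattice_def)
  assume x: "norm (snd x) < s"
  then have "0 < s" using norm_ge_zero le_less_trans by blast
  then have "cpair x \<in> strip_ball s"
    using x by (auto simp: strip_ball_def strip_eq mem_Times_iff)
  then show "G (cpair x) = complex_of_real (g x)"
    using assms unfolding holo_ext_def by blast
qed

lemma holo_ext_open_strip:
  assumes "holo_ext scale_vec cvec int_lattice (strip s) g G" "0 < s"
  shows "holo_map scale_vec (*) (open_strip s) G" "G (cvec x) = complex_of_real (g x)"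
proof -
  show "holo_map scale_vec (*) (open_strip s) G"
    using assms holo_map_subset[OF _ open_strip_subset_interior]
    by (auto simp: holo_ext_def cholomorphic_eq_holo_map)
  show "G (cvec x) = complex_of_real (g x)"
    using assms by (auto simp: holo_ext_def strip_eq)
qed

text \<open>The infimum in the definition of the norm need not be attained, hence the error \<open>e\<close>.\<close>

lemma ext_norm_component:
  assumes le: "ext_norm sc \<iota> L D g \<le> ennreal c" and c: "0 \<le> c" and b: "b \<in> Basis" and e: "0 < e"
  obtains G where "holo_ext sc \<iota> L D (\<lambda>x. g x \<bullet> b) G" "\<And>z. z \<in> D \<Longrightarrow> cmod (G z) \<le> c + e"
proof -
  have "(INF G\<in>{G. holo_ext sc \<iota> L D (\<lambda>x. g x \<bullet> b) G}. SUP z\<in>D. ennreal (cmod (G z))) \<le> ext_norm sc \<iota> L D g"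
    unfolding ext_norm_def by (rule SUP_upper[OF b])
  also have "\<dots> < ennreal (c + e)"
    using le c e by (auto intro: le_less_trans simp: ennreal_less_iff)
  finally obtain G where G: "holo_ext sc \<iota> L D (\<lambda>x. g x \<bullet> b) G" "(SUP z\<in>D. ennreal (cmod (G z))) < ennreal (c + e)"
    by (auto simp: INF_less_iff)
  have "cmod (G z) \<le> c + e" if "z \<in> D" for z
  proof -
    have "ennreal (cmod (G z)) \<le> ennreal (c + e)"
      using SUP_upper[OF that, of "\<lambda>z. ennreal (cmod (G z))"] G(2) by (meson le_less_trans less_imp_le)
    then show ?thesis using c e ennreal_le_iff[of "c + e" "cmod (G z)"] by linarith
  qed
  with G(1) show ?thesis using that by blast
qed

lemma ext_norm_le:
  fixes g :: "'r \<Rightarrow> 'b::euclidean_space"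
  assumes "\<And>b. b \<in> Basis \<Longrightarrow> \<exists>G. holo_ext sc \<iota> L D (\<lambda>x. g x \<bullet> b) G \<and> (\<forall>z\<in>D. cmod (G z) \<le> c)"
  shows "ext_norm sc \<iota> L D g \<le> ennreal c"
  unfolding ext_norm_def
proof (rule SUP_least)
  fix b :: 'b assume "b \<in> Basis"
  from assms[OF this] obtain G where G: "holo_ext sc \<iota> L D (\<lambda>x. g x \<bullet> b) G" "\<forall>z\<in>D. cmod (G z) \<le> c"
    by blast
  then show "(INF G\<in>{G. holo_ext sc \<iota> L D (\<lambda>x. g x \<bullet> b) G}. SUP z\<in>D. ennreal (cmod (G z))) \<le> ennreal c"
    by (intro INF_lower2[of G] SUP_least) (auto intro: ennreal_leI)
qed

text \<open>By the identity principle, any holomorphic extension to the open strip agrees with the ones that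
  define the norm. The same holds on the complexified phase space.\<close>

lemma torus_norm_bound:
  assumes "torus_norm s g \<le> ennreal c" "0 \<le> c" "b \<in> Basis" "0 < s"
    and F: "holo_map scale_vec (*) (open_strip s) F" "\<And>x. F (cvec x) = complex_of_real (g x \<bullet> b)"
    and q: "q \<in> open_strip s"
  shows "cmod (F q) \<le> c"
proof (rule field_le_epsilon)
  fix e :: real assume "0 < e"
  then obtain G where G: "holo_ext scale_vec cvec int_lattice (strip s) (\<lambda>x. g x \<bullet> b) G"
    "\<And>z. z \<in> strip s \<Longrightarrow> cmod (G z) \<le> c + e"
    using assms(1-3) unfolding torus_norm_def by (metis ext_norm_component)
  have "F q = G q"
    by (rule open_strip_identity[OF F(1) holo_ext_open_strip(1)[OF G(1) assms(4)] assms(4) _ q])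
      (simp add: F(2) holo_ext_open_strip(2)[OF G(1) assms(4)])
  then show "cmod (F q) \<le> c + e" using G(2) q open_strip_subset_strip by auto
qed

lemma phase_norm_bound:
  assumes "phase_norm s g \<le> ennreal c" "0 \<le> c" "b \<in> Basis" "0 < s"
    and F: "holo_map scale_pair (*) (domain s) F" "\<And>x. norm (snd x) < s \<Longrightarrow> F (cpair x) = complex_of_real (g x \<bullet> b)"
    and z: "z \<in> domain s"
  shows "cmod (F z) \<le> c"
proof (rule field_le_epsilon)
  fix e :: real assume "0 < e"
  then obtain G where G: "holo_ext scale_pair cpair phase_lattice (strip_ball s) (\<lambda>x. g x \<bullet> b) G"
    "\<And>z. z \<in> strip_ball s \<Longrightarrow> cmod (G z) \<le> c + e"
    using assms(1-3) unfolding phase_norm_def by (metis ext_norm_component)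
  have "F z = G z"
    by (rule domain_identity[OF F(1) holo_ext_domain(1)[OF G(1)] assms(4) _ z])
      (simp add: F(2) holo_ext_domain(3)[OF G(1)])
  then show "cmod (F z) \<le> c + e"
    using G(2)[OF subsetD[OF domain_subset_strip_ball z]] by simp
qed

text \<open>The coordinates of the complexified phase space that extend the real coordinates; they reduce
  statements about components to the vector valued extension.\<close>

lemma phase_basis_projection:
  assumes "b \<in> (Basis :: 'n::finite phase set)"
  obtains \<pi> where "bounded_linear \<pi>" "\<And>c z. \<pi> (scale_pair c z) = c * \<pi> z"
    "\<And>x. \<pi> (cpair x) = complex_of_real (x \<bullet> b)" "\<And>z. cmod (\<pi> z) \<le> norm z"
proof -
  obtain k where "b = (axis k 1, 0) \<or> b = (0, axis k 1)"
    using assms by (auto simp: Basis_prod_def Basis_vec_def)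
  then show ?thesis
  proof
    assume b: "b = (axis k 1, 0)"
    show ?thesis
    proof (rule that[of "\<lambda>z. fst z $ k"])
      show "bounded_linear (\<lambda>z :: 'n cphase. fst z $ k)"
        by (rule bounded_linear_compose[OF bounded_linear_vec_nth bounded_linear_fst])
      show "cmod (fst z $ k) \<le> norm z" for z :: "'n cphase"
        using Finite_Cartesian_Product.norm_nth_le[of "fst z" k] norm_fst_le[of "fst z" "snd z"] by simp
    qed (auto simp: b inner_prod_def inner_axis)
  next
    assume b: "b = (0, axis k 1)"
    show ?thesis
    proof (rule that[of "\<lambda>z. snd z $ k"])
      show "bounded_linear (\<lambda>z :: 'n cphase. snd z $ k)"
        by (rule bounded_linear_compose[OF bounded_linear_vec_nth bounded_linear_snd])
      show "cmod (snd z $ k) \<le> norm z" for z :: "'n cphase"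
        using Finite_Cartesian_Product.norm_nth_le[of "snd z" k] norm_snd_le[of "snd z" "fst z"] by simp
    qed (auto simp: b inner_prod_def inner_axis)
  qed
qed

lemma ext_norm_le_of_extension:
  fixes X :: "'r \<Rightarrow> 'n::finite phase"
  assumes E: "holo_map sc scale_pair U E" and D: "D \<subseteq> U"
    and per: "\<And>z k. z \<in> D \<Longrightarrow> k \<in> K \<Longrightarrow> E (z + \<iota> k) = E z"
    and real: "\<And>x. \<iota> x \<in> D \<Longrightarrow> E (\<iota> x) = cpair (X x)"
    and bound: "\<And>z. z \<in> D \<Longrightarrow> norm (E z) \<le> c"
  shows "ext_norm sc \<iota> K D X \<le> ennreal c"
proof (rule ext_norm_le)
  fix b :: "'n phase" assume "b \<in> Basis"
  then obtain \<pi> where \<pi>: "bounded_linear \<pi>" "\<And>c z. \<pi> (scale_pair c z) = c * \<pi> z"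
    "\<And>x. \<pi> (cpair x) = complex_of_real (x \<bullet> b)" "\<And>z. cmod (\<pi> z) \<le> norm z"
    using phase_basis_projection by blast
  have h: "holo_map sc (*) U (\<lambda>z. \<pi> (E z))"
    by (rule holo_map_compose[OF E holo_map_bounded_linear[OF \<pi>(1), where U = UNIV]]) (use \<pi>(2) in auto)
  have bd: "cmod (\<pi> (E z)) \<le> c" if "z \<in> D" for z
    using \<pi>(4)[of "E z"] bound[OF that] by linarith
  have "holo_ext sc \<iota> K D (\<lambda>x. X x \<bullet> b) (\<lambda>z. \<pi> (E z))"
    unfolding holo_ext_def cholomorphic_eq_holo_map
  proof (intro conjI ballI allI impI)
    show "continuous_on D (\<lambda>z. \<pi> (E z))"
      by (rule continuous_on_subset[OF holo_map_continuous[OF h] D])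
    show "bounded ((\<lambda>z. \<pi> (E z)) ` D)" unfolding bounded_iff using bd by blast
    show "holo_map sc (*) (interior D) (\<lambda>z. \<pi> (E z))"
      using holo_map_subset[OF h] D interior_subset by blast
  qed (simp_all add: per real \<pi>(3))
  with bd show "\<exists>G. holo_ext sc \<iota> K D (\<lambda>x. X x \<bullet> b) G \<and> (\<forall>z\<in>D. cmod (G z) \<le> c)"
    by blast
qed

lemma phase_norm_le:
  fixes X :: "'n::finite phase \<Rightarrow> 'n phase"
  assumes s: "s < s'" and E: "holo_map scale_pair scale_pair (domain s') E"
    and per: "\<And>z k. z \<in> domain s' \<Longrightarrow> k \<in> int_lattice \<Longrightarrow> E (z + (cvec k, 0)) = E z"
    and real: "\<And>x. norm (snd x) < s' \<Longrightarrow> E (cpair x) = cpair (X x)"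
    and bound: "\<And>z. z \<in> strip_ball s \<Longrightarrow> norm (E z) \<le> c"
  shows "phase_norm s X \<le> ennreal c"
  unfolding phase_norm_def
proof (rule ext_norm_le_of_extension[OF E strip_ball_subset_domain[OF s] _ _ bound])
  show "E (z + cpair k) = E z" if "z \<in> strip_ball s" "k \<in> phase_lattice" for z k
    using that per[of z "fst k"] strip_ball_subset_domain[OF s] by (auto simp: phase_lattice_def)
  show "E (cpair x) = cpair (X x)" if "cpair x \<in> strip_ball s" for x
  proof -
    have "norm (snd x) \<le> s" using that by (auto simp: strip_ball_def mem_Times_iff simp del: cpair_simps(1))
    then show ?thesis using s real[of x] by simp
  qed
qed

lemma torus_norm_le:
  fixes w :: "real ^ 'n \<Rightarrow> 'n::finite phase"
  assumes s: "s < s'" and E: "holo_map scale_vec scale_pair (open_strip s') E"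
    and per: "\<And>q k. q \<in> open_strip s' \<Longrightarrow> k \<in> int_lattice \<Longrightarrow> E (q + cvec k) = E q"
    and real: "\<And>x. E (cvec x) = cpair (w x)"
    and bound: "\<And>q. q \<in> strip s \<Longrightarrow> norm (E q) \<le> c"
  shows "torus_norm s w \<le> ennreal c"
  unfolding torus_norm_def
  by (rule ext_norm_le_of_extension[OF E strip_subset_open_strip[OF s] _ real bound])
    (use per strip_subset_open_strip[OF s] in auto)

lemma grad_unique:
  assumes "GDERIV g x :> D"
  shows "grad g x = D"
  unfolding grad_def
proof (rule the_equality)
  show "GDERIV g x :> D" by (rule assms)
  fix D' assume "GDERIV g x :> D'"
  then have "(\<lambda>h. h \<bullet> D') = (\<lambda>h. h \<bullet> D)"
    using assms unfolding gderiv_def by (rule has_derivative_unique)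
  then show "D' = D" using vector_eq_ldot by (metis fun_cong)
qed

lemma grad_eq:
  fixes g :: "real ^ 'n \<Rightarrow> real"
  assumes "(g has_derivative g') (at x)"
  shows "grad g x = (\<chi> k. g' (axis k 1))" "GDERIV g x :> (\<chi> k. g' (axis k 1))"
proof -
  have lin: "linear g'" using assms has_derivative_bounded_linear bounded_linear.linear by blast
  have "g' h = h \<bullet> (\<chi> k. g' (axis k 1))" for h
  proof -
    have "g' h = g' (\<Sum>k\<in>UNIV. h $ k *\<^sub>R axis k 1)"
      using basis_expansion[of h] by (simp add: scalar_mult_eq_scaleR)
    then show ?thesis
      by (simp add: linear_sum[OF lin] linear_scale[OF lin] inner_vec_def)
  qed
  then have "g' = (\<lambda>h. h \<bullet> (\<chi> k. g' (axis k 1)))" by (rule ext)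
  then show D: "GDERIV g x :> (\<chi> k. g' (axis k 1))"
    using assms unfolding gderiv_def by metis
  show "grad g x = (\<chi> k. g' (axis k 1))" by (rule grad_unique[OF D])
qed

text \<open>Gradients depend only on the germ of the function, whether or not it is differentiable.\<close>

lemma grad_cong:
  assumes "open U" "x \<in> U" "\<And>y. y \<in> U \<Longrightarrow> f y = g y"
  shows "grad f x = grad g x"
proof -
  have "(f has_derivative D) (at x) \<longleftrightarrow> (g has_derivative D) (at x)" for D
    using has_derivative_transform_within_open[OF _ assms(1,2), of f D UNIV g]
      has_derivative_transform_within_open[OF _ assms(1,2), of g D UNIV f] assms(3) by auto
  then show ?thesis by (simp add: grad_def gderiv_def)
qed

lemma grad_shift: "grad g (x + k) = grad (\<lambda>q. g (q + k)) x"
proof -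
  have "(g has_derivative D) (at (x + k)) \<longleftrightarrow> ((\<lambda>q. g (q + k)) has_derivative D) (at x)" for D
  proof
    assume "(g has_derivative D) (at (x + k))"
    from has_derivative_compose[OF has_derivative_add[OF has_derivative_ident has_derivative_const] this]
    show "((\<lambda>q. g (q + k)) has_derivative D) (at x)" by simp
  next
    assume "((\<lambda>q. g (q + k)) has_derivative D) (at x)"
    then have "((\<lambda>q. g (q + k)) has_derivative D) (at ((x + k) + (- k)))" by simp
    from has_derivative_compose[OF has_derivative_add[OF has_derivative_ident has_derivative_const] this]
    show "(g has_derivative D) (at (x + k))" by simp
  qed
  then show ?thesis by (simp add: grad_def gderiv_def)
qed

lemma partial_gradients:
  assumes "(g has_derivative g') (at x)"
  shows "grad_q g x $ k = g' (axis k 1, 0)" "grad_p g x $ k = g' (0, axis k 1)"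
    and "GDERIV (\<lambda>p. g (fst x, p)) (snd x) :> grad_p g x"
proof -
  have D: "(g has_derivative g') (at (fst x, snd x))" using assms by simp
  have "((\<lambda>q. (q, snd x)) has_derivative (\<lambda>v. (v, 0))) (at (fst x))"
    by (auto intro!: derivative_eq_intros)
  from grad_eq(1)[OF has_derivative_compose[OF this D]] show "grad_q g x $ k = g' (axis k 1, 0)"
    by (simp add: grad_q_def)
  have "((\<lambda>p. (fst x, p)) has_derivative (\<lambda>v. (0, v))) (at (snd x))"
    by (auto intro!: derivative_eq_intros)
  note d = has_derivative_compose[OF this D]
  from grad_eq(1)[OF d] show "grad_p g x $ k = g' (0, axis k 1)"
    by (simp add: grad_p_def)
  show "GDERIV (\<lambda>p. g (fst x, p)) (snd x) :> grad_p g x"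
    using grad_eq[OF d] by (simp add: grad_p_def)
qed

lemma extension_gradients:
  assumes G: "holo_map scale_pair (*) W G" and U: "open U" "x \<in> U"
    and W: "\<And>y. y \<in> U \<Longrightarrow> cpair y \<in> W" and eq: "\<And>y. y \<in> U \<Longrightarrow> G (cpair y) = complex_of_real (g y)"
  shows "(g has_derivative (\<lambda>v. Re (fd G (cpair x) (cpair v)))) (at x)"
    and "fd G (cpair x) (dp k) = complex_of_real (grad_p g x $ k)"
    and "fd G (cpair x) (dq k) = complex_of_real (grad_q g x $ k)"
proof -
  note d = real_derivative_of_extension[OF bounded_linear_cpair holo_map_derivative(1)[OF G W[OF U(2)]] U eq]
  show *: "(g has_derivative (\<lambda>v. Re (fd G (cpair x) (cpair v)))) (at x)" by (rule d(1))
  show "fd G (cpair x) (dp k) = complex_of_real (grad_p g x $ k)"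
    using partial_gradients(2)[OF *, of k] d(2)[of "(0, axis k 1)"]
    by (simp add: axis_cpair del: cpair_simps(1))
  show "fd G (cpair x) (dq k) = complex_of_real (grad_q g x $ k)"
    using partial_gradients(1)[OF *, of k] d(2)[of "(axis k 1, 0)"]
    by (simp add: axis_cpair del: cpair_simps(1))
qed

lemma open_phase_space: "open (phase_space R)"
  unfolding phase_space_def by (intro open_Times) auto

lemma real_analyticD:
  fixes g :: "'n::finite phase \<Rightarrow> real"
  assumes "real_analytic scale_pair cpair (phase_space R) g" "x \<in> phase_space R"
  shows "\<exists>W G. open W \<and> cpair x \<in> W \<and> holo_map scale_pair (*) W G \<and>
    (\<forall>y. y \<in> phase_space R \<longrightarrow> cpair y \<in> W \<longrightarrow> G (cpair y) = complex_of_real (g y))"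
proof -
  obtain W G where "open W \<and> cpair x \<in> W \<and> cholomorphic scale_pair W G \<and>
     (\<forall>y\<in>phase_space R. cpair y \<in> W \<longrightarrow> G (cpair y) = complex_of_real (g y \<bullet> 1))"
    using assms unfolding real_analytic_def by (metis Basis_real_def insertI1)
  then show ?thesis by (intro exI[of _ W] exI[of _ G]) (auto simp: cholomorphic_eq_holo_map)
qed

lemma phase_Basis_cases:
  assumes "b \<in> (Basis :: 'n::finite phase set)"
  obtains k where "b = (axis k 1, 0)" | k where "b = (0, axis k 1)"
  using assms by (auto simp: Basis_prod_def Basis_vec_def)

lemma real_analytic_ham_vf:
  fixes H :: "real \<Rightarrow> 'n::finite phase \<Rightarrow> real"
  assumes H: "real_analytic scale_pair cpair (phase_space R) (H t)"
  shows "real_analytic scale_pair cpair (phase_space R) (ham_vf H t)"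
    and "x \<in> phase_space R \<Longrightarrow> \<exists>D. (H t has_derivative D) (at x)"
proof -
  have *: "\<exists>W G. open W \<and> cpair x \<in> W \<and> holo_map scale_pair (*) W G \<and>
      (\<forall>y\<in>phase_space R. cpair y \<in> W \<longrightarrow> (\<exists>D. (H t has_derivative D) (at y)) \<and>
        (\<forall>k. fd G (cpair y) (dp k) = of_real (grad_p (H t) y $ k) \<and> fd G (cpair y) (dq k) = of_real (grad_q (H t) y $ k)))"
    if xR: "x \<in> phase_space R" for x
  proof -
    obtain W G where G: "open W" "cpair x \<in> W" "holo_map scale_pair (*) W G"
      "\<And>y. y \<in> phase_space R \<Longrightarrow> cpair y \<in> W \<Longrightarrow> G (cpair y) = complex_of_real (H t y)"
      using real_analyticD[OF H xR] by blast
    have "open (cpair -` W)"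
      using open_vimage[OF G(1) linear_continuous_on[OF bounded_linear_cpair]] by blast
    then have oU: "open (phase_space R \<inter> cpair -` W)" by (intro open_Int open_phase_space)
    have "(\<exists>D. (H t has_derivative D) (at y)) \<and> (\<forall>k. fd G (cpair y) (dp k) = of_real (grad_p (H t) y $ k)
        \<and> fd G (cpair y) (dq k) = of_real (grad_q (H t) y $ k))"
      if y: "y \<in> phase_space R" "cpair y \<in> W" for y
    proof -
      have yU: "y \<in> phase_space R \<inter> cpair -` W" using y by simp
      have "(H t has_derivative (\<lambda>v. Re (fd G (cpair y) (cpair v)))) (at y)"
        by (rule extension_gradients(1)[OF G(3) oU yU]) (use G(4) in auto)
      moreover have "fd G (cpair y) (dp k) = of_real (grad_p (H t) y $ k)" for k
        by (rule extension_gradients(2)[OF G(3) oU yU]) (use G(4) in auto)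
      moreover have "fd G (cpair y) (dq k) = of_real (grad_q (H t) y $ k)" for k
        by (rule extension_gradients(3)[OF G(3) oU yU]) (use G(4) in auto)
      ultimately show ?thesis by blast
    qed
    with G(1-3) show ?thesis by blast
  qed
  then show "x \<in> phase_space R \<Longrightarrow> \<exists>D. (H t has_derivative D) (at x)" by blast
  show "real_analytic scale_pair cpair (phase_space R) (ham_vf H t)"
    unfolding real_analytic_def
  proof (intro ballI)
    fix b :: "'n phase" and x :: "'n phase" assume b: "b \<in> Basis" and x: "x \<in> phase_space R"
    obtain W G where G: "open W" "cpair x \<in> W" "holo_map scale_pair (*) W G"
      "\<And>y k. y \<in> phase_space R \<Longrightarrow> cpair y \<in> W \<Longrightarrow> fd G (cpair y) (dp k) = of_real (grad_p (H t) y $ k)"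
      "\<And>y k. y \<in> phase_space R \<Longrightarrow> cpair y \<in> W \<Longrightarrow> fd G (cpair y) (dq k) = of_real (grad_q (H t) y $ k)"
      using *[OF x] by blast
    note h = PC.holo_map_fd[OF G(3,1)]
    from b show "\<exists>W G. open W \<and> cpair x \<in> W \<and> cholomorphic scale_pair W G \<and>
        (\<forall>y\<in>phase_space R. cpair y \<in> W \<longrightarrow> G (cpair y) = complex_of_real (ham_vf H t y \<bullet> b))"
    proof (cases rule: phase_Basis_cases)
      case (1 k)
      show ?thesis unfolding cholomorphic_eq_holo_map
        by (intro exI[of _ W] exI[of _ "\<lambda>z. fd G z (dp k)"] conjI G h)
          (auto simp: G 1 ham_vf_def inner_axis)
    next
      case (2 k)
      show ?thesis unfolding cholomorphic_eq_holo_map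
        by (intro exI[of _ W] exI[of _ "\<lambda>z. - fd G z (dq k)"] conjI G PC.holo_map_minus h)
          (auto simp: G 2 ham_vf_def inner_axis)
    qed
  qed
qed

text \<open>Periodicity is assumed only over the ball, an open set, which is enough to differentiate it.\<close>

lemma periodic_ham_vf:
  assumes "periodic_on_phase R (H t)"
  shows "periodic_on_phase R (ham_vf H t)"
  unfolding periodic_on_phase_def
proof (intro ballI)
  fix z k :: "'a phase" assume z: "z \<in> phase_space R" and k: "k \<in> phase_lattice"
  have k0: "snd k = 0" "(fst k, 0) = k" using k by (auto simp: phase_lattice_def)
  have per: "H t (q + fst k, p) = H t (q, p)" if "norm p < R" for q p
    using assms k k0(2) that unfolding periodic_on_phase_def phase_space_def
    by (metis add.right_neutral add_Pair mem_ball_0 mem_Times_iff fst_conv snd_conv UNIV_I)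
  have zR: "norm (snd z) < R" using z by (auto simp: phase_space_def)
  have "grad_p (H t) (z + k) = grad_p (H t) z"
    unfolding grad_p_def by (simp add: k0) (rule grad_cong[of "ball 0 R"]; use per zR in auto)
  moreover have "grad_q (H t) (z + k) = grad_q (H t) z"
    unfolding grad_q_def by (simp add: k0 grad_shift) (rule grad_cong[of UNIV]; use per zR in auto)
  ultimately show "ham_vf H t (z + k) = ham_vf H t z" by (simp add: ham_vf_def)
qed

lemma analytic_on_phase_ham_vf:
  "analytic_on_phase R (H t) \<Longrightarrow> analytic_on_phase R (ham_vf H t)"
  using real_analytic_ham_vf(1) periodic_ham_vf by (auto simp: analytic_on_phase_def)

definition re_pair :: "'n::finite cphase \<Rightarrow> 'n phase" where
  "re_pair z = (re_vec (fst z), re_vec (snd z))"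

lemma re_pair_cpair [simp]: "re_pair (cpair x) = x"
  by (simp add: re_pair_def prod_eq_iff)

lemma bounded_linear_re_pair: "bounded_linear re_pair"
  unfolding re_pair_def
  by (intro bounded_linear_Pair bounded_linear_compose[OF bounded_linear_re_vec] bounded_linear_fst bounded_linear_snd)

lemma cpair_inject: "cpair x = cpair y \<Longrightarrow> x = y"
  by (metis re_pair_cpair)

lemma csymp_cpair: "csymp (cpair u) (cpair v) = complex_of_real (symp_form u v)"
  by (simp add: csymp_def symp_form_def inner_vec_def sum_subtractf)

text \<open>Tori \<open>x \<mapsto> (x, 0) + w x\<close> close to the zero section. The bound on the derivative of the
  position component makes \<open>x \<mapsto> x + fst (w x)\<close> injective, so that these maps are embeddings.\<close>

locale perturbed_zero_section =
  fixes r R :: real and E :: "complex ^ 'n \<Rightarrow> 'n::finite cphase" and w :: "real ^ 'n \<Rightarrow> 'n phase"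
  assumes r: "0 < r" and E: "holo_map scale_vec scale_pair (open_strip r) E"
    and per: "\<And>q k. q \<in> open_strip r \<Longrightarrow> k \<in> int_lattice \<Longrightarrow> E (q + cvec k) = E q"
    and real: "\<And>x. E (cvec x) = cpair (w x)"
    and momentum: "\<And>x. norm (snd (w x)) < R"
    and contr: "\<And>x v. norm (fst (fd E (cvec x) (cvec v))) \<le> 1 / 2 * norm v"
begin

definition \<phi> :: "real ^ 'n \<Rightarrow> 'n phase" where "\<phi> x = (x, 0) + w x"

lemma derivative_w:
  shows "(w has_derivative (\<lambda>v. re_pair (fd E (cvec x) (cvec v)))) (at x)"
    and "cpair (re_pair (fd E (cvec x) (cvec v))) = fd E (cvec x) (cvec v)"
proof -
  have "cvec x \<in> open_strip r" using r by simp
  note d = has_derivative_compose[OF bounded_linear_imp_has_derivative[OF bounded_linear_cvec] holo_map_derivative(1)[OF E this]]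
  have "((\<lambda>x. re_pair (E (cvec x))) has_derivative (\<lambda>v. re_pair (fd E (cvec x) (cvec v)))) (at x)"
    by (rule bounded_linear.has_derivative[OF bounded_linear_re_pair d])
  then show *: "(w has_derivative (\<lambda>v. re_pair (fd E (cvec x) (cvec v)))) (at x)"
    by (simp add: real)
  have "((\<lambda>x. cpair (w x)) has_derivative (\<lambda>v. cpair (re_pair (fd E (cvec x) (cvec v))))) (at x)"
    by (rule bounded_linear.has_derivative[OF bounded_linear_cpair *])
  moreover have "((\<lambda>x. cpair (w x)) has_derivative (\<lambda>v. fd E (cvec x) (cvec v))) (at x)"
    using d by (simp add: real)
  ultimately have "(\<lambda>v. cpair (re_pair (fd E (cvec x) (cvec v)))) = (\<lambda>v. fd E (cvec x) (cvec v))"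
    by (rule has_derivative_unique)
  then show "cpair (re_pair (fd E (cvec x) (cvec v))) = fd E (cvec x) (cvec v)"
    by (rule fun_cong)
qed

lemma derivative_phi:
  shows "(\<phi> has_derivative (\<lambda>v. (v, 0) + re_pair (fd E (cvec x) (cvec v)))) (at x)"
    and "fd \<phi> x v = (v, 0) + re_pair (fd E (cvec x) (cvec v))"
    and "cpair (fd \<phi> x v) = (cvec v, 0) + fd E (cvec x) (cvec v)"
proof -
  show *: "(\<phi> has_derivative (\<lambda>v. (v, 0) + re_pair (fd E (cvec x) (cvec v)))) (at x)"
    unfolding \<phi>_def[abs_def]
    by (intro has_derivative_add derivative_w(1) has_derivative_Pair has_derivative_ident has_derivative_const)
  show "fd \<phi> x v = (v, 0) + re_pair (fd E (cvec x) (cvec v))"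
    using fd_eq[OF *] by simp
  then show "cpair (fd \<phi> x v) = (cvec v, 0) + fd E (cvec x) (cvec v)"
    by (simp add: cpair_add derivative_w(2))
qed

lemma fst_fd_w_le: "norm (fst (re_pair (fd E (cvec x) (cvec v)))) \<le> 1 / 2 * norm v"
proof -
  have "fst (fd E (cvec x) (cvec v)) = cvec (fst (re_pair (fd E (cvec x) (cvec v))))"
    using derivative_w(2)[of x v] by (metis cpair_simps(2))
  then show ?thesis using contr[of x v] by simp
qed

lemma linear_fd_phi: "linear (fd \<phi> x)"
  using bounded_linear.linear[OF has_derivative_bounded_linear[OF derivative_phi(1)[of x]]]
  by (simp only: fd_eq[OF derivative_phi(1)[of x]])

lemma inj_fd_phi: "inj (fd \<phi> x)"
proof -
  note lin = linear_fd_phi[of x]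
  show ?thesis
  proof (rule linear_injective_0[OF lin, THEN iffD2], intro allI impI)
    fix v assume "fd \<phi> x v = 0"
    then have "v + fst (re_pair (fd E (cvec x) (cvec v))) = 0"
      by (simp add: derivative_phi(2) prod_eq_iff)
    then have "norm v = norm (fst (re_pair (fd E (cvec x) (cvec v))))"
      by (metis add_eq_0_iff norm_minus_cancel)
    then show "v = 0" using fst_fd_w_le[of x v] by simp
  qed
qed

lemma Lipschitz: "norm (fst (w x) - fst (w y)) \<le> 1 / 2 * norm (x - y)"
proof (rule differentiable_bound[of UNIV "\<lambda>x. fst (w x)" "\<lambda>x v. fst (re_pair (fd E (cvec x) (cvec v)))"])
  show "((\<lambda>x. fst (w x)) has_derivative (\<lambda>v. fst (re_pair (fd E (cvec x) (cvec v))))) (at x within UNIV)" for x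
    using has_derivative_fst[OF derivative_w(1)] by simp
  show "onorm (\<lambda>v. fst (re_pair (fd E (cvec x) (cvec v)))) \<le> 1 / 2" for x
    by (rule onorm_le) (rule fst_fd_w_le)
qed auto

lemma w_periodic: "k \<in> int_lattice \<Longrightarrow> w (x + k) = w x"
  using per[of "cvec x" k] r by (intro cpair_inject) (simp add: real cvec_add del: cpair_simps flip: real)

lemma analytic_embedding: "analytic_embedding R \<phi>"
  unfolding analytic_embedding_def
proof (intro conjI allI ballI impI)
  show "inj (fd \<phi> q)" for q by (rule inj_fd_phi)
  show "range \<phi> \<subseteq> phase_space R"
    by (simp add: image_subset_iff \<phi>_def phase_space_def mem_Times_iff momentum)
  show "\<phi> (q + k) - \<phi> q \<in> phase_lattice" if "k \<in> int_lattice" for q k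
    using that w_periodic[OF that] by (simp add: \<phi>_def phase_lattice_def)
  show "q - q' \<in> int_lattice" if "\<phi> q - \<phi> q' \<in> phase_lattice" for q q'
  proof -
    obtain k where k: "k \<in> int_lattice" "\<phi> q - \<phi> q' = (k, 0)"
      using \<open>\<phi> q - \<phi> q' \<in> phase_lattice\<close> by (auto simp: phase_lattice_def)
    then have "q + fst (w q) - (q' + fst (w q')) = k"
      by (simp add: \<phi>_def prod_eq_iff)
    \<comment> \<open>Translating \<open>q'\<close> by \<open>k\<close> reduces injectivity on the torus to injectivity on \<open>R^n\<close>.\<close>
    then have "q - (q' + k) = fst (w (q' + k)) - fst (w q)"
      using w_periodic[OF k(1), of q'] by (simp add: algebra_simps)
    then have "norm (q - (q' + k)) \<le> 1 / 2 * norm (q - (q' + k))"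
      using Lipschitz[of "q' + k" q] by (metis norm_minus_commute)
    then have "q = q' + k" by simp
    then show ?thesis using k(1) by simp
  qed
  show "real_analytic scale_vec cvec UNIV \<phi>"
    unfolding real_analytic_def
  proof (intro ballI)
    fix b :: "'n phase" and x :: "real ^ 'n" assume "b \<in> Basis"
    then obtain \<pi> where \<pi>: "bounded_linear \<pi>" "\<And>c z. \<pi> (scale_pair c z) = c * \<pi> z"
      "\<And>x. \<pi> (cpair x) = complex_of_real (x \<bullet> b)" "\<And>z. cmod (\<pi> z) \<le> norm z"
      using phase_basis_projection by blast
    have "holo_map scale_vec scale_pair (open_strip r) (\<lambda>q. (q, 0) + E q)"
      by (intro VP.holo_map_add E holo_map_Pair VV.holo_map_const holo_map_bounded_linear[OF bounded_linear_ident]) simp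
    then have h: "holo_map scale_vec (*) (open_strip r) (\<lambda>q. \<pi> ((q, 0) + E q))"
      by (rule holo_map_compose[OF _ holo_map_bounded_linear[OF \<pi>(1), where U = UNIV]]) (use \<pi>(2) in auto)
    have "\<pi> ((cvec y, 0) + E (cvec y)) = complex_of_real (\<phi> y \<bullet> b)" for y
    proof -
      have "(cvec y, 0) + E (cvec y) = cpair (\<phi> y)" by (simp add: \<phi>_def real cpair_add)
      then show ?thesis using \<pi>(3) by simp
    qed
    then show "\<exists>W G. open W \<and> cvec x \<in> W \<and> cholomorphic scale_vec W G \<and>
        (\<forall>y\<in>UNIV. cvec y \<in> W \<longrightarrow> G (cvec y) = complex_of_real (\<phi> y \<bullet> b))"
      using h r open_open_strip[of r] unfolding cholomorphic_eq_holo_map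
      by (intro exI[of _ "open_strip r"] exI[of _ "\<lambda>q. \<pi> ((q, 0) + E q)"]) auto
  qed
qed

lemma lagrangian:
  assumes "\<And>x u v. csymp ((cvec u, 0) + fd E (cvec x) (cvec u)) ((cvec v, 0) + fd E (cvec x) (cvec v)) = 0"
  shows "lagrangian_torus \<phi>"
  unfolding lagrangian_torus_def lagrangian_subspace_def
proof (intro allI conjI ballI)
  fix q
  note lin = linear_fd_phi[of q]
  show "subspace (range (fd \<phi> q))"
    by (rule linear_subspace_image[OF lin subspace_UNIV])
  show "dim (range (fd \<phi> q)) = CARD('n)"
    using dim_image_eq[OF lin inj_on_subset[OF inj_fd_phi subset_UNIV], of UNIV] by simp
  fix u v assume "u \<in> range (fd \<phi> q)" "v \<in> range (fd \<phi> q)"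
  then obtain u' v' where uv: "u = fd \<phi> q u'" "v = fd \<phi> q v'" by blast
  have "complex_of_real (symp_form u v) = 0"
    unfolding csymp_cpair[symmetric] uv derivative_phi(3) by (rule assms)
  then show "symp_form u v = 0" by simp
qed

end

section \<open>Reduction to the complexified equation of motion\<close>

lemma holo_map_mult:
  fixes F G :: "'c::euclidean_space \<Rightarrow> complex"
  assumes "holo_map sc (*) U F" "holo_map sc (*) U G"
  shows "holo_map sc (*) U (\<lambda>z. F z * G z)"
    and "z \<in> U \<Longrightarrow> fd (\<lambda>z. F z * G z) z v = F z * fd G z v + fd F z v * G z"
proof -
  have d: "((\<lambda>z. F z * G z) has_derivative (\<lambda>v. F z * fd G z v + fd F z v * G z)) (at z)" if "z \<in> U" for z
    by (rule has_derivative_mult[OF holo_map_derivative(1)[OF assms(1) that] holo_map_derivative(1)[OF assms(2) that]])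
  show "holo_map sc (*) U (\<lambda>z. F z * G z)"
    unfolding holo_map_def
  proof
    fix z assume z: "z \<in> U"
    show "\<exists>F'. ((\<lambda>z. F z * G z) has_derivative F') (at z) \<and> (\<forall>c v. F' (sc c v) = c * F' v)"
      using d[OF z] holo_map_derivative(2)[OF assms(1) z] holo_map_derivative(2)[OF assms(2) z]
      by (intro exI[of _ "\<lambda>v. F z * fd G z v + fd F z v * G z"]) (simp add: algebra_simps)
  qed
  show "z \<in> U \<Longrightarrow> fd (\<lambda>z. F z * G z) z v = F z * fd G z v + fd F z v * G z"
    using fd_eq[OF d] by simp
qed

lemma fd_sum:
  assumes "\<And>i. i \<in> I \<Longrightarrow> holo_map sc sd U (F i)" "z \<in> U"
  shows "fd (\<lambda>z. \<Sum>i\<in>I. F i z) z v = (\<Sum>i\<in>I. fd (F i) z v)"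
  using fd_eq[OF has_derivative_sum[of I F "\<lambda>i. fd (F i) z" "at z"]] holo_map_derivative(1)[OF assms(1) assms(2)]
  by simp

lemma fd_periodic:
  fixes G :: "'n::finite cphase \<Rightarrow> complex"
  assumes G: "holo_map scale_pair (*) V G" and V: "open V" "\<And>z. z \<in> V \<Longrightarrow> z + \<kappa> \<in> V"
    and per: "\<And>z. z \<in> V \<Longrightarrow> G (z + \<kappa>) = G z" and z: "z \<in> V"
  shows "fd G (z + \<kappa>) u = fd G z u"
proof -
  have "fd (\<lambda>z. G (z + \<kappa>)) z = fd G z"
    by (rule fd_cong_open[OF G V(1) z]) (use per in auto)
  moreover have "fd (\<lambda>z. G (z + \<kappa>)) z u = fd G (z + \<kappa>) u"
    by (rule PC.holo_map_shift(2)[OF G _ z]) (rule V(2))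
  ultimately show ?thesis by simp
qed

lemma zero_section_restriction:
  fixes G :: "'n::finite cphase \<Rightarrow> complex"
  assumes G: "holo_map scale_pair (*) (domain s) G" and s: "0 < s"
  shows "holo_map scale_vec (*) (open_strip s) (\<lambda>q. G (q, 0))"
    and "q \<in> open_strip s \<Longrightarrow> fd (\<lambda>q. G (q, 0)) q v = fd G (q, 0) (v, 0)"
proof -
  have e: "holo_map scale_vec scale_pair (open_strip s) (\<lambda>q. (q, 0) :: 'n cphase)"
    by (intro holo_map_Pair VV.holo_map_const holo_map_bounded_linear[OF bounded_linear_ident]) simp
  have d: "q \<in> open_strip s \<Longrightarrow> (q, 0) \<in> domain s" for q :: "complex ^ 'n"
    using s by (simp add: domain_def)
  show "holo_map scale_vec (*) (open_strip s) (\<lambda>q. G (q, 0))"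
    by (rule holo_map_compose[OF e G d])
  have "fd (\<lambda>q. (q, 0) :: 'n cphase) q v = (v, 0)" for q
    by (rule fd_eq[THEN fun_cong]) (auto intro!: derivative_eq_intros)
  then show "q \<in> open_strip s \<Longrightarrow> fd (\<lambda>q. G (q, 0)) q v = fd G (q, 0) (v, 0)"
    using fd_compose[OF e G _ d, of q v] by simp
qed

lemma domain_gradients:
  fixes g :: "'n::finite phase \<Rightarrow> real"
  assumes G: "holo_map scale_pair (*) (domain s) G"
    and eq: "\<And>x. norm (snd x) < s \<Longrightarrow> G (cpair x) = complex_of_real (g x)" and x: "norm (snd x) < s"
  shows "(g has_derivative (\<lambda>v. Re (fd G (cpair x) (cpair v)))) (at x)"
    and "fd G (cpair x) (dp k) = complex_of_real (grad_p g x $ k)"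
    and "fd G (cpair x) (dq k) = complex_of_real (grad_q g x $ k)"
proof -
  have U: "open {x :: 'n phase. norm (snd x) < s}"
    by (intro open_Collect_less continuous_intros)
  have xU: "x \<in> {x. norm (snd x) < s}" using x by simp
  have W: "cpair y \<in> domain s" if "y \<in> {x. norm (snd x) < s}" for y :: "'n phase"
  proof -
    have "0 < s" using that norm_ge_zero le_less_trans by blast
    then show ?thesis using that by (simp add: domain_def mem_Times_iff)
  qed
  show "(g has_derivative (\<lambda>v. Re (fd G (cpair x) (cpair v)))) (at x)"
    by (rule extension_gradients(1)[OF G U xU W]) (use eq in auto)
  show "fd G (cpair x) (dp k) = complex_of_real (grad_p g x $ k)"
    by (rule extension_gradients(2)[OF G U xU W]) (use eq in auto)
  show "fd G (cpair x) (dq k) = complex_of_real (grad_q g x $ k)"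
    by (rule extension_gradients(3)[OF G U xU W]) (use eq in auto)
qed

text \<open>The second derivatives of an extension in the momenta extend the entries of the Hessian; the Hessian
  is the Jacobian of the partial gradient, which is differentiable because its components have
  holomorphic extensions.\<close>

lemma domain_hessian:
  fixes g :: "'n::finite phase \<Rightarrow> real"
  assumes G: "holo_map scale_pair (*) (domain s) G"
    and eq: "\<And>x. norm (snd x) < s \<Longrightarrow> G (cpair x) = complex_of_real (g x)" and x: "norm (snd x) < s"
  shows "fd (\<lambda>z. fd G z (dp j)) (cpair x) (dp k) = complex_of_real (hess_p g x \<bullet> axis j (axis k 1))"
proof -
  have h: "holo_map scale_pair (*) (domain s) (\<lambda>z. fd G z (dp j))" for j
    by (rule PC.holo_map_fd[OF G open_domain])
  have e: "fd G (cpair y) (dp j) = complex_of_real (grad_p g y $ j)" if "norm (snd y) < s" for y j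
    by (rule domain_gradients(2)[OF G _ that]) (rule eq)
  have d: "((\<lambda>y. grad_p g y $ j) has_derivative (\<lambda>v. Re (fd (\<lambda>z. fd G z (dp j)) (cpair x) (cpair v)))) (at (fst x, snd x))" for j
    using domain_gradients(1)[OF h e x, of j] by simp
  have i: "((\<lambda>p. (fst x, p)) has_derivative (\<lambda>v. (0, v))) (at (snd x))"
    by (auto intro!: derivative_eq_intros)
  have "((\<lambda>p. grad_p g (fst x, p)) has_derivative
      (\<lambda>v. \<chi> j. Re (fd (\<lambda>z. fd G z (dp j)) (cpair x) (cpair (0, v))))) (at (snd x))"
    unfolding has_derivative_vec_componentwise using has_derivative_compose[OF i d] by simp
  from fd_eq[OF this] have "hess_p g x $ j $ k = Re (fd (\<lambda>z. fd G z (dp j)) (cpair x) (dp k))"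
    by (simp add: hess_p_def jacobian_def matrix_def axis_cpair del: cpair_simps(1))
  moreover have "fd (\<lambda>z. fd G z (dp j)) (cpair x) (dp k) = complex_of_real (grad_p (\<lambda>y. grad_p g y $ j) x $ k)"
    by (rule domain_gradients(2)[OF h e x])
  ultimately show ?thesis by (simp add: inner_axis)
qed

lemma real_analytic_add_scaled:
  fixes g h :: "'n::finite phase \<Rightarrow> real"
  assumes "real_analytic scale_pair cpair (phase_space R) g" "real_analytic scale_pair cpair (phase_space R) h"
    and eq: "\<And>z. z \<in> phase_space R \<Longrightarrow> u z = g z + c * h z"
  shows "real_analytic scale_pair cpair (phase_space R) u"
  unfolding real_analytic_def
proof (intro ballI)
  fix b :: real and x :: "'n phase" assume b: "b \<in> Basis" and x: "x \<in> phase_space R"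
  obtain V F where F: "open V" "cpair x \<in> V" "holo_map scale_pair (*) V F"
    "\<And>y. y \<in> phase_space R \<Longrightarrow> cpair y \<in> V \<Longrightarrow> F (cpair y) = complex_of_real (g y)"
    using real_analyticD[OF assms(1) x] by blast
  obtain W G where G: "open W" "cpair x \<in> W" "holo_map scale_pair (*) W G"
    "\<And>y. y \<in> phase_space R \<Longrightarrow> cpair y \<in> W \<Longrightarrow> G (cpair y) = complex_of_real (h y)"
    using real_analyticD[OF assms(2) x] by blast
  have "holo_map scale_pair (*) (V \<inter> W) (\<lambda>z. F z + c *\<^sub>R G z)"
    by (intro PC.holo_map_add PC.holo_map_scaleR holo_map_subset[OF F(3)] holo_map_subset[OF G(3)]) auto
  moreover have "F (cpair y) + c *\<^sub>R G (cpair y) = complex_of_real (u y)"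
    if "y \<in> phase_space R" "cpair y \<in> V \<inter> W" for y
    using that F(4)[of y] G(4)[of y] eq[of y] by (simp add: scaleR_conv_of_real)
  ultimately show "\<exists>W G. open W \<and> cpair x \<in> W \<and> cholomorphic scale_pair W G \<and>
      (\<forall>y\<in>phase_space R. cpair y \<in> W \<longrightarrow> G (cpair y) = complex_of_real (u y \<bullet> b))"
    using F(1,2) G(1,2) b unfolding cholomorphic_eq_holo_map
    by (intro exI[of _ "V \<inter> W"] exI[of _ "\<lambda>z. F z + c *\<^sub>R G z"]) auto
qed

text \<open>The data of the theorem, with holomorphic extensions \<open>Fh\<close> and \<open>Ff\<close> of \<open>h\<close> and \<open>f\<close>.\<close>

locale kam_problem = A: decaying a + B: decaying b
  for a b :: "real \<Rightarrow> real" +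
  fixes \<upsilon> \<Lambda> s R :: real and \<omega> :: "real ^ 'n" and H h f :: "real \<Rightarrow> 'n::finite phase \<Rightarrow> real"
    and Fh Ff :: "real \<Rightarrow> 'n cphase \<Rightarrow> complex"
  assumes s: "0 < s" and sR: "s < R" and \<upsilon>: "0 \<le> \<upsilon>"
    and tail_a_le: "\<upsilon> \<le> t \<Longrightarrow> tail a t \<le> \<Lambda> * b t"
    and tail_a_b_le: "\<upsilon> \<le> t \<Longrightarrow> tail a t * b t \<le> \<Lambda> * a t * tail b t"
    and H_eq: "0 \<le> t \<Longrightarrow> z \<in> phase_space R \<Longrightarrow> H t z = h t z + f t z"
    and h_nf: "h \<in> kolmogorov_nf R \<omega>"
    and h_analytic: "0 \<le> t \<Longrightarrow> analytic_on_phase R (h t)" and f_analytic: "0 \<le> t \<Longrightarrow> analytic_on_phase R (f t)"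
    and Fh_cont: "continuous_on ({0..} \<times> strip_ball s) (\<lambda>(t, z). Fh t z)"
    and Ff_cont: "continuous_on ({0..} \<times> strip_ball s) (\<lambda>(t, z). Ff t z)"
    and Fh_ext: "0 \<le> t \<Longrightarrow> holo_ext scale_pair cpair phase_lattice (strip_ball s) (h t) (Fh t)"
    and Ff_ext: "0 \<le> t \<Longrightarrow> holo_ext scale_pair cpair phase_lattice (strip_ball s) (f t) (Ff t)"
    and hess: "(SUP t\<in>{0..}. phase_norm s (hess_p (H t))) < \<infinity>"
    and f_q: "0 \<le> t \<Longrightarrow> torus_norm s (\<lambda>q. grad_q (f t) (q, 0)) \<le> ennreal (a t)"
    and f_p: "0 \<le> t \<Longrightarrow> torus_norm s (\<lambda>q. grad_p (f t) (q, 0)) \<le> ennreal (b t)"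
begin

definition Hc :: "real \<Rightarrow> 'n cphase \<Rightarrow> complex" where "Hc t z = Fh t z + Ff t z"

lemma holo_Fh: "0 \<le> t \<Longrightarrow> holo_map scale_pair (*) (domain s) (Fh t)"
  and holo_Ff: "0 \<le> t \<Longrightarrow> holo_map scale_pair (*) (domain s) (Ff t)"
  by (rule holo_ext_domain(1)[OF Fh_ext] holo_ext_domain(1)[OF Ff_ext]; assumption)+

lemma Fh_real: "0 \<le> t \<Longrightarrow> norm (snd x) < s \<Longrightarrow> Fh t (cpair x) = complex_of_real (h t x)"
  and Ff_real: "0 \<le> t \<Longrightarrow> norm (snd x) < s \<Longrightarrow> Ff t (cpair x) = complex_of_real (f t x)"
  by (rule holo_ext_domain(3)[OF Fh_ext] holo_ext_domain(3)[OF Ff_ext]; assumption)+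

lemma cpair_zero_section: "(cvec x, 0) = cpair (x, 0)"
  by simp

text \<open>The normal form is a statement about real \<open>q\<close>; it extends to the strip by the identity principle.\<close>

lemma h_zero_section:
  assumes t: "0 \<le> t" and q: "q \<in> open_strip s"
  shows "fd (Fh t) (q, 0) (dp k) = complex_of_real (\<omega> $ k)" "fd (Fh t) (q, 0) (dq k) = 0"
proof -
  obtain c where c: "\<And>q. h t (q, 0) = c" "\<And>q. GDERIV (\<lambda>p. h t (q, p)) 0 :> \<omega>"
    using h_nf t by (auto simp: kolmogorov_nf_def)
  have gr: "grad_p (h t) (x, 0) = \<omega>" "grad_q (h t) (x, 0) = 0" for x
    using grad_unique[OF c(2)] grad_unique[OF GDERIV_const, of c x] by (simp_all add: grad_p_def grad_q_def c(1))
  have x0: "norm (snd (x :: real ^ 'n, 0 :: real ^ 'n)) < s" for x using s by simp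
  note e = domain_gradients(2,3)[OF holo_Fh[OF t] Fh_real[OF t] x0]
  note hol = zero_section_restriction(1)[OF PC.holo_map_fd[OF holo_Fh[OF t] open_domain] s]
  show "fd (Fh t) (q, 0) (dp k) = complex_of_real (\<omega> $ k)"
    by (rule open_strip_identity[OF hol VC.holo_map_const s _ q])
      (simp only: cpair_zero_section e(1) gr)
  show "fd (Fh t) (q, 0) (dq k) = 0"
    by (rule open_strip_identity[OF hol VC.holo_map_const s _ q])
      (simp only: cpair_zero_section e(2) gr zero_index of_real_0)
qed

lemma f_zero_section:
  assumes t: "0 \<le> t" and q: "q \<in> open_strip s"
  shows "cmod (fd (Ff t) (q, 0) (dp k)) \<le> b t" "cmod (fd (Ff t) (q, 0) (dq k)) \<le> a t"
proof -
  have x0: "norm (snd (x :: real ^ 'n, 0 :: real ^ 'n)) < s" for x using s by simp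
  note e = domain_gradients(2,3)[OF holo_Ff[OF t] Ff_real[OF t] x0]
  note hol = zero_section_restriction(1)[OF PC.holo_map_fd[OF holo_Ff[OF t] open_domain] s]
  have ax: "axis k (1 :: real) \<in> Basis" by (simp add: axis_in_Basis_iff)
  show "cmod (fd (Ff t) (q, 0) (dp k)) \<le> b t"
    by (rule torus_norm_bound[OF f_p[OF t] less_imp_le[OF B.pos[OF t]] ax s hol _ q])
      (simp only: cpair_zero_section e(1) inner_axis inner_real_def mult_1_right)
  show "cmod (fd (Ff t) (q, 0) (dq k)) \<le> a t"
    by (rule torus_norm_bound[OF f_q[OF t] less_imp_le[OF A.pos[OF t]] ax s hol _ q])
      (simp only: cpair_zero_section e(2) inner_axis inner_real_def mult_1_right)
qed

lemma holo_Hc: "0 \<le> t \<Longrightarrow> holo_map scale_pair (*) (domain s) (Hc t)"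
  unfolding Hc_def[abs_def] by (rule PC.holo_map_add[OF holo_Fh holo_Ff])

lemma in_phase_space: "norm (snd x) < s \<Longrightarrow> x \<in> phase_space R"
  using sR by (auto simp: phase_space_def mem_Times_iff)

lemma Hc_real: "0 \<le> t \<Longrightarrow> norm (snd x) < s \<Longrightarrow> Hc t (cpair x) = complex_of_real (H t x)"
  using Fh_real[of t x] Ff_real[of t x] H_eq[of t x] in_phase_space[of x] by (simp add: Hc_def)

definition "M = enn2real (SUP t\<in>{0..}. phase_norm s (hess_p (H t)))"

lemma hessian_bound:
  assumes t: "0 \<le> t" and z: "z \<in> domain s"
  shows "cmod (fd (\<lambda>z. fd (Hc t) z (dp j)) z (dp k)) \<le> M"
proof (rule phase_norm_bound[OF _ _ _ s _ _ z])
  show "phase_norm s (hess_p (H t)) \<le> ennreal M"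
    using SUP_upper[of t "{0..}" "\<lambda>t. phase_norm s (hess_p (H t))"] t hess
    by (simp add: M_def infinity_ennreal_def)
  show "0 \<le> M" by (simp add: M_def)
  show "axis j (axis k (1 :: real)) \<in> Basis" by (simp add: axis_in_Basis_iff)
  show "holo_map scale_pair (*) (domain s) (\<lambda>z. fd (\<lambda>z. fd (Hc t) z (dp j)) z (dp k))"
    by (intro PC.holo_map_fd holo_Hc t open_domain)
  show "fd (\<lambda>z. fd (Hc t) z (dp j)) (cpair x) (dp k) = complex_of_real (hess_p (H t) x \<bullet> axis j (axis k 1))"
    if "norm (snd x) < s" for x
    by (rule domain_hessian[OF holo_Hc[OF t] Hc_real[OF t] that])
qed

sublocale CH: complex_hamiltonian a b \<upsilon> "max 1 \<Lambda>" s M "real CARD('n)" \<omega> Hc H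
proof (unfold_locales; (fact \<upsilon> s)?)
  show "1 \<le> max 1 \<Lambda>" by simp
  show "0 \<le> M" by (simp add: M_def)
  show "real CARD('n) = real CARD('n)" ..
  show "continuous_on ({0..} \<times> domain s) (\<lambda>(t, z). Hc t z)"
    using continuous_on_add[OF continuous_on_subset[OF Fh_cont] continuous_on_subset[OF Ff_cont], of "{0..} \<times> domain s"]
      domain_subset_strip_ball[of s]
    by (auto simp: Hc_def case_prod_unfold)
  fix t :: real
  { assume t: "\<upsilon> \<le> t"
    then have t0: "0 \<le> t" using \<upsilon> by simp
    have "tail a t \<le> \<Lambda> * b t" by (rule tail_a_le[OF t])
    also have "\<dots> \<le> max 1 \<Lambda> * b t" using B.pos[OF t0] by (intro mult_right_mono) auto
    finally show "tail a t \<le> max 1 \<Lambda> * b t" .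
    have "tail a t * b t \<le> \<Lambda> * (a t * tail b t)" using tail_a_b_le[OF t] by (simp add: mult.assoc)
    also have "\<dots> \<le> max 1 \<Lambda> * (a t * tail b t)"
      using A.pos[OF t0] B.tail_nonneg[OF t0] by (intro mult_right_mono) auto
    finally show "tail a t * b t \<le> max 1 \<Lambda> * a t * tail b t" by (simp add: mult.assoc)
  }
  assume t: "0 \<le> t"
  show "holo_map scale_pair (*) (domain s) (Hc t)" by (rule holo_Hc[OF t])
  show "Hc t (z + (cvec k, 0)) = Hc t z" if "z \<in> domain s" "k \<in> int_lattice" for z k
    using holo_ext_domain(2)[OF Fh_ext[OF t] that] holo_ext_domain(2)[OF Ff_ext[OF t] that] by (simp add: Hc_def)
  show "Hc t (cpair x) = complex_of_real (H t x)" if "norm (snd x) < s" for x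
    by (rule Hc_real[OF t that])
  { fix q :: "complex ^ 'n" and i assume q: "q \<in> open_strip s"
    have z: "(q, 0) \<in> domain s" using q s by (simp add: domain_def)
    have "fd (Hc t) (q, 0) u = fd (Fh t) (q, 0) u + fd (Ff t) (q, 0) u" for u
      unfolding Hc_def[abs_def] by (rule PC.fd_add[OF holo_Fh[OF t] holo_Ff[OF t] z])
    then show "cmod (fd (Hc t) (q, 0) (dp i) - complex_of_real (\<omega> $ i)) \<le> b t" "cmod (fd (Hc t) (q, 0) (dq i)) \<le> a t"
      using h_zero_section[OF t q] f_zero_section[OF t q] by simp_all
  }
  show "cmod (fd (\<lambda>z. fd (Hc t) z (dp j)) z (dp i)) \<le> M" if "z \<in> domain s" for z i j
    by (rule hessian_bound[OF t that])
qed

end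

section \<open>The limit Hamiltonian\<close>

context kam_problem
begin

text \<open>The part of \<open>f\<close> of degree at most one in the momenta. It is what prevents \<open>H\<close> from being in
  Kolmogorov normal form, and it carries the decay.\<close>

definition lin :: "real \<Rightarrow> 'n phase \<Rightarrow> real" where
  "lin t z = f t (fst z, 0) + grad_p (f t) (fst z, 0) \<bullet> snd z"

definition h' :: "real \<Rightarrow> 'n phase \<Rightarrow> real" where
  "h' t z = H t z - lin t z"

definition P :: "real \<Rightarrow> 'n \<Rightarrow> complex ^ 'n \<Rightarrow> complex" where
  "P t k q = fd (Ff t) (q, 0) (dp k)"

definition linc :: "real \<Rightarrow> 'n cphase \<Rightarrow> complex" where
  "linc t z = Ff t (fst z, 0) + (\<Sum>k\<in>UNIV. P t k (fst z) * snd z $ k)"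

definition V :: "'n cphase set" where "V = open_strip s \<times> UNIV"

lemma open_V: "open V" and domain_V: "domain s \<subseteq> V"
  unfolding V_def by (auto simp: domain_def intro!: open_Times open_open_strip)

lemma holo_P: "0 \<le> t \<Longrightarrow> holo_map scale_vec (*) (open_strip s) (P t k)"
  unfolding P_def[abs_def] by (rule zero_section_restriction(1)[OF PC.holo_map_fd[OF holo_Ff open_domain] s])

lemma holo_fst: "holo_map scale_pair scale_vec U fst" and holo_snd_nth: "holo_map scale_pair (*) U (\<lambda>z. snd z $ k)"
  by (intro holo_map_bounded_linear bounded_linear_fst; simp)
    (intro holo_map_bounded_linear bounded_linear_compose[OF bounded_linear_vec_nth bounded_linear_snd]; simp)

lemma holo_comp_fst:
  assumes "holo_map scale_vec (*) (open_strip s) F"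
  shows "holo_map scale_pair (*) V (\<lambda>z. F (fst z))"
    and "z \<in> V \<Longrightarrow> fd (\<lambda>z. F (fst z)) z v = fd F (fst z) (fst v)"
proof -
  have f: "z \<in> V \<Longrightarrow> fst z \<in> open_strip s" for z by (auto simp: V_def)
  show "holo_map scale_pair (*) V (\<lambda>z. F (fst z))"
    by (rule holo_map_compose[OF holo_fst assms f])
  have "fd fst z v = fst v" for z v :: "'n cphase"
    by (rule fd_eq[THEN fun_cong]) (rule has_derivative_fst[OF has_derivative_ident])
  then show "z \<in> V \<Longrightarrow> fd (\<lambda>z. F (fst z)) z v = fd F (fst z) (fst v)"
    using fd_compose[OF holo_fst assms _ f, of z V v] by simp
qed

lemma holo_linc:
  assumes t: "0 \<le> t"
  shows "holo_map scale_pair (*) V (linc t)"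
    and "z \<in> V \<Longrightarrow> fd (linc t) z v = fd (Ff t) (fst z, 0) (fst v, 0)
      + (\<Sum>k\<in>UNIV. P t k (fst z) * snd v $ k + fd (P t k) (fst z) (fst v) * snd z $ k)"
proof -
  note F0 = zero_section_restriction[OF holo_Ff[OF t] s]
  note h0 = holo_comp_fst(1)[OF F0(1)]
  have hm: "holo_map scale_pair (*) V (\<lambda>z. P t k (fst z) * snd z $ k)" for k
    by (rule holo_map_mult(1)[OF holo_comp_fst(1)[OF holo_P[OF t]] holo_snd_nth])
  have hs: "holo_map scale_pair (*) V (\<lambda>z. \<Sum>k\<in>UNIV. P t k (fst z) * snd z $ k)"
    by (rule PC.holo_map_sum) (rule hm)
  show "holo_map scale_pair (*) V (linc t)"
    unfolding linc_def[abs_def] by (rule PC.holo_map_add[OF h0 hs])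
  assume z: "z \<in> V"
  have n: "fd (\<lambda>z. snd z $ k) z v = snd v $ k" for k
    by (rule fd_eq[THEN fun_cong]) (rule bounded_linear_imp_has_derivative[OF bounded_linear_compose[OF bounded_linear_vec_nth bounded_linear_snd]])
  have "fd (linc t) z v = fd (\<lambda>z. Ff t (fst z, 0)) z v + fd (\<lambda>z. \<Sum>k\<in>UNIV. P t k (fst z) * snd z $ k) z v"
    unfolding linc_def[abs_def] by (rule PC.fd_add[OF h0 hs z])
  also have "fd (\<lambda>z. Ff t (fst z, 0)) z v = fd (Ff t) (fst z, 0) (fst v, 0)"
    using holo_comp_fst(2)[OF F0(1) z] F0(2)[of "fst z"] z by (simp add: V_def mem_Times_iff)
  also have "fd (\<lambda>z. \<Sum>k\<in>UNIV. P t k (fst z) * snd z $ k) z v = (\<Sum>k\<in>UNIV. fd (\<lambda>z. P t k (fst z) * snd z $ k) z v)"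
    by (rule fd_sum[OF hm z])
  also have "\<dots> = (\<Sum>k\<in>UNIV. P t k (fst z) * snd v $ k + fd (P t k) (fst z) (fst v) * snd z $ k)"
    by (rule sum.cong)
      (simp_all add: holo_map_mult(2)[OF holo_comp_fst(1)[OF holo_P[OF t]] holo_snd_nth z] n
        holo_comp_fst(2)[OF holo_P[OF t] z])
  finally show "fd (linc t) z v = fd (Ff t) (fst z, 0) (fst v, 0)
      + (\<Sum>k\<in>UNIV. P t k (fst z) * snd v $ k + fd (P t k) (fst z) (fst v) * snd z $ k)" .
qed

lemma linc_real:
  assumes t: "0 \<le> t"
  shows "linc t (cpair x) = complex_of_real (lin t x)"
proof -
  have x0: "norm (snd (fst x, 0 :: real ^ 'n)) < s" using s by simp
  have "P t k (cvec (fst x)) = complex_of_real (grad_p (f t) (fst x, 0) $ k)" for k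
    unfolding P_def cpair_zero_section by (rule domain_gradients(2)[OF holo_Ff[OF t] Ff_real[OF t] x0])
  moreover have "Ff t (cvec (fst x), 0) = complex_of_real (f t (fst x, 0))"
    unfolding cpair_zero_section by (rule Ff_real[OF t x0])
  ultimately show ?thesis by (simp add: linc_def lin_def inner_vec_def)
qed

lemma lin_gradients:
  assumes t: "0 \<le> t"
  shows "(lin t has_derivative (\<lambda>v. Re (fd (linc t) (cpair x) (cpair v)))) (at x)"
    and "fd (linc t) (cpair x) (dp k) = complex_of_real (grad_p (lin t) x $ k)"
    and "fd (linc t) (cpair x) (dq k) = complex_of_real (grad_q (lin t) x $ k)"
proof -
  have W: "cpair y \<in> V" for y using s by (simp add: V_def mem_Times_iff)
  note e = extension_gradients[OF holo_linc(1)[OF t] open_UNIV UNIV_I W linc_real[OF t]]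
  show "(lin t has_derivative (\<lambda>v. Re (fd (linc t) (cpair x) (cpair v)))) (at x)"
    "fd (linc t) (cpair x) (dp k) = complex_of_real (grad_p (lin t) x $ k)"
    "fd (linc t) (cpair x) (dq k) = complex_of_real (grad_q (lin t) x $ k)"
    by (rule e)+
qed

definition Elin :: "real \<Rightarrow> 'n cphase \<Rightarrow> 'n cphase" where
  "Elin t z = ((\<chi> k. fd (linc t) z (dp k)), (\<chi> k. - fd (linc t) z (dq k)))"

definition lin_bound :: "real \<Rightarrow> real" where
  "lin_bound t = real CARD('n) * b t + real CARD('n) * (a t + real CARD('n) * b t)"

lemma holo_Elin: "0 \<le> t \<Longrightarrow> holo_map scale_pair scale_pair (domain s) (Elin t)"
  unfolding Elin_def[abs_def]
  by (intro holo_map_subset[OF _ domain_V] holo_map_Pair holo_map_vec)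
    (auto intro!: PC.holo_map_minus PC.holo_map_fd[OF holo_linc(1) open_V])

lemma Elin_real: "0 \<le> t \<Longrightarrow> Elin t (cpair x) = cpair (ham_vf lin t x)"
  using lin_gradients by (simp add: Elin_def ham_vf_def prod_eq_iff vec_eq_iff)

lemma linc_periodic:
  assumes t: "0 \<le> t" and z: "z \<in> V" and k: "k \<in> int_lattice"
  shows "linc t (z + (cvec k, 0)) = linc t z"
proof -
  have z0: "(fst z, 0) \<in> domain s" using z s by (auto simp: V_def domain_def)
  have "Ff t ((fst z, 0) + (cvec k, 0)) = Ff t (fst z, 0)"
    by (rule holo_ext_domain(2)[OF Ff_ext[OF t] z0 k])
  moreover have "fd (Ff t) ((fst z, 0) + (cvec k, 0)) u = fd (Ff t) (fst z, 0) u" for u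
    by (rule fd_periodic[OF holo_Ff[OF t] open_domain _ holo_ext_domain(2)[OF Ff_ext[OF t] _ k] z0])
      (auto simp: domain_def)
  ultimately show ?thesis by (simp add: linc_def P_def)
qed

lemma Elin_periodic:
  assumes t: "0 \<le> t" and z: "z \<in> domain s" and k: "k \<in> int_lattice"
  shows "Elin t (z + (cvec k, 0)) = Elin t z"
proof -
  have "fd (linc t) (z + (cvec k, 0)) u = fd (linc t) z u" for u
    by (rule fd_periodic[OF holo_linc(1)[OF t] open_V _ linc_periodic[OF t _ k] subsetD[OF domain_V z]])
      (auto simp: V_def)
  then show ?thesis by (simp add: Elin_def)
qed

text \<open>The derivative of \<open>lin\<close> contains \<open>\<partial>\<^sub>q\<partial>\<^sub>pf(q,0) \<cdot> p\<close>, which decays like \<open>b\<close> by the Cauchy estimate. Its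
  radius \<open>s / 2\<close> is admissible because the imaginary part of \<open>q\<close> is at most \<open>s / 4\<close>.\<close>

lemma Elin_bound:
  assumes t: "0 \<le> t" and z: "z \<in> strip_ball (s / 4)"
  shows "norm (Elin t z) \<le> lin_bound t"
proof -
  have zd: "z \<in> domain s" using subsetD[OF strip_ball_subset_domain z, of s] s by simp
  then have zV: "z \<in> V" using domain_V by blast
  have q: "fst z \<in> open_strip s" using zV by (auto simp: V_def)
  have p: "norm (snd z) \<le> s / 4" and im: "norm (im_vec (fst z)) \<le> s / 4"
    using z by (auto simp: strip_ball_def strip_eq mem_Times_iff)
  have ab: "0 < a t" "0 < b t" using A.pos[OF t] B.pos[OF t] by auto
  have sub: "cball (fst z) (s / 2) \<subseteq> open_strip s"
  proof
    fix w assume "w \<in> cball (fst z) (s / 2)"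
    then have "norm (im_vec (w - fst z)) \<le> s / 2"
      using norm_im_vec_le[of "w - fst z"] by (simp add: dist_norm norm_minus_commute)
    then have "norm (im_vec w) \<le> s / 2 + s / 4"
      using im norm_triangle_ineq[of "im_vec (w - fst z)" "im_vec (fst z)"] by (simp add: im_vec_diff)
    then show "w \<in> open_strip s" using s by (simp add: open_strip_def)
  qed
  have dP: "cmod (fd (P t k) (fst z) (axis j 1)) \<le> b t / (s / 2)" for k j
  proof -
    have "cmod (fd (P t k) (fst z) (axis j 1)) \<le> b t / (s / 2) * norm (axis j (1 :: complex))"
      by (rule VC.Cauchy_estimate[OF holo_P[OF t] _ sub])
        (use s sub f_zero_section(1)[OF t] in \<open>auto simp: P_def\<close>)
    then show ?thesis by (simp add: norm_axis_complex)
  qed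
  have "cmod (fd (linc t) z (dp k)) \<le> b t" for k
  proof -
    have "fd (Ff t) (fst z, 0) 0 = 0" 
      using fd_linear[OF holo_Ff[OF t], of "(fst z, 0)"] q s by (simp add: domain_def bounded_linear.linear linear_0)
    moreover have "fd (P t j) (fst z) 0 = 0" for j
      using fd_linear[OF holo_P[OF t] q] by (simp add: bounded_linear.linear linear_0)
    moreover have "(\<Sum>j\<in>UNIV. P t j (fst z) * axis k 1 $ j) = P t k (fst z)"
      using sum.delta[of UNIV k "\<lambda>j. P t j (fst z)"] by (simp add: axis_def if_distrib cong: if_cong)
    ultimately have "fd (linc t) z (dp k) = P t k (fst z)"
      by (simp add: holo_linc(2)[OF t zV] dp_def zero_prod_def)
    then show ?thesis using f_zero_section(1)[OF t q] by (simp add: P_def)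
  qed
  then have 1: "norm (fst (Elin t z)) \<le> real CARD('n) * b t"
    unfolding Elin_def by (auto intro!: norm_vec_le_card)
  have "cmod (fd (linc t) z (dq k)) \<le> a t + real CARD('n) * b t" for k
  proof -
    have "cmod (fd (P t j) (fst z) (axis k 1) * snd z $ j) \<le> b t" for j
    proof -
      have "cmod (snd z $ j) \<le> s / 4"
        using Finite_Cartesian_Product.norm_nth_le[of "snd z" j] p by linarith
      then have "cmod (fd (P t j) (fst z) (axis k 1) * snd z $ j) \<le> b t / (s / 2) * (s / 4)"
        unfolding norm_mult using dP[of j k] ab s by (intro mult_mono) auto
      also have "\<dots> \<le> b t" using ab s by simp
      finally show ?thesis .
    qed
    then have "cmod (\<Sum>j\<in>UNIV. fd (P t j) (fst z) (axis k 1) * snd z $ j) \<le> real CARD('n) * b t"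
      using sum_norm_le[of UNIV "\<lambda>j. fd (P t j) (fst z) (axis k 1) * snd z $ j" "\<lambda>_. b t"] by simp
    moreover have "fd (linc t) z (dq k) = fd (Ff t) (fst z, 0) (dq k)
        + (\<Sum>j\<in>UNIV. fd (P t j) (fst z) (axis k 1) * snd z $ j)"
      by (simp add: holo_linc(2)[OF t zV] dq_def)
    ultimately show ?thesis
      using f_zero_section(2)[OF t q, of k] norm_triangle_ineq[of "fd (Ff t) (fst z, 0) (dq k)"
          "\<Sum>j\<in>UNIV. fd (P t j) (fst z) (axis k 1) * snd z $ j"] by simp
  qed
  then have 2: "norm (snd (Elin t z)) \<le> real CARD('n) * (a t + real CARD('n) * b t)"
    unfolding Elin_def by (auto intro!: norm_vec_le_card)
  show ?thesis
    using norm_Pair_le[of "fst (Elin t z)" "snd (Elin t z)"] 1 2 by (simp add: lin_bound_def)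
qed

lemma lin_bound_tendsto: "(lin_bound \<longlongrightarrow> 0) at_top"
proof -
  have "(lin_bound \<longlongrightarrow> real CARD('n) * 0 + real CARD('n) * (0 + real CARD('n) * 0)) at_top"
    unfolding lin_bound_def[abs_def] by (intro tendsto_intros A.tendsto_0 B.tendsto_0)
  then show ?thesis by simp
qed

lemma real_analytic_lin:
  assumes t: "0 \<le> t"
  shows "real_analytic scale_pair cpair (phase_space R) (lin t)"
  unfolding real_analytic_def cholomorphic_eq_holo_map
  using open_V holo_linc(1)[OF t] linc_real[OF t] s
  by (intro ballI exI[of _ V] exI[of _ "linc t"]) (auto simp: V_def)

lemma periodic_H: "0 \<le> t \<Longrightarrow> periodic_on_phase R (H t)"
  using h_analytic[of t] f_analytic[of t] H_eq[of t]
  by (auto simp: analytic_on_phase_def periodic_on_phase_def phase_space_def phase_lattice_def)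

lemma periodic_lin:
  assumes t: "0 \<le> t"
  shows "periodic_on_phase R (lin t)"
proof -
  have f: "periodic_on_phase R (f t)" using f_analytic[OF t] by (simp add: analytic_on_phase_def)
  have "lin t (z + k) = lin t z" if k: "k \<in> phase_lattice" for z k
  proof -
    have z0: "(fst z, 0) \<in> phase_space R" and k0: "snd k = 0" and kk: "(fst z + fst k, 0) = (fst z, 0) + k"
      using k s sR by (auto simp: phase_space_def phase_lattice_def)
    have "f t ((fst z, 0) + k) = f t (fst z, 0)" "ham_vf f t ((fst z, 0) + k) = ham_vf f t (fst z, 0)"
      using f periodic_ham_vf[of R f t, OF f] z0 k by (auto simp: periodic_on_phase_def)
    then show ?thesis by (simp add: lin_def k0 ham_vf_def kk del: add_Pair)
  qed
  then show ?thesis by (simp add: periodic_on_phase_def)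
qed

lemma analytic_H: 
  assumes t: "0 \<le> t"
  shows "analytic_on_phase R (H t)"
proof -
  have "real_analytic scale_pair cpair (phase_space R) (H t)"
    by (rule real_analytic_add_scaled[of R "h t" "f t" "H t" 1])
      (use h_analytic[OF t] f_analytic[OF t] H_eq[OF t] in \<open>auto simp: analytic_on_phase_def\<close>)
  then show ?thesis using periodic_H[OF t] by (simp add: analytic_on_phase_def)
qed

lemma periodic_h': "0 \<le> t \<Longrightarrow> periodic_on_phase R (h' t)"
  using periodic_H[of t] periodic_lin[of t] by (auto simp: periodic_on_phase_def h'_def)

lemma analytic_h':
  assumes t: "0 \<le> t"
  shows "analytic_on_phase R (h' t)"
proof -
  have "real_analytic scale_pair cpair (phase_space R) (h' t)"
    by (rule real_analytic_add_scaled[of R "H t" "lin t" "h' t" "-1"])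
      (use analytic_H[OF t] real_analytic_lin[OF t] in \<open>auto simp: analytic_on_phase_def h'_def\<close>)
  then show ?thesis using periodic_h'[OF t] by (simp add: analytic_on_phase_def)
qed

lemma differentiable_H:
  assumes "0 \<le> t" "x \<in> phase_space R"
  shows "\<exists>D. (H t has_derivative D) (at x)"
  using real_analytic_ham_vf(2)[of R H t x] analytic_H[OF assms(1)] assms(2) by (simp add: analytic_on_phase_def)

lemma ham_vf_h':
  assumes t: "0 \<le> t" and x: "x \<in> phase_space R"
  shows "ham_vf H t x - ham_vf h' t x = ham_vf lin t x"
proof -
  obtain D where D: "(H t has_derivative D) (at x)" using differentiable_H[OF t x] by blast
  obtain D' where D': "(lin t has_derivative D') (at x)" using lin_gradients(1)[OF t] by blast
  have d: "(h' t has_derivative (\<lambda>v. D v - D' v)) (at x)"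
    unfolding h'_def[abs_def] by (rule has_derivative_diff[OF D D'])
  show ?thesis
    by (simp add: ham_vf_def prod_eq_iff vec_eq_iff partial_gradients(1,2)[OF d] partial_gradients(1,2)[OF D]
        partial_gradients(1,2)[OF D'])
qed

text \<open>Near the zero section \<open>h'\<close> is \<open>h\<close> plus a function that vanishes there to second order.\<close>

lemma h'_kolmogorov: "h' \<in> kolmogorov_nf R \<omega>"
proof -
  obtain c where c: "\<And>q t. 0 \<le> t \<Longrightarrow> h t (q, 0) = c" "\<And>q t. 0 \<le> t \<Longrightarrow> GDERIV (\<lambda>p. h t (q, p)) 0 :> \<omega>"
    using h_nf by (auto simp: kolmogorov_nf_def)
  have R: "0 < R" using s sR by simp
  have "h' t (q, 0) = c" if t: "0 \<le> t" for q t
    using H_eq[OF t, of "(q, 0)"] c(1)[OF t] R by (simp add: h'_def lin_def phase_space_def)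
  moreover have "GDERIV (\<lambda>p. h' t (q, p)) 0 :> \<omega>" if t: "0 \<le> t" for q t
  proof -
    have qR: "(q, 0) \<in> phase_space R" using R by (simp add: phase_space_def)
    obtain D where D: "(f t has_derivative D) (at (q, 0))"
      using real_analytic_ham_vf(2)[of R f t "(q, 0)"] f_analytic[OF t] qR by (auto simp: analytic_on_phase_def)
    have 1: "((\<lambda>p. h t (q, p)) has_derivative (\<lambda>v. v \<bullet> \<omega>)) (at 0)"
      using c(2)[OF t] by (simp add: gderiv_def)
    have 2: "((\<lambda>p. f t (q, p)) has_derivative (\<lambda>v. v \<bullet> grad_p (f t) (q, 0))) (at 0)"
      using partial_gradients(3)[OF D] by (simp add: gderiv_def)
    have 3: "((\<lambda>p. f t (q, 0) + grad_p (f t) (q, 0) \<bullet> p) has_derivative (\<lambda>v. grad_p (f t) (q, 0) \<bullet> v)) (at 0)"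
      by (auto intro!: derivative_eq_intros)
    have "((\<lambda>p. h t (q, p) + f t (q, p) - (f t (q, 0) + grad_p (f t) (q, 0) \<bullet> p)) has_derivative (\<lambda>v. v \<bullet> \<omega>)) (at 0)"
      using has_derivative_diff[OF has_derivative_add[OF 1 2] 3] by (simp add: inner_commute)
    then have "((\<lambda>p. h' t (q, p)) has_derivative (\<lambda>v. v \<bullet> \<omega>)) (at 0)"
      by (rule has_derivative_transform_within_open[of _ _ _ _ "ball 0 R"])
        (use R H_eq[OF t] in \<open>auto simp: h'_def lin_def phase_space_def\<close>)
    then show ?thesis by (simp add: gderiv_def)
  qed
  ultimately show ?thesis
    using periodic_h' by (auto simp: kolmogorov_nf_def)
qed

lemma ham_vf_H:
  assumes t: "0 \<le> t" and x: "norm (snd x) < s"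
  shows "cpair (ham_vf H t x) = CH.Y t (cpair x) + (cvec \<omega>, 0)"
proof -
  note g = domain_gradients(2,3)[OF holo_Hc[OF t] Hc_real[OF t] x]
  show ?thesis
    by (simp add: CH.Y_def ham_vf_def prod_eq_iff vec_eq_iff g)
qed

lemma phase_norm_difference:
  assumes t: "0 \<le> t"
  shows "phase_norm (s / 4) (\<lambda>z. ham_vf H t z - ham_vf h' t z) \<le> ennreal (lin_bound t)"
proof (rule phase_norm_le[OF _ holo_Elin[OF t] Elin_periodic[OF t] _ Elin_bound[OF t]])
  show "s / 4 < s" using s by simp
  show "Elin t (cpair x) = cpair (ham_vf H t x - ham_vf h' t x)" if "norm (snd x) < s" for x
    using Elin_real[OF t] ham_vf_h'[OF t in_phase_space[OF that]] by simp
qed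

text \<open>A bound at fixed time; it serves only to show that the norms of the vector fields are finite.\<close>

definition Y_bound :: "real \<Rightarrow> real" where
  "Y_bound t = (real CARD('n) * b t + CH.C1 * (s / 4)) + (real CARD('n) * a t + CH.C3 * (b t + s / 4) * (s / 4)) + norm \<omega>"

lemma Y_bound:
  assumes t: "0 \<le> t" and z: "z \<in> strip_ball (s / 4)"
  shows "norm (CH.Y t z + (cvec \<omega>, 0)) \<le> Y_bound t"
proof -
  have zd: "z \<in> domain s" "z \<in> domain (s / 2)"
    using subsetD[OF strip_ball_subset_domain z] s by auto
  have p: "norm (snd z) \<le> s / 4" using z by (auto simp: strip_ball_def mem_Times_iff)
  have b: "0 < b t" using B.pos[OF t] .
  have "norm (fst (CH.Y t z)) \<le> real CARD('n) * b t + CH.C1 * norm (snd z)" by (rule CH.fst_Y_bound[OF t zd(1)])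
  also have "\<dots> \<le> real CARD('n) * b t + CH.C1 * (s / 4)"
    using p CH.constants by (intro add_mono mult_left_mono) auto
  finally have 1: "norm (fst (CH.Y t z)) \<le> real CARD('n) * b t + CH.C1 * (s / 4)" .
  have "norm (snd (CH.Y t z)) \<le> real CARD('n) * a t + CH.C3 * (b t + norm (snd z)) * norm (snd z)"
    by (rule CH.snd_Y_bound[OF t zd(2)])
  also have "\<dots> \<le> real CARD('n) * a t + CH.C3 * (b t + s / 4) * (s / 4)"
    using p CH.constants b s by (intro add_mono mult_mono mult_left_mono order_refl) auto
  finally have 2: "norm (snd (CH.Y t z)) \<le> real CARD('n) * a t + CH.C3 * (b t + s / 4) * (s / 4)" .
  have "norm (CH.Y t z + (cvec \<omega>, 0)) \<le> norm (CH.Y t z) + norm (cvec \<omega>, 0 :: complex ^ 'n)"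
    by (rule norm_triangle_ineq)
  also have "\<dots> \<le> norm (fst (CH.Y t z)) + norm (snd (CH.Y t z)) + norm \<omega>"
    using norm_Pair_le[of "fst (CH.Y t z)" "snd (CH.Y t z)"] by (simp add: norm_Pair)
  finally show ?thesis using 1 2 by (simp add: Y_bound_def)
qed

lemma holo_EH: "0 \<le> t \<Longrightarrow> holo_map scale_pair scale_pair (domain s) (\<lambda>z. CH.Y t z + (cvec \<omega>, 0))"
  by (intro PP.holo_map_add CH.holo_map_Y PP.holo_map_const)

lemma EH_periodic:
  "0 \<le> t \<Longrightarrow> z \<in> domain s \<Longrightarrow> k \<in> int_lattice \<Longrightarrow> CH.Y t (z + (cvec k, 0)) = CH.Y t z"
  using CH.fd_H_periodic by (simp add: CH.Y_def)

lemma phase_norm_H: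
  assumes t: "0 \<le> t"
  shows "phase_norm (s / 4) (ham_vf H t) < \<infinity>"
proof -
  have "phase_norm (s / 4) (ham_vf H t) \<le> ennreal (Y_bound t)"
    by (rule phase_norm_le[OF _ holo_EH[OF t] _ _ Y_bound[OF t]])
      (use s EH_periodic[OF t] ham_vf_H[OF t] in simp_all)
  then show ?thesis by (simp add: le_less_trans)
qed

lemma phase_norm_h':
  assumes t: "0 \<le> t"
  shows "phase_norm (s / 4) (ham_vf h' t) < \<infinity>"
proof -
  have "phase_norm (s / 4) (ham_vf h' t) \<le> ennreal (Y_bound t + lin_bound t)"
  proof (rule phase_norm_le[OF _ PP.holo_map_diff[OF holo_EH[OF t] holo_Elin[OF t]]])
    show "s / 4 < s" using s by simp
    show "CH.Y t (z + (cvec k, 0)) + (cvec \<omega>, 0) - Elin t (z + (cvec k, 0)) = CH.Y t z + (cvec \<omega>, 0) - Elin t z"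
      if "z \<in> domain s" "k \<in> int_lattice" for z k
      using EH_periodic[OF t that] Elin_periodic[OF t that] by simp
    show "CH.Y t (cpair x) + (cvec \<omega>, 0) - Elin t (cpair x) = cpair (ham_vf h' t x)" if "norm (snd x) < s" for x
    proof -
      have "ham_vf h' t x = ham_vf H t x - ham_vf lin t x"
        using ham_vf_h'[OF t in_phase_space[OF that]] by (simp add: algebra_simps)
      then show ?thesis
        using ham_vf_H[OF t that] Elin_real[OF t, of x]
        by (simp only: linear_diff[OF bounded_linear.linear[OF bounded_linear_cpair]])
    qed
    show "norm (CH.Y t z + (cvec \<omega>, 0) - Elin t z) \<le> Y_bound t + lin_bound t" if "z \<in> strip_ball (s / 4)" for z
      using Y_bound[OF t that] Elin_bound[OF t that] norm_triangle_ineq4[of "CH.Y t z + (cvec \<omega>, 0)" "Elin t z"]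
      by linarith
  qed
  then show ?thesis by (simp add: le_less_trans)
qed

lemma h'_zero_section:
  assumes t: "0 \<le> t"
  shows "ham_vf h' t (q, 0) = (\<omega>, 0)"
proof -
  obtain c where c: "\<And>q. h' t (q, 0) = c" "GDERIV (\<lambda>p. h' t (q, p)) 0 :> \<omega>"
    using h'_kolmogorov t by (auto simp: kolmogorov_nf_def)
  then show ?thesis
    using grad_unique[OF c(2)] grad_unique[OF GDERIV_const, of c q] by (simp add: ham_vf_def grad_p_def grad_q_def)
qed

end

section \<open>The asymptotic torus\<close>

locale kam_solution = kam_problem a b \<upsilon> \<Lambda> s R \<omega> H h f Fh Ff
    + AS: asymptotic_system a b \<upsilon> "max 1 \<Lambda>" CH.C "s / 4" T \<omega> CH.Y
  for a b :: "real \<Rightarrow> real" and \<upsilon> \<Lambda> s R :: real and \<omega> :: "real ^ 'n"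
    and H h f :: "real \<Rightarrow> 'n::finite phase \<Rightarrow> real" and Fh Ff :: "real \<Rightarrow> 'n cphase \<Rightarrow> complex" and T :: real +
  fixes W :: "real \<Rightarrow> complex ^ 'n \<Rightarrow> 'n cphase"
  assumes W: "AS.solution W"
begin

lemma W_admissible: "AS.admissible W"
  using W by (simp add: AS.solution_def)

text \<open>The embedding at time \<open>t\<close> is parametrised by the current phase \<open>q\<close>; the trajectory through that point is
  labelled by the phase \<open>q - t \<omega>\<close> of the unperturbed motion at time zero.\<close>

definition E :: "real \<Rightarrow> complex ^ 'n \<Rightarrow> 'n cphase" where
  "E t q = W t (q - t *\<^sub>R cvec \<omega>)"

definition w :: "real \<Rightarrow> real ^ 'n \<Rightarrow> 'n phase" where
  "w t x = re_pair (E t (cvec x))"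

lemma comoving_in_strip: "q \<in> AS.S \<Longrightarrow> q - t *\<^sub>R cvec \<omega> \<in> AS.S"
  by (simp add: open_strip_def im_vec_diff im_vec_scaleR)

lemma comoving_cvec: "cvec x - t *\<^sub>R cvec \<omega> = cvec (x - t *\<^sub>R \<omega>)"
  by (simp add: cvec_diff cvec_scaleR)

lemma holo_E:
  assumes t: "T \<le> t"
  shows "holo_map scale_vec scale_pair AS.S (E t)"
    and "q \<in> AS.S \<Longrightarrow> fd (E t) q v = fd (W t) (q - t *\<^sub>R cvec \<omega>) v"
proof -
  have "q \<in> AS.S \<Longrightarrow> q + (- (t *\<^sub>R cvec \<omega>)) \<in> AS.S" for q
    using comoving_in_strip[of q t] by simp
  from VP.holo_map_shift[OF AS.admissibleD(2)[OF W_admissible t] this]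
  show "holo_map scale_vec scale_pair AS.S (E t)"
    "q \<in> AS.S \<Longrightarrow> fd (E t) q v = fd (W t) (q - t *\<^sub>R cvec \<omega>) v"
    unfolding E_def[abs_def] by simp_all
qed

lemma E_tube: "T \<le> t \<Longrightarrow> q \<in> AS.S \<Longrightarrow> E t q \<in> AS.tube t"
  using AS.admissibleD(3)[OF W_admissible _ comoving_in_strip] by (simp add: E_def)

lemma E_periodic:
  assumes "T \<le> t" "q \<in> AS.S" "k \<in> int_lattice"
  shows "E t (q + cvec k) = E t q"
proof -
  have "q + cvec k - t *\<^sub>R cvec \<omega> = (q - t *\<^sub>R cvec \<omega>) + cvec k" by simp
  then show ?thesis
    using AS.admissibleD(4)[OF W_admissible assms(1) comoving_in_strip[OF assms(2)] assms(3)] by (simp only: E_def)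
qed

lemma E_real:
  assumes "T \<le> t"
  shows "E t (cvec x) = cpair (w t x)"
proof -
  obtain y where "W t (cvec (x - t *\<^sub>R \<omega>)) = cpair y"
    using AS.admissibleD(5)[OF W_admissible assms] by blast
  then show ?thesis
    by (simp add: w_def E_def comoving_cvec del: cpair_simps(1))
qed

lemma cvec_in_S: "cvec x \<in> AS.S"
  using AS.\<rho> by simp

lemma torus:
  assumes t: "T \<le> t"
  shows "perturbed_zero_section (s / 4 / 2) R (E t) (w t)"
proof
  note tb = AS.time_bounds[OF t]
  show "0 < s / 4 / 2" using s by simp
  show "holo_map scale_vec scale_pair AS.S (E t)" by (rule holo_E(1)[OF t])
  show "\<And>q k. q \<in> AS.S \<Longrightarrow> k \<in> int_lattice \<Longrightarrow> E t (q + cvec k) = E t q" by (rule E_periodic[OF t])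
  show "\<And>x. E t (cvec x) = cpair (w t x)" by (rule E_real[OF t])
  show "norm (snd (w t x)) < R" for x
  proof -
    have "norm (snd (w t x)) = norm (snd (E t (cvec x)))" by (simp add: E_real[OF t])
    also have "\<dots> \<le> 2 * CH.C * tail a t" using E_tube[OF t cvec_in_S] by (simp add: AS.tube_def)
    also have "\<dots> \<le> 2 * CH.C * tail a T" using tb AS.constants by (intro mult_left_mono) auto
    finally show ?thesis using AS.small_a s sR by linarith
  qed
  show "norm (fst (fd (E t) (cvec x) (cvec v))) \<le> 1 / 2 * norm v" for x v
  proof -
    have "norm (fst (fd (E t) (cvec x) (cvec v))) \<le> AS.L * tail b t / (s / 4 / 4) * norm v"
      using AS.solution_fd_bound(1)[OF W_admissible t, of "x - t *\<^sub>R \<omega>" "cvec v"] holo_E(2)[OF t cvec_in_S]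
      by (simp add: comoving_cvec)
    also have "\<dots> \<le> 1 / 2 * norm v"
    proof (rule mult_right_mono)
      have "AS.L * tail b t \<le> AS.L * tail b T" using tb AS.constants by (intro mult_left_mono) auto
      also have "\<dots> \<le> s / 4 / 8" by (rule AS.small_b(1))
      finally show "AS.L * tail b t / (s / 4 / 4) \<le> 1 / 2" using s by (simp add: field_simps)
    qed simp
    finally show ?thesis .
  qed
qed

definition \<phi> :: "real \<Rightarrow> real ^ 'n \<Rightarrow> 'n phase" where
  "\<phi> t x = (x, 0) + w t x"

lemma phi_eq: "T \<le> t \<Longrightarrow> perturbed_zero_section.\<phi> (w t) = \<phi> t"
  by (rule ext) (simp add: perturbed_zero_section.\<phi>_def[OF torus] \<phi>_def)

lemma embedding: "T \<le> t \<Longrightarrow> analytic_embedding R (\<phi> t)"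
  using perturbed_zero_section.analytic_embedding[OF torus] phi_eq by metis

lemma Lagrangian:
  assumes t: "T \<le> t"
  shows "lagrangian_torus (\<phi> t)"
proof -
  have "csymp ((cvec u, 0) + fd (E t) (cvec x) (cvec u)) ((cvec v, 0) + fd (E t) (cvec x) (cvec v)) = 0" for x u v
    unfolding holo_E(2)[OF t cvec_in_S] comoving_cvec
    by (rule AS.solution_isotropic[OF W t CH.fd_Y_skew]) (use domain_mono[of "s / 4" s] s in auto)
  from perturbed_zero_section.lagrangian[OF torus[OF t] this] show ?thesis
    by (simp add: phi_eq[OF t])
qed

definition decay :: "real \<Rightarrow> real" where
  "decay t = AS.L * tail b t + 2 * CH.C * tail a t"

lemma torus_norm_phi:
  assumes t: "T \<le> t"
  shows "torus_norm (s / 4 / 4) (\<lambda>q. \<phi> t q - (q, 0)) \<le> ennreal (decay t)"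
proof -
  have "torus_norm (s / 4 / 4) (w t) \<le> ennreal (decay t)"
  proof (rule torus_norm_le[OF _ holo_E(1)[OF t] E_periodic[OF t] E_real[OF t]])
    show "s / 4 / 4 < s / 4 / 2" using s by simp
    fix q :: "complex ^ 'n" assume "q \<in> strip (s / 4 / 4)"
    then have "q \<in> AS.S" using strip_subset_open_strip[of "s / 4 / 4" "s / 4 / 2"] s by auto
    then show "norm (E t q) \<le> decay t"
      using E_tube[OF t] AS.norm_pair_le[of "E t q"] by (force simp: AS.tube_def decay_def)
  qed
  then show ?thesis by (simp add: \<phi>_def)
qed

lemma decay_tendsto: "(decay \<longlongrightarrow> 0) at_top"
proof -
  have "(decay \<longlongrightarrow> AS.L * 0 + 2 * CH.C * 0) at_top"
    unfolding decay_def[abs_def] by (intro tendsto_intros A.tail_tendsto_0 B.tail_tendsto_0)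
  then show ?thesis by simp
qed

text \<open>The time derivative of \<open>\<phi>\<close> at fixed \<open>q\<close> is the velocity along the trajectory minus the transport term
  \<open>\<partial>\<^sub>q\<phi> \<omega>\<close>. The constant field \<open>(\<omega>, 0)\<close>, which \<open>Y\<close> does not contain, cancels in this difference.\<close>

lemma invariance:
  assumes t: "T \<le> t"
  shows "\<exists>d. ((\<lambda>\<tau>. \<phi> \<tau> x) has_vector_derivative d) (at t within {T..}) \<and>
    ham_vf H t (\<phi> t x) = fd (\<phi> t) x \<omega> + d"
proof -
  let ?y = "cvec (x - t *\<^sub>R \<omega>) :: complex ^ 'n"
  have t0: "0 \<le> t" using AS.T_nonneg t by simp
  define d where "d = re_pair (AS.field W t ?y) - re_pair (fd (E t) (cvec x) (cvec \<omega>))"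
  have "((\<lambda>\<tau>. E \<tau> (cvec x)) has_vector_derivative AS.field W t ?y - fd (E t) (cvec x) (cvec \<omega>)) (at t within {T..})"
    using AS.solution_comoving_derivative[OF W t cvec_in_S[of x]]
    by (simp add: E_def[abs_def] holo_E(2)[OF t cvec_in_S, unfolded E_def[abs_def]] comoving_cvec)
  from bounded_linear.has_vector_derivative[OF bounded_linear_re_pair this]
  have "((\<lambda>\<tau>. w \<tau> x) has_vector_derivative d) (at t within {T..})"
    by (simp add: w_def[abs_def] d_def linear_diff[OF bounded_linear.linear[OF bounded_linear_re_pair]])
  then have 1: "((\<lambda>\<tau>. \<phi> \<tau> x) has_vector_derivative d) (at t within {T..})"
    unfolding \<phi>_def using has_vector_derivative_add[OF has_vector_derivative_const] by fastforce
  have orbit: "cpair (\<phi> t x) = AS.base t ?y + W t ?y"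
  proof -
    have "W t ?y = cpair (w t x)" using E_real[OF t, of x] by (simp add: E_def comoving_cvec)
    then show ?thesis by (simp add: \<phi>_def cpair_add AS.base_cvec)
  qed
  have "AS.base t ?y + W t ?y \<in> domain (s / 4)"
    by (rule AS.tube_in_domain[OF t cvec_in_S AS.admissibleD(3)[OF W_admissible t cvec_in_S]])
  then have "norm (snd (\<phi> t x)) < s"
    using s unfolding orbit[symmetric] by (auto simp: domain_def mem_Times_iff simp del: cpair_simps(1))
  from ham_vf_H[OF t0 this] have "cpair (ham_vf H t (\<phi> t x)) = AS.field W t ?y + (cvec \<omega>, 0)"
    by (simp add: orbit AS.field_def)
  then have "ham_vf H t (\<phi> t x) = re_pair (AS.field W t ?y + cpair (\<omega>, 0))"
    by (metis re_pair_cpair cpair_zero_section)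
  also have "\<dots> = re_pair (AS.field W t ?y) + (\<omega>, 0)"
    by (simp only: linear_add[OF bounded_linear.linear[OF bounded_linear_re_pair]] re_pair_cpair)
  also have "\<dots> = fd (\<phi> t) x \<omega> + d"
    using perturbed_zero_section.derivative_phi(2)[OF torus[OF t], of x \<omega>]
    by (simp add: d_def phi_eq[OF t])
  finally show ?thesis using 1 by blast
qed

lemma zero_section_embedding: "analytic_embedding R (\<lambda>q :: real ^ 'n. (q, 0))"
  and zero_section_derivative: "fd (\<lambda>q :: real ^ 'n. (q, 0 :: real ^ 'n)) q v = (v, 0)"
proof -
  have fd0: "fd (\<lambda>_. 0 :: 'n cphase) z u = 0" for z :: "complex ^ 'n" and u
    by (simp add: frechet_derivative_const)
  interpret Z: perturbed_zero_section 1 R "\<lambda>_. 0" "\<lambda>_. 0 :: 'n phase"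
    using s sR by unfold_locales (auto simp: fd0 prod_eq_iff)
  have "Z.\<phi> = (\<lambda>q. (q, 0))" by (rule ext) (simp add: Z.\<phi>_def)
  then show "analytic_embedding R (\<lambda>q :: real ^ 'n. (q, 0))" using Z.analytic_embedding by simp
  show "fd (\<lambda>q :: real ^ 'n. (q, 0 :: real ^ 'n)) q v = (v, 0)"
    by (rule fd_eq[THEN fun_cong]) (auto intro!: derivative_eq_intros)
qed

lemma ennreal_squeeze:
  fixes g :: "real \<Rightarrow> ennreal"
  assumes "(c \<longlongrightarrow> 0) at_top" "\<And>t. t0 \<le> t \<Longrightarrow> g t \<le> ennreal (c t)"
  shows "(g \<longlongrightarrow> 0) at_top"
proof (rule tendsto_sandwich[OF _ _ tendsto_const])
  show "\<forall>\<^sub>F t in at_top. 0 \<le> g t" by simp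
  show "\<forall>\<^sub>F t in at_top. g t \<le> ennreal (c t)"
    using eventually_ge_at_top[of t0] by eventually_elim (rule assms(2))
  show "((\<lambda>t. ennreal (c t)) \<longlongrightarrow> 0) at_top"
    using tendsto_ennrealI[OF assms(1)] by simp
qed

lemma asymptotic_KAM_torus:
  "asymptotic_KAM_torus R \<omega> (ham_vf H) (ham_vf h') (\<lambda>q. (q, 0)) T \<phi>"
  unfolding asymptotic_KAM_torus_def
proof (rule exI[of _ 0], intro conjI order_refl, rule exI[of _ "s / 4"], intro conjI allI impI)
  show "0 < s / 4" "s / 4 < R" using s sR by auto
  show "0 \<le> T" by (rule AS.T_nonneg)
  show "analytic_embedding R (\<lambda>q :: real ^ 'n. (q, 0))" by (rule zero_section_embedding)
  show "((\<lambda>t. phase_norm (s / 4) (\<lambda>z. ham_vf H t z - ham_vf h' t z)) \<longlongrightarrow> 0) at_top"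
    by (rule ennreal_squeeze[OF lin_bound_tendsto phase_norm_difference])
  show "\<exists>s'>0. s' \<le> s / 4 \<and> (\<forall>t\<ge>T. torus_norm s' (\<lambda>q. \<phi> t q - (q, 0)) < \<infinity>) \<and>
      ((\<lambda>t. torus_norm s' (\<lambda>q. \<phi> t q - (q, 0))) \<longlongrightarrow> 0) at_top"
  proof (intro exI[of _ "s / 4 / 4"] conjI allI impI)
    show "0 < s / 4 / 4" "s / 4 / 4 \<le> s / 4" using s by auto
    show "torus_norm (s / 4 / 4) (\<lambda>q. \<phi> t q - (q, 0)) < \<infinity>" if "T \<le> t" for t
      using torus_norm_phi[OF that] by (simp add: le_less_trans)
    show "((\<lambda>t. torus_norm (s / 4 / 4) (\<lambda>q. \<phi> t q - (q, 0))) \<longlongrightarrow> 0) at_top"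
      by (rule ennreal_squeeze[OF decay_tendsto torus_norm_phi])
  qed
  fix t :: real
  show "analytic_embedding R (\<phi> t)" if "T \<le> t" by (rule embedding[OF that])
  show "\<exists>d. ((\<lambda>\<tau>. \<phi> \<tau> q) has_vector_derivative d) (at t within {T..}) \<and>
      ham_vf H t (\<phi> t q) = fd (\<phi> t) q \<omega> + d" if "T \<le> t" for q
    by (rule invariance[OF that])
  assume t: "0 \<le> t"
  show "analytic_on_phase R (ham_vf H t)" by (rule analytic_on_phase_ham_vf[of R H t, OF analytic_H[OF t]])
  show "analytic_on_phase R (ham_vf h' t)" by (rule analytic_on_phase_ham_vf[of R h' t, OF analytic_h'[OF t]])
  show "phase_norm (s / 4) (ham_vf H t) < \<infinity>" by (rule phase_norm_H[OF t])
  show "phase_norm (s / 4) (ham_vf h' t) < \<infinity>" by (rule phase_norm_h'[OF t])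
  show "ham_vf h' t (q, 0) = fd (\<lambda>q. (q, 0)) q \<omega>" for q
    using h'_zero_section[OF t] by (simp add: zero_section_derivative)
qed

end

theorem theoremB:
  fixes \<omega> :: "real ^ 'n"
    and s\<^sub>0 R \<upsilon> \<Lambda> :: real
    and a b :: "real \<Rightarrow> real"
    and H h f :: "real \<Rightarrow> 'n::finite phase \<Rightarrow> real"
  assumes "s\<^sub>0 > 0" and "s\<^sub>0 < R"
    and "\<forall>t\<ge>0. a t > 0" and "antimono_on {0..} a" and "a integrable_on {0..}"
    and "\<forall>t\<ge>0. b t > 0" and "antimono_on {0..} b" and "b integrable_on {0..}"
    and "\<upsilon> \<ge> 0"
    and "\<forall>t\<ge>\<upsilon>. integral {t..} a \<le> \<Lambda> * b t"
    and "\<forall>t\<ge>\<upsilon>. integral {t..} a * b t \<le> \<Lambda> * a t * integral {t..} b"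
    and "\<forall>t\<ge>0. \<forall>z\<in>phase_space R. H t z = h t z + f t z"
    and "h \<in> kolmogorov_nf R \<omega>"
    and "h \<in> analytic_space R 0 s\<^sub>0" and "f \<in> analytic_space R 0 s\<^sub>0"
    and "(SUP t\<in>{0..}. torus_norm s\<^sub>0 (\<lambda>q. f t (q, 0))) < \<infinity>"
    and "(SUP t\<in>{0..}. phase_norm s\<^sub>0 (hess_p (H t))) < \<infinity>"
    and "\<forall>t\<ge>0. torus_norm s\<^sub>0 (\<lambda>q. grad_q (f t) (q, 0)) \<le> ennreal (a t)"
    and "\<forall>t\<ge>0. torus_norm s\<^sub>0 (\<lambda>q. grad_p (f t) (q, 0)) \<le> ennreal (b t)"
  shows "\<exists>h'\<in>kolmogorov_nf R \<omega>. \<exists>\<phi> \<upsilon>'.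
           asymptotic_KAM_torus R \<omega> (ham_vf H) (ham_vf h') (\<lambda>q. (q, 0)) \<upsilon>' \<phi> \<and>
           (\<forall>t\<ge>\<upsilon>'. lagrangian_torus (\<phi> t))"
proof -
  obtain Fh where Fh: "continuous_on ({0..} \<times> strip_ball s\<^sub>0) (\<lambda>(t, z). Fh t z)"
    "\<forall>t\<ge>0. holo_ext scale_pair cpair phase_lattice (strip_ball s\<^sub>0) (h t) (Fh t)"
    "\<forall>t\<ge>0. analytic_on_phase R (h t)"
    using \<open>h \<in> analytic_space R 0 s\<^sub>0\<close> unfolding analytic_space_def by blast
  obtain Ff where Ff: "continuous_on ({0..} \<times> strip_ball s\<^sub>0) (\<lambda>(t, z). Ff t z)"
    "\<forall>t\<ge>0. holo_ext scale_pair cpair phase_lattice (strip_ball s\<^sub>0) (f t) (Ff t)"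
    "\<forall>t\<ge>0. analytic_on_phase R (f t)"
    using \<open>f \<in> analytic_space R 0 s\<^sub>0\<close> unfolding analytic_space_def by blast
  interpret kam_problem a b \<upsilon> \<Lambda> s\<^sub>0 R \<omega> H h f Fh Ff
    by unfold_locales (use assms Fh Ff in \<open>auto simp: tail_def\<close>)
  obtain T where "asymptotic_system a b \<upsilon> (max 1 \<Lambda>) CH.C (s\<^sub>0 / 4) T CH.Y"
    by (rule CH.asymptotic_system)
  then interpret AS: asymptotic_system a b \<upsilon> "max 1 \<Lambda>" CH.C "s\<^sub>0 / 4" T \<omega> CH.Y .
  obtain W where W: "AS.solution W"
    using AS.solution_exists by blast
  interpret kam_solution a b \<upsilon> \<Lambda> s\<^sub>0 R \<omega> H h f Fh Ff T W
    by unfold_locales (rule W)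
  show ?thesis
    using h'_kolmogorov asymptotic_KAM_torus Lagrangian by blast
qed

end
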